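(* Let $\Omega\subset\mathbb{R}^n$ be a smooth bounded domain and let $K:[0,+\infty)\to\mathbb{R}$ be a function. Assume that there exists an open interval $I\subseteq(0,+\infty)$ such that the restriction of $K$ to $I$ is (strictly) increasing and $K(I)=(0,+\infty)$. Let $f:[0,+\infty)\to[0,+\infty)$ be a continuous function, with $f(0)=0$, such that the function $\xi\mapsto\frac{f(\xi)}{\xi}$ is (strictly) decreasing in $(0,+\infty)$, $\lim_{\xi\to+\infty}\frac{f(\xi)}{\xi}=0$ and $\lim_{\xi\to0^+}\frac{f(\xi)}{\xi}=+\infty$. Then, for each $\alpha\in L^\infty(\Omega)$ with $\alpha>0$ in $\Omega$, the problem $$\begin{cases}-K\left(\int_\Omega|\nabla u(x)|^2dx\right)\Delta u=\alpha(x)f(u) & \text{in }\Omega\\ u>0 & \text{in }\Omega\\ u=0 & \text{on }\partial\Omega\\ \int_\Omega|\nabla u(x)|^2dx\in I\end{cases}$$ has a unique weak solution $\tilde u$, and $\tilde u$ is the unique global minimum in $H^1_0(\Omega)$ of the functional $$u\mapsto\frac12K\left(\int_\Omega|\nabla\tilde u(x)|^2dx\right)\int_\Omega|\nabla u(x)|^2dx-\int_\Omega\left(\alpha(x)\int_0^{u^+(x)}f(t)dt\right)dx.$$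
   Context: Here $u^+=\max\{0,u\}$. No continuity of $K$ on $[0,+\infty)$ is assumed. As usual for (classes of) measurable functions, pointwise inequalities such as $\alpha>0$ or $u>0$ in $\Omega$ are understood almost everywhere. A weak solution of the problem is a function $u\in H^1_0(\Omega)$, with $u>0$ in $\Omega$ and $\int_\Omega|\nabla u(x)|^2dx\in I$, such that for every $v\in H^1_0(\Omega)$ the function $x\mapsto\alpha(x)f(u(x))v(x)$ lies in $L^1(\Omega)$ and $$K\left(\int_\Omega|\nabla u(x)|^2dx\right)\int_\Omega\nabla u(x)\cdot\nabla v(x)\,dx-\int_\Omega\alpha(x)f(u(x))v(x)\,dx=0.$$ *)

theory Defs
  imports "HOL-Analysis.Analysis"
begin

primrec Ck :: "nat \<Rightarrow> ('a::euclidean_space \<Rightarrow> real) \<Rightarrow> bool" where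
  "Ck 0 f \<longleftrightarrow> continuous_on UNIV f"
| "Ck (Suc k) f \<longleftrightarrow> (\<forall>x. f differentiable (at x)) \<and>
     (\<forall>b\<in>Basis. Ck k (\<lambda>x. frechet_derivative f (at x) b))"

definition smooth :: "('a::euclidean_space \<Rightarrow> real) \<Rightarrow> bool" where
  "smooth f \<longleftrightarrow> (\<forall>k. Ck k f)"

definition gradient :: "('a::euclidean_space \<Rightarrow> real) \<Rightarrow> 'a \<Rightarrow> 'a" where
  "gradient f x = (\<Sum>b\<in>Basis. frechet_derivative f (at x) b *\<^sub>R b)"

text \<open>Near each of its points the boundary is the graph of a smooth function over a hyperplane
  orthogonal to a unit vector \<open>e\<close>, with \<open>\<Omega>\<close> on one side of it. The function \<open>\<gamma>\<close> of \<open>n - 1\<close> variables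
  is given on the whole space but evaluated only on the hyperplane orthogonal to \<open>e\<close>.\<close>

definition smooth_boundary :: "'a::euclidean_space set \<Rightarrow> bool" where
  "smooth_boundary \<Omega> \<longleftrightarrow>
     (\<forall>p\<in>frontier \<Omega>. \<exists>r>0. \<exists>e \<gamma>. norm e = 1 \<and> smooth \<gamma> \<and>
        \<Omega> \<inter> ball p r = {y \<in> ball p r. \<gamma> (y - (y \<bullet> e) *\<^sub>R e) < y \<bullet> e})"

definition smooth_bounded_domain :: "'a::euclidean_space set \<Rightarrow> bool" where
  "smooth_bounded_domain \<Omega> \<longleftrightarrow>
     open \<Omega> \<and> connected \<Omega> \<and> \<Omega> \<noteq> {} \<and> bounded \<Omega> \<and> smooth_boundary \<Omega>"

text \<open>Elements of the spaces below are representatives: functions on the whole space whose values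
  outside \<open>\<Omega>\<close> are irrelevant, to be identified when they agree almost everywhere in \<open>\<Omega>\<close>.\<close>

definition L2 :: "'a::euclidean_space set \<Rightarrow> ('a \<Rightarrow> 'b::euclidean_space) set" where
  "L2 \<Omega> = {u \<in> borel_measurable (lebesgue_on \<Omega>). integrable (lebesgue_on \<Omega>) (\<lambda>x. (norm (u x))\<^sup>2)}"

definition Linf :: "'a::euclidean_space set \<Rightarrow> ('a \<Rightarrow> real) set" where
  "Linf \<Omega> = {u \<in> borel_measurable (lebesgue_on \<Omega>). \<exists>C. AE x in lebesgue_on \<Omega>. \<bar>u x\<bar> \<le> C}"

definition test_functions :: "'a::euclidean_space set \<Rightarrow> ('a \<Rightarrow> real) set" where
  "test_functions \<Omega> =
     {\<phi>. smooth \<phi> \<and> compact (closure {x. \<phi> x \<noteq> 0}) \<and> closure {x. \<phi> x \<noteq> 0} \<subseteq> \<Omega>}"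

definition has_weak_gradient ::
    "'a::euclidean_space set \<Rightarrow> ('a \<Rightarrow> real) \<Rightarrow> ('a \<Rightarrow> 'a) \<Rightarrow> bool" where
  "has_weak_gradient \<Omega> u g \<longleftrightarrow>
     (\<forall>C. compact C \<and> C \<subseteq> \<Omega> \<longrightarrow> integrable (lebesgue_on C) u \<and> integrable (lebesgue_on C) g) \<and>
     (\<forall>\<phi>\<in>test_functions \<Omega>.
        (LINT x|lebesgue_on \<Omega>. u x *\<^sub>R gradient \<phi> x) = - (LINT x|lebesgue_on \<Omega>. \<phi> x *\<^sub>R g x))"

definition weak_gradient :: "'a::euclidean_space set \<Rightarrow> ('a \<Rightarrow> real) \<Rightarrow> 'a \<Rightarrow> 'a" where
  "weak_gradient \<Omega> u = (SOME g. has_weak_gradient \<Omega> u g)"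

definition H1 :: "'a::euclidean_space set \<Rightarrow> ('a \<Rightarrow> real) set" where
  "H1 \<Omega> = {u \<in> L2 \<Omega>. \<exists>g\<in>L2 \<Omega>. has_weak_gradient \<Omega> u g}"

definition dirichlet :: "'a::euclidean_space set \<Rightarrow> ('a \<Rightarrow> real) \<Rightarrow> real" where
  "dirichlet \<Omega> u = (LINT x|lebesgue_on \<Omega>. (norm (weak_gradient \<Omega> u x))\<^sup>2)"

definition H1_norm :: "'a::euclidean_space set \<Rightarrow> ('a \<Rightarrow> real) \<Rightarrow> real" where
  "H1_norm \<Omega> u = sqrt ((LINT x|lebesgue_on \<Omega>. (u x)\<^sup>2) + dirichlet \<Omega> u)"

definition H10 :: "'a::euclidean_space set \<Rightarrow> ('a \<Rightarrow> real) set" where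
  "H10 \<Omega> = {u \<in> H1 \<Omega>. \<forall>\<epsilon>>0. \<exists>\<phi>\<in>test_functions \<Omega>. H1_norm \<Omega> (\<lambda>x. u x - \<phi> x) < \<epsilon>}"

definition weak_solution ::
    "'a::euclidean_space set \<Rightarrow> (real \<Rightarrow> real) \<Rightarrow> real set \<Rightarrow> ('a \<Rightarrow> real) \<Rightarrow> (real \<Rightarrow> real) \<Rightarrow>
     ('a \<Rightarrow> real) \<Rightarrow> bool" where
  "weak_solution \<Omega> K I \<alpha> f u \<longleftrightarrow>
     u \<in> H10 \<Omega> \<and> (AE x in lebesgue_on \<Omega>. u x > 0) \<and> dirichlet \<Omega> u \<in> I \<and>
     (\<forall>v\<in>H10 \<Omega>. integrable (lebesgue_on \<Omega>) (\<lambda>x. \<alpha> x * f (u x) * v x) \<and>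
        K (dirichlet \<Omega> u) * (LINT x|lebesgue_on \<Omega>. weak_gradient \<Omega> u x \<bullet> weak_gradient \<Omega> v x)
          - (LINT x|lebesgue_on \<Omega>. \<alpha> x * f (u x) * v x) = 0)"

definition energy ::
    "'a::euclidean_space set \<Rightarrow> real \<Rightarrow> ('a \<Rightarrow> real) \<Rightarrow> (real \<Rightarrow> real) \<Rightarrow> ('a \<Rightarrow> real) \<Rightarrow> real" where
  "energy \<Omega> \<kappa> \<alpha> f u =
     1/2 * \<kappa> * dirichlet \<Omega> u - (LINT x|lebesgue_on \<Omega>. \<alpha> x * integral {0..max 0 (u x)} f)"

end

theory Submission
  imports Defs "HOL-Computational_Algebra.Polynomial"
begin

text \<open>
  Write \<open>D u\<close> for the Dirichlet integral and \<open>G u\<close> for the integral of \<open>\<alpha> F(u)\<close>, where \<open>F\<close> is the primitive of \<open>f\<close>.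
  Everything rests on hidden convexity: as a function of \<open>u\<^sup>2\<close>, the functional \<open>D\<close> is convex, and \<open>G\<close> is
  strictly concave because \<open>f \<xi> / \<xi>\<close> decreases. For \<open>D\<close> this is used in the form that the regularised
  quadratic mean of two test functions is a test function with at most the mean Dirichlet integral.

  Hence \<open>M t = sup {G \<phi> | D \<phi> \<le> t}\<close> is concave, and there is \<open>t \<in> I\<close> such that \<open>K t / 2\<close> is a supporting slope of \<open>M\<close>
  at \<open>t\<close>. Suitable maximising sequences for \<open>M t\<close> are Cauchy, first in \<open>L\<^sup>1\<close> by a strict concavity argument that
  replaces the Rellich compactness theorem, then in \<open>H\<^sup>1\<close> by the parallelogram law, since \<open>K t > 0\<close>. The limit \<open>u\<close> has
  \<open>D u = t\<close> and minimises the energy with coefficient \<open>K t\<close>. It is positive because \<open>f \<xi> / \<xi>\<close> is unbounded near \<open>0\<close>,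
  and so it is a weak solution.

  Conversely, Picone's inequality and the concavity of \<open>G\<close> show that every weak solution \<open>w\<close> is the only minimiser of
  the energy with coefficient \<open>K (D w)\<close>. Comparing the energies of two solutions gives that their Dirichlet integrals
  agree, because \<open>K\<close> increases, and then that the solutions agree.
\<close>

section \<open>Smooth functions and test functions\<close>

text \<open>The coefficient \<open>K (D u)\<close> depends on the solution itself. Prescribing the
  level \<open>t\<close> of the Dirichlet integral decouples it: if \<open>K t / 2\<close> supports
  \<open>M\<close> at \<open>t\<close>, then \<open>G \<phi> \<le> M (D \<phi>) \<le> M t + K t / 2
  * (D \<phi> - t)\<close> for every test function, so a maximiser with \<open>D u = t\<close>
  minimises the energy whose coefficient is exactly \<open>K t\<close>, and no fixed point argument
  remains. The obstacle is that absolute values, quadratic means and Picone quotients of functions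
  in \<open>H10\<close> would call for chain rules for weak gradients. They are therefore formed
  with test functions only, after a regularisation (\<open>e\<close> in the quadratic mean,
  \<open>\<epsilon>\<close> in the quotient), where gradients are classical. What is kept are
  inequalities between integrals that survive the passage to the limit. For \<open>G\<close> this
  needs only L1 convergence with bounded Dirichlet integrals, because \<open>f\<close> grows more
  slowly than any linear function.\<close>

lemma Ck_SucD: "Ck (Suc k) f \<Longrightarrow> Ck k f"
proof (induction k arbitrary: f)
  case 0
  then show ?case
    by (auto intro!: differentiable_imp_continuous_on simp: differentiable_on_def)
next
  case (Suc k)
  then show ?case
    by (metis Ck.simps(2))
qed

text \<open>By uniqueness of derivatives, one found with the calculus rules may replace the
  choice-defined \<open>frechet_derivative\<close> in \<open>Ck\<close>.\<close>

lemma Ck_SucI: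
  assumes "\<And>x. (f has_derivative f' x) (at x)" and "\<And>b. b \<in> Basis \<Longrightarrow> Ck k (\<lambda>x. f' x b)"
  shows "Ck (Suc k) f"
proof -
  have "frechet_derivative f (at x) = f' x" for x
    using frechet_derivative_at[OF assms(1)] by simp
  then show ?thesis
    using assms by (auto simp: differentiable_def)
qed

lemma Ck_const: "Ck k (\<lambda>x. c)"
proof (induction k arbitrary: c)
  case (Suc k)
  show ?case by (rule Ck_SucI[where f' = "\<lambda>x h. 0"]) (auto intro: Suc)
qed simp

lemma Ck_inner: "Ck k (\<lambda>x. x \<bullet> c)"
proof (cases k)
  case 0
  then show ?thesis by (auto intro!: continuous_intros)
next
  case (Suc n)
  have "Ck (Suc n) (\<lambda>x. x \<bullet> c)"
    by (rule Ck_SucI[where f' = "\<lambda>x h. h \<bullet> c"]) (auto intro: Ck_const derivative_eq_intros)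
  then show ?thesis using Suc by simp
qed

lemma Ck_has_derivative:
  "Ck (Suc k) f \<Longrightarrow> (f has_derivative frechet_derivative f (at x)) (at x)"
  by (auto simp: frechet_derivative_works)

lemma Ck_add: "Ck k f \<Longrightarrow> Ck k g \<Longrightarrow> Ck k (\<lambda>x. f x + g x)"
proof (induction k arbitrary: f g)
  case 0
  then show ?case by (auto intro!: continuous_intros)
next
  case (Suc k)
  show ?case
    by (rule Ck_SucI[where f' = "\<lambda>x h. frechet_derivative f (at x) h + frechet_derivative g (at x) h"])
      (use Suc in \<open>auto intro!: has_derivative_add Ck_has_derivative\<close>)
qed

lemma Ck_mult: "Ck k f \<Longrightarrow> Ck k g \<Longrightarrow> Ck k (\<lambda>x. f x * g x)"
proof (induction k arbitrary: f g)
  case 0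
  then show ?case by (auto intro!: continuous_intros)
next
  case (Suc k)
  have "Ck k f" "Ck k g" by (rule Ck_SucD, rule Suc.prems)+
  then show ?case
    by (intro Ck_SucI[where f' = "\<lambda>x h. f x * frechet_derivative g (at x) h + frechet_derivative f (at x) h * g x"])
      (use Suc in \<open>auto intro!: has_derivative_mult Ck_has_derivative Ck_add\<close>)
qed

text \<open>The outer function comes as a sequence in which each member is the derivative of the one
  before, so that the induction on \<open>j\<close> can pass from \<open>H k\<close> to
  \<open>H (Suc k)\<close>. Asking for derivatives only on \<open>S\<close>, which contains the
  range of \<open>f\<close>, admits powers on the positive half-line.\<close>

lemma Ck_compose:
  fixes H :: "nat \<Rightarrow> real \<Rightarrow> real"
  assumes "\<And>k y. y \<in> S \<Longrightarrow> (H k has_real_derivative H (Suc k) y) (at y)"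
    and "\<And>x. f x \<in> S"
  shows "Ck j f \<Longrightarrow> Ck j (\<lambda>x. H k (f x))"
proof (induction j arbitrary: k)
  case 0
  have "isCont (H k) (f x)" for x
    using assms DERIV_isCont by blast
  moreover have "isCont f x" for x
    using 0 by (simp add: continuous_on_eq_continuous_at)
  ultimately show ?case
    by (simp add: continuous_on_eq_continuous_at isCont_o2[where g = "H k"])
next
  case (Suc j)
  have "Ck j f" by (rule Ck_SucD[OF Suc.prems])
  have D: "((\<lambda>x. H k (f x)) has_derivative (\<lambda>h. H (Suc k) (f x) * frechet_derivative f (at x) h)) (at x)" for x
    using has_derivative_compose[OF Ck_has_derivative[OF Suc.prems] assms(1)[OF assms(2), unfolded has_field_derivative_def]]
    by simp
  show ?case
  proof (rule Ck_SucI[OF D])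
    fix b :: 'a assume "b \<in> Basis"
    then show "Ck j (\<lambda>x. H (Suc k) (f x) * frechet_derivative f (at x) b)"
      using Suc.prems by (intro Ck_mult Suc.IH \<open>Ck j f\<close>) simp
  qed
qed

lemma smooth_const: "smooth (\<lambda>x. c)" by (simp add: smooth_def Ck_const)
lemma smooth_inner: "smooth (\<lambda>x. x \<bullet> c)" by (simp add: smooth_def Ck_inner)
lemma smooth_add: "smooth f \<Longrightarrow> smooth g \<Longrightarrow> smooth (\<lambda>x. f x + g x)" by (simp add: smooth_def Ck_add)
lemma smooth_mult: "smooth f \<Longrightarrow> smooth g \<Longrightarrow> smooth (\<lambda>x. f x * g x)" by (simp add: smooth_def Ck_mult)
lemma smooth_cmult: "smooth f \<Longrightarrow> smooth (\<lambda>x. c * f x)" by (simp add: smooth_mult smooth_const)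
lemma smooth_diff: "smooth f \<Longrightarrow> smooth g \<Longrightarrow> smooth (\<lambda>x. f x - g x)"
  using smooth_add[of f "\<lambda>x. -1 * g x"] smooth_cmult[of g "-1"] by simp
lemma smooth_prod: "(\<And>b. b \<in> B \<Longrightarrow> smooth (f b)) \<Longrightarrow> smooth (\<lambda>x. \<Prod>b\<in>B. f b x)"
proof (induction B rule: infinite_finite_induct)
  case (insert b B)
  then have "smooth (\<lambda>x. f b x * (\<Prod>b\<in>B. f b x))"
    by (intro smooth_mult) auto
  then show ?case using insert by simp
qed (simp_all add: smooth_const)
lemma smooth_compose:
  fixes H :: "nat \<Rightarrow> real \<Rightarrow> real"
  assumes "\<And>k y. y \<in> S \<Longrightarrow> (H k has_real_derivative H (Suc k) y) (at y)"
    and "\<And>x. f x \<in> S" and "smooth f"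
  shows "smooth (\<lambda>x. H k (f x))"
  using assms(3) Ck_compose[where S = S and H = H and f = f, OF assms(1,2)] unfolding smooth_def by blast

lemma smooth_exp: "smooth f \<Longrightarrow> smooth (\<lambda>x. exp (f x))"
  using smooth_compose[where H = "\<lambda>k. exp" and S = UNIV and f = f] by (simp add: DERIV_exp)

lemma smooth_powr:
  assumes "smooth f" and "\<And>x. f x > 0"
  shows "smooth (\<lambda>x. f x powr a)"
proof -
  \<comment> \<open>The factor is the falling factorial a (a - 1) ... (a - k + 1) of the k-th
    derivative of y^a, written as a rising factorial from its last factor.\<close>
  have "((\<lambda>y. pochhammer (a - real k + 1) k * y powr (a - real k)) has_real_derivative
      pochhammer (a - real (Suc k) + 1) (Suc k) * y powr (a - real (Suc k))) (at y)"
    if "y \<in> {0<..}" for k and y :: real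
    using that by (auto intro!: derivative_eq_intros simp: pochhammer_rec algebra_simps)
  from smooth_compose[where H = "\<lambda>k y. pochhammer (a - real k + 1) k * y powr (a - real k)" and S = "{0<..}"
      and f = f and k = 0, OF this] show ?thesis
    using assms by auto
qed

lemma smooth_sqrt: "smooth f \<Longrightarrow> (\<And>x. f x > 0) \<Longrightarrow> smooth (\<lambda>x. sqrt (f x))"
  using smooth_powr[of f "1/2"] by (simp add: powr_half_sqrt less_imp_le)

lemma smooth_inverse: "smooth f \<Longrightarrow> (\<And>x. f x > 0) \<Longrightarrow> smooth (\<lambda>x. inverse (f x))"
  using smooth_powr[of f "-1"] by (simp add: powr_minus less_imp_le)

lemma smooth_continuous: "smooth f \<Longrightarrow> continuous_on S f"
  unfolding smooth_def by (metis Ck.simps(1) continuous_on_subset subset_UNIV)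

lemma smooth_partial: "smooth f \<Longrightarrow> b \<in> Basis \<Longrightarrow> smooth (\<lambda>x. frechet_derivative f (at x) b)"
  unfolding smooth_def by (metis Ck.simps(2))

lemma smooth_differentiable: "smooth f \<Longrightarrow> f differentiable (at x)"
  unfolding smooth_def by (metis Ck.simps(2))

section \<open>Gradients of smooth functions\<close>

lemma gradient_inner:
  assumes "f differentiable (at x)"
  shows "gradient f x \<bullet> h = frechet_derivative f (at x) h"
proof -
  have lin: "linear (frechet_derivative f (at x))"
    using assms by (simp add: linear_frechet_derivative)
  have "gradient f x \<bullet> h = (\<Sum>b\<in>Basis. frechet_derivative f (at x) b * (b \<bullet> h))"
    by (simp add: gradient_def inner_sum_left)
  also have "\<dots> = (\<Sum>b\<in>Basis. frechet_derivative f (at x) ((h \<bullet> b) *\<^sub>R b))"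
    using lin by (simp add: linear_cmul inner_commute mult.commute)
  also have "\<dots> = frechet_derivative f (at x) (\<Sum>b\<in>Basis. (h \<bullet> b) *\<^sub>R b)"
    using linear_sum[OF lin] by metis
  finally show ?thesis by (simp add: euclidean_representation)
qed

lemma gradient_has_derivative:
  "f differentiable (at x) \<Longrightarrow> (f has_derivative (\<lambda>h. gradient f x \<bullet> h)) (at x)"
  using gradient_inner frechet_derivative_works by (metis ext)

lemma smooth_has_derivative:
  "smooth f \<Longrightarrow> (f has_derivative (\<lambda>h. gradient f x \<bullet> h)) (at x)"
  by (simp add: gradient_has_derivative smooth_differentiable)

lemma gradient_eqI:
  assumes "(f has_derivative (\<lambda>h. g \<bullet> h)) (at x)"
  shows "gradient f x = g"
proof -
  have "f differentiable (at x)" using assms by (auto simp: differentiable_def)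
  then have "(\<lambda>h. gradient f x \<bullet> h) = (\<lambda>h. g \<bullet> h)"
    using gradient_has_derivative assms has_derivative_unique by blast
  then show ?thesis by (metis inner_commute vector_eq_rdot)
qed

lemma smooth_gradient_component: "smooth f \<Longrightarrow> b \<in> Basis \<Longrightarrow> smooth (\<lambda>x. gradient f x \<bullet> b)"
  using smooth_partial[of f b] by (simp add: gradient_inner smooth_differentiable)

lemma smooth_continuous_gradient:
  fixes f :: "'a::euclidean_space \<Rightarrow> real"
  assumes "smooth f" shows "continuous_on S (gradient f)"
proof -
  have "continuous_on S (\<lambda>x. \<Sum>b\<in>Basis. frechet_derivative f (at x) b *\<^sub>R b)"
    by (intro continuous_intros smooth_continuous smooth_partial assms)
  then show ?thesis by (simp add: gradient_def[abs_def])
qed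

section \<open>Smooth bump functions of boxes\<close>

lemma poly_exp_decay: "((\<lambda>y::real. poly p y * exp (- y)) \<longlongrightarrow> 0) at_top"
proof -
  have "((\<lambda>y::real. \<Sum>i\<le>degree p. coeff p i * (y ^ i / exp y)) \<longlongrightarrow> (\<Sum>i\<le>degree p. coeff p i * 0)) at_top"
    by (intro tendsto_intros tendsto_power_div_exp_0)
  then show ?thesis
    by (simp add: poly_altdef exp_minus field_simps sum_divide_distrib)
qed

text \<open>Functions of this form are closed under differentiation.\<close>

definition flat_poly :: "real poly \<Rightarrow> real \<Rightarrow> real" where
  "flat_poly p t = (if t > 0 then poly p (1/t) * exp (- (1/t)) else 0)"

text \<open>With s = 1/t the derivative of p(s) exp(-s) is s^2 (p(s) - p'(s)) exp(-s), and
  \<open>[:0,0,1:]\<close> is s^2. At t = 0 the right difference quotient is s p(s) exp(-s), which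
  tends to 0 as s grows.\<close>

lemma flat_poly_deriv:
  "(flat_poly p has_real_derivative flat_poly ([:0,0,1:] * (p - pderiv p)) t) (at t)"
proof -
  consider "t > 0" | "t < 0" | "t = 0" by linarith
  then show ?thesis
  proof cases
    case 1
    have "((\<lambda>t. poly p (1/t) * exp (- (1/t))) has_real_derivative
        poly ([:0,0,1:] * (p - pderiv p)) (1/t) * exp (- (1/t))) (at t)"
      using 1 by (auto intro!: derivative_eq_intros DERIV_chain'[where f = "\<lambda>t. 1/t", OF _ poly_DERIV]
          simp: field_simps power2_eq_square)
    then have "(flat_poly p has_real_derivative
        poly ([:0,0,1:] * (p - pderiv p)) (1/t) * exp (- (1/t))) (at t)"
      by (rule DERIV_cong_ev[THEN iffD1, rotated -1])
        (auto intro!: eventually_mono[OF eventually_gt_at_top] eventually_nhds_in_open[of "{0<..}" t, THEN eventually_mono]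
          simp: 1 flat_poly_def)
    then show ?thesis using 1 by (simp add: flat_poly_def)
  next
    case 2
    have "((\<lambda>t. 0) has_real_derivative 0) (at t)" by simp
    then have "(flat_poly p has_real_derivative 0) (at t)"
      by (rule DERIV_cong_ev[THEN iffD1, rotated -1])
        (auto intro!: eventually_nhds_in_open[of "{..<0}" t, THEN eventually_mono]
          simp: 2 flat_poly_def)
    then show ?thesis using 2 by (simp add: flat_poly_def)
  next
    case 3
    have "((\<lambda>h. flat_poly p h / h) \<longlongrightarrow> 0) (at_right 0)"
    proof -
      have "((\<lambda>h. poly (pCons 0 p) (inverse h) * exp (- inverse h)) \<longlongrightarrow> 0) (at_right (0::real))"
        by (rule filterlim_compose[OF poly_exp_decay filterlim_inverse_at_top_right])
      then show ?thesis
        by (rule Lim_transform_eventually)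
          (auto simp: eventually_at_filter flat_poly_def field_simps)
    qed
    moreover have "((\<lambda>h. flat_poly p h / h) \<longlongrightarrow> 0) (at_left 0)"
      by (rule tendsto_eventually) (auto simp: eventually_at_filter flat_poly_def)
    ultimately have "((\<lambda>h. flat_poly p h / h) \<longlongrightarrow> 0) (at 0)"
      by (simp add: filterlim_at_split)
    then show ?thesis
      using 3 by (simp add: DERIV_def flat_poly_def)
  qed
qed

definition flat :: "real \<Rightarrow> real" where
  "flat t = (if t > 0 then exp (- (1/t)) else 0)"

lemma smooth_flat:
  assumes "smooth f" shows "smooth (\<lambda>x. flat (f x))"
proof -
  \<comment> \<open>Iterating the derivative operator of \<open>flat_poly_deriv\<close> on the
    constant polynomial 1 gives the sequence of derivatives that \<open>smooth_compose\<close>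
    expects.\<close>
  define P where "P k = ((\<lambda>p. [:0,0,1:] * (p - pderiv p)) ^^ k) (1 :: real poly)" for k
  have "smooth (\<lambda>x. flat_poly (P 0) (f x))"
    by (rule smooth_compose[where S = UNIV and H = "\<lambda>k. flat_poly (P k)"])
      (use assms flat_poly_deriv in \<open>auto simp: P_def\<close>)
  moreover have "flat_poly (P 0) = flat"
    by (auto simp: P_def flat_poly_def flat_def)
  ultimately show ?thesis by simp
qed

definition box_bump :: "'a::euclidean_space \<Rightarrow> 'a \<Rightarrow> 'a \<Rightarrow> real" where
  "box_bump a c x = (\<Prod>b\<in>Basis. flat (x \<bullet> b - a \<bullet> b) * flat (c \<bullet> b - x \<bullet> b))"

lemma smooth_box_bump: "smooth (box_bump a c)"
proof -
  have "smooth (\<lambda>x. flat (x \<bullet> b - a \<bullet> b) * flat (c \<bullet> b - x \<bullet> b))" for b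
    by (rule smooth_mult[OF smooth_flat[OF smooth_diff[OF smooth_inner smooth_const]]
          smooth_flat[OF smooth_diff[OF smooth_const smooth_inner]]])
  then show ?thesis
    unfolding box_bump_def[abs_def] by (rule smooth_prod)
qed

lemma box_bump_pos: "x \<in> box a c \<Longrightarrow> box_bump a c x > 0"
  unfolding box_bump_def by (rule prod_pos) (auto simp: flat_def mem_box)

lemma box_bump_zero: "x \<notin> box a c \<Longrightarrow> box_bump a c x = 0"
  unfolding box_bump_def by (rule prod_zero) (auto simp: flat_def mem_box)

section \<open>Test functions\<close>

lemma test_functionI:
  assumes "smooth \<phi>" and "compact S" "S \<subseteq> \<Omega>" and "\<And>x. x \<notin> S \<Longrightarrow> \<phi> x = 0"
  shows "\<phi> \<in> test_functions \<Omega>"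
proof -
  have "closure {x. \<phi> x \<noteq> 0} \<subseteq> S"
    using assms by (intro closure_minimal) (auto intro: compact_imp_closed)
  then show ?thesis
    using assms compact_Int_closed[OF assms(2) closed_closure, of "{x. \<phi> x \<noteq> 0}"]
    by (auto simp: test_functions_def Int_absorb1)
qed

text \<open>One compact set serves for the function and its gradient, since the function vanishes on
  an open set off its support. Hence partial derivatives of test functions are test functions
  again.\<close>

lemma test_functionE:
  assumes "\<phi> \<in> test_functions \<Omega>"
  obtains S where "compact S" "S \<subseteq> \<Omega>" "\<And>x. x \<notin> S \<Longrightarrow> \<phi> x = 0" "\<And>x. x \<notin> S \<Longrightarrow> gradient \<phi> x = 0"
proof -
  define S where "S = closure {x. \<phi> x \<noteq> 0}"
  have S: "compact S" "S \<subseteq> \<Omega>" using assms by (auto simp: test_functions_def S_def)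
  have z: "\<phi> x = 0" if "x \<notin> S" for x
    using that closure_subset[of "{x. \<phi> x \<noteq> 0}"] unfolding S_def by blast
  have "gradient \<phi> x = 0" if "x \<notin> S" for x
  proof (rule gradient_eqI)
    have "((\<lambda>x. 0 :: real) has_derivative (\<lambda>h. 0 \<bullet> h)) (at x)" by simp
    then show "(\<phi> has_derivative (\<lambda>h. 0 \<bullet> h)) (at x)"
      by (rule has_derivative_transform_within_open[where s = "- S"]) (use that z compact_imp_closed[OF S(1)] in auto)
  qed
  then show ?thesis using that[of S] S z by blast
qed

lemma test_function_smooth: "\<phi> \<in> test_functions \<Omega> \<Longrightarrow> smooth \<phi>"
  by (simp add: test_functions_def)

lemma test_function_zero: "\<phi> \<in> test_functions \<Omega> \<Longrightarrow> x \<notin> \<Omega> \<Longrightarrow> \<phi> x = 0"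
  by (metis test_functionE subsetD)

lemma test_gradient_zero: "\<phi> \<in> test_functions \<Omega> \<Longrightarrow> x \<notin> \<Omega> \<Longrightarrow> gradient \<phi> x = 0"
  by (metis test_functionE subsetD)

lemma test_function_mult:
  assumes "\<phi> \<in> test_functions \<Omega>" and "smooth \<psi>"
  shows "(\<lambda>x. \<phi> x * \<psi> x) \<in> test_functions \<Omega>"
proof -
  obtain S where S: "compact S" "S \<subseteq> \<Omega>" "\<And>x. x \<notin> S \<Longrightarrow> \<phi> x = 0"
    using test_functionE[OF assms(1)] by metis
  show ?thesis
    by (rule test_functionI[OF smooth_mult[OF test_function_smooth[OF assms(1)] assms(2)] S(1,2)]) (simp add: S)
qed

lemma test_function_cmult: "\<phi> \<in> test_functions \<Omega> \<Longrightarrow> (\<lambda>x. c * \<phi> x) \<in> test_functions \<Omega>"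
  using test_function_mult[OF _ smooth_const[of c]] by (simp add: mult.commute)

lemma test_function_add:
  assumes "\<phi> \<in> test_functions \<Omega>" and "\<psi> \<in> test_functions \<Omega>"
  shows "(\<lambda>x. \<phi> x + \<psi> x) \<in> test_functions \<Omega>"
proof -
  obtain S where S: "compact S" "S \<subseteq> \<Omega>" "\<And>x. x \<notin> S \<Longrightarrow> \<phi> x = 0"
    using test_functionE[OF assms(1)] by metis
  obtain T where T: "compact T" "T \<subseteq> \<Omega>" "\<And>x. x \<notin> T \<Longrightarrow> \<psi> x = 0"
    using test_functionE[OF assms(2)] by metis
  show ?thesis
    by (rule test_functionI[OF smooth_add[OF test_function_smooth[OF assms(1)] test_function_smooth[OF assms(2)]],
          of "S \<union> T"]) (use S T in auto)
qed

lemma test_function_diff: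
  "\<phi> \<in> test_functions \<Omega> \<Longrightarrow> \<psi> \<in> test_functions \<Omega> \<Longrightarrow> (\<lambda>x. \<phi> x - \<psi> x) \<in> test_functions \<Omega>"
  using test_function_add[of \<phi> \<Omega> "\<lambda>x. -1 * \<psi> x"] test_function_cmult[of \<psi> \<Omega> "-1"] by simp

lemma test_function_partial:
  assumes "\<phi> \<in> test_functions \<Omega>" and "b \<in> Basis"
  shows "(\<lambda>x. gradient \<phi> x \<bullet> b) \<in> test_functions \<Omega>"
proof -
  obtain S where S: "compact S" "S \<subseteq> \<Omega>" "\<And>x. x \<notin> S \<Longrightarrow> gradient \<phi> x = 0"
    using test_functionE[OF assms(1)] by metis
  show ?thesis
    by (rule test_functionI[OF smooth_gradient_component[OF test_function_smooth[OF assms(1)] assms(2)] S(1,2)])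
      (simp add: S)
qed

lemma gradient_add:
  "smooth f \<Longrightarrow> smooth g \<Longrightarrow> gradient (\<lambda>x. f x + g x) x = gradient f x + gradient g x"
proof (rule gradient_eqI)
  assume "smooth f" "smooth g"
  from has_derivative_add[OF this[THEN smooth_has_derivative]]
  show "((\<lambda>x. f x + g x) has_derivative (\<lambda>h. (gradient f x + gradient g x) \<bullet> h)) (at x)"
    by (simp add: inner_add_left)
qed

lemma gradient_mult:
  "smooth f \<Longrightarrow> smooth g \<Longrightarrow> gradient (\<lambda>x. f x * g x) x = f x *\<^sub>R gradient g x + g x *\<^sub>R gradient f x"
proof (rule gradient_eqI)
  assume "smooth f" "smooth g"
  from has_derivative_mult[OF this[THEN smooth_has_derivative]]
  show "((\<lambda>x. f x * g x) has_derivative (\<lambda>h. (f x *\<^sub>R gradient g x + g x *\<^sub>R gradient f x) \<bullet> h)) (at x)"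
    by (simp add: inner_add_left mult.commute)
qed

lemma gradient_const: "gradient (\<lambda>x. c) x = 0"
  by (rule gradient_eqI) auto

lemma gradient_cmult: "smooth f \<Longrightarrow> gradient (\<lambda>x. c * f x) x = c *\<^sub>R gradient f x"
  using gradient_mult[OF smooth_const[of c], of f] by (simp add: gradient_const)

lemma gradient_diff:
  "smooth f \<Longrightarrow> smooth g \<Longrightarrow> gradient (\<lambda>x. f x - g x) x = gradient f x - gradient g x"
proof (rule gradient_eqI)
  assume "smooth f" "smooth g"
  from has_derivative_diff[OF this[THEN smooth_has_derivative]]
  show "((\<lambda>x. f x - g x) has_derivative (\<lambda>h. (gradient f x - gradient g x) \<bullet> h)) (at x)"
    by (simp add: inner_diff_left)
qed

lemma gradient_linear: "gradient (\<lambda>x. x \<bullet> c) x = c"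
  by (rule gradient_eqI) (auto intro!: derivative_eq_intros simp: inner_commute)

lemma gradient_compose:
  assumes "smooth f" and "(h has_real_derivative h') (at (f x))"
  shows "gradient (\<lambda>x. h (f x)) x = h' *\<^sub>R gradient f x"
  by (rule gradient_eqI)
    (use has_derivative_compose[OF smooth_has_derivative[OF assms(1)] assms(2)[unfolded has_field_derivative_def]] in simp)

section \<open>Integrals of gradients of test functions\<close>

lemma compact_support_bounded:
  fixes g :: "'a::euclidean_space \<Rightarrow> 'b::real_normed_vector"
  assumes "continuous_on UNIV g" and "compact S" and "\<And>x. x \<notin> S \<Longrightarrow> g x = 0"
  obtains B where "B > 0" "\<And>x. norm (g x) \<le> B"
proof -
  have "bounded (g ` S)"
    by (intro compact_imp_bounded compact_continuous_image continuous_on_subset[OF assms(1)] assms(2)) simp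
  then obtain B where "B > 0" "\<And>x. x \<in> S \<Longrightarrow> norm (g x) \<le> B"
    by (auto simp: bounded_pos)
  then have "norm (g x) \<le> B" for x
    using assms(3)[of x] by (cases "x \<in> S") auto
  then show ?thesis using that \<open>B > 0\<close> by blast
qed

lemma test_function_bounded:
  assumes "\<phi> \<in> test_functions \<Omega>"
  obtains B where "B > 0" "\<And>x. \<bar>\<phi> x\<bar> \<le> B" "\<And>x. norm (gradient \<phi> x) \<le> B"
proof -
  obtain S where S: "compact S" "\<And>x. x \<notin> S \<Longrightarrow> \<phi> x = 0" "\<And>x. x \<notin> S \<Longrightarrow> gradient \<phi> x = 0"
    using test_functionE[OF assms] by metis
  have sm: "smooth \<phi>" using assms by (rule test_function_smooth)
  obtain B where B: "B > 0" "\<And>x. norm (\<phi> x) \<le> B"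
    using compact_support_bounded[OF smooth_continuous[OF sm] S(1,2)] by metis
  obtain C where C: "C > 0" "\<And>x. norm (gradient \<phi> x) \<le> C"
    using compact_support_bounded[OF smooth_continuous_gradient[OF sm] S(1,3)] by metis
  show ?thesis
    using that[of "B + C"] B C by (smt (verit) real_norm_def)
qed

text \<open>Translation invariance lives on the whole space, weak gradients on \<Omega>; extension
  by zero links the two.\<close>

lemma lebesgue_on_integral_eq_lborel:
  fixes g :: "'a::euclidean_space \<Rightarrow> 'b::euclidean_space"
  assumes "\<Omega> \<in> sets lebesgue" and "g \<in> borel_measurable borel" and "\<And>x. x \<notin> \<Omega> \<Longrightarrow> g x = 0"
  shows "integral\<^sup>L (lebesgue_on \<Omega>) g = integral\<^sup>L lborel g"
proof -
  have "integral\<^sup>L (lebesgue_on \<Omega>) g = integral\<^sup>L lebesgue (\<lambda>x. indicator \<Omega> x *\<^sub>R g x)"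
    by (rule integral_restrict_space) (simp add: assms)
  also have "(\<lambda>x. indicator \<Omega> x *\<^sub>R g x) = g"
    using assms(3) by (auto simp: indicator_def)
  also have "integral\<^sup>L lebesgue g = integral\<^sup>L lborel g"
    using assms(2) by (intro integral_completion) simp
  finally show ?thesis .
qed

text \<open>The integral of the difference quotient vanishes by translation invariance.\<close>

lemma integral_gradient_lborel:
  assumes \<psi>: "\<psi> \<in> test_functions UNIV"
  shows "(LINT x|lborel. gradient \<psi> x \<bullet> h) = 0"
proof -
  obtain S where S: "compact S" "\<And>x. x \<notin> S \<Longrightarrow> \<psi> x = 0" "\<And>x. x \<notin> S \<Longrightarrow> gradient \<psi> x = 0"
    using test_functionE[OF \<psi>] by metis
  obtain B where B: "B > 0" "\<And>x. \<bar>\<psi> x\<bar> \<le> B" "\<And>x. norm (gradient \<psi> x) \<le> B"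
    using test_function_bounded[OF \<psi>] by metis
  have sm: "smooth \<psi>" using \<psi> by (rule test_function_smooth)
  obtain R where R: "S \<subseteq> cball 0 R"
    using compact_imp_bounded[OF S(1)] by (auto simp: bounded_iff subset_iff)
  have [measurable]: "\<psi> \<in> borel_measurable borel" "gradient \<psi> \<in> borel_measurable borel"
    using sm by (auto intro!: borel_measurable_continuous_onI smooth_continuous smooth_continuous_gradient)
  define s where "s n x = (\<psi> (x + h /\<^sub>R real (Suc n)) - \<psi> x) * real (Suc n)" for n x
  have int: "integrable lborel \<psi>"
  proof -
    have "integrable lborel (\<lambda>x. indicator (cball 0 R) x *\<^sub>R \<psi> x)"
      using smooth_continuous[OF sm, of "cball 0 R"] by (intro borel_integrable_compact) auto
    moreover have "(\<lambda>x. indicator (cball 0 R) x *\<^sub>R \<psi> x) = \<psi>"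
    proof
      fix x
      show "indicator (cball 0 R) x *\<^sub>R \<psi> x = \<psi> x"
        using S(2)[of x] subsetD[OF R, of x] by (cases "x \<in> cball 0 R") (auto simp: indicator_def)
    qed
    ultimately show ?thesis by simp
  qed
  have tr: "integrable lborel (\<lambda>x. \<psi> (x + c))" "(LINT x|lborel. \<psi> (x + c)) = (LINT x|lborel. \<psi> x)" for c
  proof -
    have "integrable (distr lborel borel ((+) c)) \<psi>"
      using int by (simp add: lborel_distr_plus)
    then show "integrable lborel (\<lambda>x. \<psi> (x + c))"
      by (subst (asm) integrable_distr_eq) (auto simp: add.commute)
    have "(LINT x|lborel. \<psi> x) = (LINT x|distr lborel borel ((+) c). \<psi> x)"
      by (simp add: lborel_distr_plus)
    also have "\<dots> = (LINT x|lborel. \<psi> (x + c))"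
      by (subst integral_distr) (auto simp: add.commute)
    finally show "(LINT x|lborel. \<psi> (x + c)) = (LINT x|lborel. \<psi> x)" ..
  qed
  have "(LINT x|lborel. s n x) = 0" for n
    unfolding s_def using tr int by simp
  \<comment> \<open>The quotients are dominated uniformly in n: the mean value inequality bounds
    them by \<open>B * norm h\<close>, and since the shifts have length at most
    \<open>norm h\<close> they vanish outside the ball enlarged by that amount.\<close>
  moreover have "(\<lambda>n. LINT x|lborel. s n x) \<longlonglongrightarrow> (LINT x|lborel. gradient \<psi> x \<bullet> h)"
  proof (rule integral_dominated_convergence[where w = "\<lambda>x. indicator (cball 0 (R + norm h)) x * (B * norm h)"])
    show "integrable lborel (\<lambda>x. indicator (cball 0 (R + norm h)) x * (B * norm h))"
      by (intro integrable_mult_left integrable_real_indicator) (use emeasure_lborel_cball_finite in auto)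
    show "AE x in lborel. (\<lambda>n. s n x) \<longlonglongrightarrow> gradient \<psi> x \<bullet> h"
    proof (rule AE_I2)
      fix x
      have "((\<lambda>t. \<psi> (x + t *\<^sub>R h)) has_derivative (\<lambda>t. gradient \<psi> x \<bullet> (t *\<^sub>R h))) (at 0)"
        by (rule has_derivative_compose[of "\<lambda>t. x + t *\<^sub>R h"])
          (use smooth_has_derivative[OF sm, of x] in \<open>auto intro!: derivative_eq_intros\<close>)
      then have "((\<lambda>t. \<psi> (x + t *\<^sub>R h)) has_real_derivative (gradient \<psi> x \<bullet> h)) (at 0)"
        by (rule has_derivative_imp_has_field_derivative) simp
      then have lim: "(\<lambda>t. (\<psi> (x + t *\<^sub>R h) - \<psi> x) / t) \<midarrow>0\<rightarrow> gradient \<psi> x \<bullet> h"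
        by (simp add: DERIV_def)
      have "(\<lambda>n. (\<psi> (x + inverse (real (Suc n)) *\<^sub>R h) - \<psi> x) / inverse (real (Suc n))) \<longlonglongrightarrow> gradient \<psi> x \<bullet> h"
        by (rule filterlim_compose[OF lim], rule filterlim_atI[OF LIMSEQ_inverse_real_of_nat]) auto
      then show "(\<lambda>n. s n x) \<longlonglongrightarrow> gradient \<psi> x \<bullet> h"
        by (simp add: s_def divide_inverse)
    qed
    show "AE x in lborel. norm (s n x) \<le> indicator (cball 0 (R + norm h)) x * (B * norm h)" for n
    proof (rule AE_I2)
      fix x
      let ?y = "x + h /\<^sub>R real (Suc n)"
      have "norm (\<psi> ?y - \<psi> x) \<le> B * norm (?y - x)"
        by (rule differentiable_bound[where S = UNIV and f' = "\<lambda>x h. gradient \<psi> x \<bullet> h"])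
          (auto intro!: smooth_has_derivative[OF sm, THEN has_derivative_at_withinI] onorm_bound
            order_trans[OF Cauchy_Schwarz_ineq2] mult_right_mono B less_imp_le[OF B(1)])
      then have "\<bar>\<psi> ?y - \<psi> x\<bar> * real (Suc n) \<le> B * norm (?y - x) * real (Suc n)"
        by (intro mult_right_mono) simp_all
      also have "\<dots> = B * norm h"
        by (simp del: of_nat_Suc)
      finally have 1: "norm (s n x) \<le> B * norm h"
        by (simp only: s_def real_norm_def abs_mult abs_of_nat)
      have 2: "s n x = 0" if "x \<notin> cball 0 (R + norm h)"
      proof -
        have "inverse (real (Suc n)) * norm h \<le> 1 * norm h"
          by (intro mult_right_mono) (auto simp: inverse_le_1_iff)
        then have "norm (h /\<^sub>R real (Suc n)) \<le> norm h"
          by (simp del: of_nat_Suc)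
        moreover have "norm x \<le> norm ?y + norm (h /\<^sub>R real (Suc n))"
          using norm_triangle_ineq4[of ?y "h /\<^sub>R real (Suc n)"] by simp
        ultimately have "x \<notin> cball 0 R" "?y \<notin> cball 0 R"
          using that norm_ge_zero[of h] unfolding mem_cball dist_0_norm by linarith+
        then show ?thesis using R S(2) unfolding s_def by (metis diff_self mult_zero_left subsetD)
      qed
      show "norm (s n x) \<le> indicator (cball 0 (R + norm h)) x * (B * norm h)"
        using 1 2 by (cases "x \<in> cball 0 (R + norm h)") (auto simp: indicator_def)
    qed
  qed (auto simp: s_def)
  ultimately show ?thesis by (simp add: LIMSEQ_const_iff)
qed

lemma test_functions_mono: "\<phi> \<in> test_functions \<Omega> \<Longrightarrow> \<Omega> \<subseteq> \<Omega>' \<Longrightarrow> \<phi> \<in> test_functions \<Omega>'"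
  by (auto simp: test_functions_def)

lemma integral_gradient_test:
  assumes "\<Omega> \<in> sets lebesgue" and "\<psi> \<in> test_functions \<Omega>"
  shows "(LINT x|lebesgue_on \<Omega>. gradient \<psi> x \<bullet> h) = 0"
proof -
  have "continuous_on UNIV (\<lambda>x. gradient \<psi> x \<bullet> h)"
    by (intro continuous_intros smooth_continuous_gradient test_function_smooth[OF assms(2)])
  then have "(LINT x|lebesgue_on \<Omega>. gradient \<psi> x \<bullet> h) = (LINT x|lborel. gradient \<psi> x \<bullet> h)"
    using assms test_gradient_zero[OF assms(2)]
    by (intro lebesgue_on_integral_eq_lborel borel_measurable_continuous_onI) auto
  then show ?thesis
    using integral_gradient_lborel[OF test_functions_mono[OF assms(2) subset_UNIV]] by simp
qed

section \<open>Uniqueness of weak gradients\<close>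

text \<open>Boxes form an intersection-stable generator of the Borel sets, so the vanishing of the
  integrals extends to all Borel sets, in particular to the sets where G is positive or negative.
  The support in a box supplies the total integral, which the complement step needs.\<close>

lemma AE_zero_if_box_integrals_zero:
  fixes G :: "'a::euclidean_space \<Rightarrow> real"
  assumes G: "integrable lebesgue G"
    and box: "\<And>l u. (LINT x:box l u|lebesgue. G x) = 0"
    and supp: "\<And>x. x \<notin> box a c \<Longrightarrow> G x = 0"
  shows "AE x in lebesgue. G x = 0"
proof -
  have total: "integral\<^sup>L lebesgue G = 0"
  proof -
    have "(\<lambda>x. indicator (box a c) x *\<^sub>R G x) = G"
      using supp by (auto simp: indicator_def fun_eq_iff)
    then show ?thesis using box[of a c] by (simp add: set_lebesgue_integral_def)
  qed
  have setint: "set_integrable lebesgue A G" if "A \<in> sets borel" for A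
    using that G unfolding set_integrable_def
    by (intro integrable_mult_indicator) auto
  have borel: "(LINT x:A|lebesgue. G x) = 0" if "A \<in> sets borel" for A
  proof -
    have "Int_stable (range (\<lambda>(a, b). box a b :: 'a set))"
      unfolding Int_stable_def by (force simp: box_Int_box)
    moreover have "range (\<lambda>(a, b). box a b :: 'a set) \<subseteq> Pow UNIV" by simp
    moreover have "A \<in> sigma_sets UNIV (range (\<lambda>(a, b). box a b :: 'a set))"
      using that by (subst (asm) borel_eq_box) simp
    ultimately show ?thesis
    proof (induction rule: sigma_sets_induct_disjoint)
      case (basic A)
      then show ?case using box by auto
    next
      case empty
      then show ?case by (simp add: set_lebesgue_integral_def)
    next
      case (compl A)
      then have A: "A \<in> sets borel" by (subst borel_eq_box) simp
      have "(LINT x:UNIV - A|lebesgue. G x) = (LINT x|lebesgue. G x - indicator A x *\<^sub>R G x)"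
        unfolding set_lebesgue_integral_def by (intro Bochner_Integration.integral_cong) (auto simp: indicator_def)
      also have "\<dots> = integral\<^sup>L lebesgue G - (LINT x:A|lebesgue. G x)"
        unfolding set_lebesgue_integral_def
        using G setint[OF A, unfolded set_integrable_def] by (rule Bochner_Integration.integral_diff)
      finally show ?case using total compl by simp
    next
      case (union A)
      have A: "A i \<in> sets borel" for i
        using union(2) by (subst borel_eq_box) auto
      have "(LINT x:(\<Union>i. A i)|lebesgue. G x) = (\<Sum>i. LINT x:A i|lebesgue. G x)"
        using union(1) A
        by (intro lebesgue_integral_countable_add setint sets.countable_UN) (auto simp: disjoint_family_on_def)
      then show ?case using union(3) by simp
    qed
  qed
  \<comment> \<open>G is only Lebesgue measurable; a Borel version makes its sign sets
    Borel.\<close>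
  obtain G' where G'[measurable]: "G' \<in> borel_measurable lborel" and GG: "AE x in lborel. G x = G' x"
    using completion_ex_borel_measurable_real[of G lborel] G by auto
  have sgn: "AE x in lebesgue. s * G' x > 0 \<longrightarrow> G x = 0" if "s \<noteq> 0" for s :: real
  proof -
    define A where "A = {x. s * G' x > 0}"
    have "{x\<in>space lborel. s * G' x > 0} \<in> sets lborel" by measurable
    then have A: "A \<in> sets borel" by (simp add: A_def)
    have "integral\<^sup>L lebesgue (\<lambda>x. s * (indicator A x *\<^sub>R G x)) = 0"
      using borel[OF A] by (simp add: set_lebesgue_integral_def)
    moreover have "integrable lebesgue (\<lambda>x. s * (indicator A x *\<^sub>R G x))"
      using setint[OF A] by (simp add: set_integrable_def)
    moreover have "AE x in lebesgue. 0 \<le> s * (indicator A x *\<^sub>R G x)"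
      using AE_completion[OF GG] by eventually_elim (auto simp: A_def indicator_def)
    ultimately have "AE x in lebesgue. s * (indicator A x *\<^sub>R G x) = 0"
      using integral_nonneg_eq_0_iff_AE by blast
    then show ?thesis
      by eventually_elim (use that in \<open>auto simp: A_def indicator_def\<close>)
  qed
  have "AE x in lebesgue. 1 * G' x > 0 \<longrightarrow> G x = 0" "AE x in lebesgue. -1 * G' x > 0 \<longrightarrow> G x = 0"
    by (rule sgn, simp)+
  with AE_completion[OF GG] show ?thesis
    by eventually_elim auto
qed

text \<open>An open set is a countable union of closed boxes, and the boundaries of boxes are null
  sets. Open boxes are the right test sets because bump functions are positive exactly
  there.\<close>

lemma AE_if_AE_boxes:
  fixes \<Omega> :: "'a::euclidean_space set"
  assumes \<Omega>: "open \<Omega>" and box: "\<And>a c. cbox a c \<subseteq> \<Omega> \<Longrightarrow> AE x in lebesgue. x \<in> box a c \<longrightarrow> P x"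
  shows "AE x in lebesgue_on \<Omega>. P x"
proof -
  obtain D where D: "countable D" "D \<subseteq> Pow \<Omega>" "\<And>X. X \<in> D \<Longrightarrow> \<exists>a b. X = cbox a b" "\<Union>D = \<Omega>"
    using open_countable_Union_open_cbox[OF \<Omega>] by metis
  have "AE x in lebesgue. x \<in> X \<longrightarrow> P x" if "X \<in> D" for X
  proof -
    obtain a b where X: "X = cbox a b" "cbox a b \<subseteq> \<Omega>" using D(2,3) \<open>X \<in> D\<close> by blast
    have "AE x in lebesgue. x \<notin> cbox a b - box a b"
      using negligible_frontier_interval[of a b] by (intro AE_not_in) (simp add: negligible_iff_null_sets)
    then show ?thesis
      using box[OF X(2)] unfolding X(1) by eventually_elim auto
  qed
  then have "AE x in lebesgue. \<forall>X\<in>D. x \<in> X \<longrightarrow> P x"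
    by (subst AE_ball_countable[OF D(1)]) blast
  then have "AE x in lebesgue. x \<in> \<Omega> \<longrightarrow> P x"
    by eventually_elim (use D(4) in blast)
  then show ?thesis
    using \<Omega> by (subst AE_restrict_space_iff) auto
qed

lemma integrable_test_mult:
  fixes g :: "'a::euclidean_space \<Rightarrow> 'b::euclidean_space"
  assumes "open \<Omega>" and \<phi>: "\<phi> \<in> test_functions \<Omega>"
    and g: "\<And>C. compact C \<Longrightarrow> C \<subseteq> \<Omega> \<Longrightarrow> integrable (lebesgue_on C) g"
  shows "integrable (lebesgue_on \<Omega>) (\<lambda>x. \<phi> x *\<^sub>R g x)"
proof -
  obtain S where S: "compact S" "S \<subseteq> \<Omega>" "\<And>x. x \<notin> S \<Longrightarrow> \<phi> x = 0"
    using test_functionE[OF \<phi>] by metis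
  obtain B where B: "B > 0" "\<And>x. \<bar>\<phi> x\<bar> \<le> B"
    using test_function_bounded[OF \<phi>] by metis
  have m: "\<phi> \<in> borel_measurable lebesgue"
    by (intro measurable_completion) (simp add: borel_measurable_continuous_onI smooth_continuous test_function_smooth[OF \<phi>])
  have i: "integrable lebesgue (\<lambda>x. indicator S x *\<^sub>R g x)"
    using g[OF S(1,2)] S(1) by (subst (asm) integrable_restrict_space) (auto simp: compact_imp_closed)
  have "integrable lebesgue (\<lambda>x. \<phi> x *\<^sub>R indicator S x *\<^sub>R g x)"
    by (rule Bochner_Integration.integrable_bound[where f = "\<lambda>x. B *\<^sub>R (indicator S x *\<^sub>R g x)"])
      (use i B m in \<open>auto intro!: borel_measurable_scaleR mult_right_mono simp del: scaleR_scaleR\<close>)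
  moreover have "(\<lambda>x. \<phi> x *\<^sub>R indicator S x *\<^sub>R g x) = (\<lambda>x. indicator \<Omega> x *\<^sub>R (\<phi> x *\<^sub>R g x))"
    using S(2,3) by (auto simp: indicator_def fun_eq_iff)
  ultimately show ?thesis
    using assms(1) by (subst integrable_restrict_space) auto
qed

text \<open>The functions \<open>1 - exp (- k B)\<close>, with \<open>B\<close> a bump function of a box, are test functions that converge
  boundedly to the indicator function of the box.\<close>

lemma AE_zero_if_test_integrals_zero:
  fixes g :: "'a::euclidean_space \<Rightarrow> real"
  assumes \<Omega>: "open \<Omega>"
    and g: "\<And>C. compact C \<Longrightarrow> C \<subseteq> \<Omega> \<Longrightarrow> integrable (lebesgue_on C) g"
    and zero: "\<And>\<phi>. \<phi> \<in> test_functions \<Omega> \<Longrightarrow> (LINT x|lebesgue_on \<Omega>. \<phi> x * g x) = 0"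
  shows "AE x in lebesgue_on \<Omega>. g x = 0"
proof -
  have int: "integrable lebesgue (\<lambda>x. indicator (cbox l u) x * g x)" if "cbox l u \<subseteq> \<Omega>" for l u
    using g[OF compact_cbox that] by (subst (asm) integrable_restrict_space) auto
  have box: "(LINT x|lebesgue. indicator (box l u) x * g x) = 0" if sub: "cbox l u \<subseteq> \<Omega>" for l u
  proof -
    define \<phi> where "\<phi> k x = 1 - exp (- real k * box_bump l u x)" for k x
    have \<phi>0: "\<phi> k x = 0" if "x \<notin> box l u" for k x
      using box_bump_zero[OF that] by (simp add: \<phi>_def)
    have \<phi>1: "\<bar>\<phi> k x\<bar> \<le> 1" for k x
      using box_bump_pos[of x l u] box_bump_zero[of x l u]
      by (cases "x \<in> box l u") (auto simp: \<phi>_def)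
    have test: "\<phi> k \<in> test_functions \<Omega>" for k
      unfolding \<phi>_def
    proof (rule test_functionI[OF _ compact_cbox sub])
      show "smooth (\<lambda>x. 1 - exp (- real k * box_bump l u x))"
        by (rule smooth_diff[OF smooth_const smooth_exp[OF smooth_cmult[OF smooth_box_bump]]])
      show "1 - exp (- real k * box_bump l u x) = 0" if "x \<notin> cbox l u" for x
        using \<phi>0[of x k] that box_subset_cbox unfolding \<phi>_def by blast
    qed
    have m: "\<phi> k \<in> borel_measurable lebesgue" for k
      by (intro measurable_completion) (simp add: borel_measurable_continuous_onI smooth_continuous test_function_smooth[OF test])
    have eq: "\<phi> k x * g x = \<phi> k x * (indicator (cbox l u) x * g x)" for k x
      using \<phi>0[of x k] box_subset_cbox by (cases "x \<in> cbox l u") auto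
    have "(\<lambda>k. LINT x|lebesgue. \<phi> k x * g x) \<longlonglongrightarrow> (LINT x|lebesgue. indicator (box l u) x * g x)"
    proof (rule integral_dominated_convergence[where w = "\<lambda>x. norm (indicator (cbox l u) x * g x)"])
      have "(\<lambda>x. indicator (box l u) x * g x) = (\<lambda>x. indicator (box l u) x * (indicator (cbox l u) x * g x))"
        using box_subset_cbox by (auto simp: indicator_def fun_eq_iff)
      then show "(\<lambda>x. indicator (box l u) x * g x) \<in> borel_measurable lebesgue"
        using borel_measurable_times[OF borel_measurable_indicator borel_measurable_integrable[OF int[OF sub]]] by simp
      show "(\<lambda>x. \<phi> k x * g x) \<in> borel_measurable lebesgue" for k
        using borel_measurable_integrable[OF int[OF sub]] m[of k] unfolding eq by simp
      show "integrable lebesgue (\<lambda>x. norm (indicator (cbox l u) x * g x))"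
        using int[OF sub] by (rule integrable_norm)
      show "AE x in lebesgue. norm (\<phi> k x * g x) \<le> norm (indicator (cbox l u) x * g x)" for k
        unfolding eq norm_mult[of "\<phi> k _"]
        by (rule AE_I2) (use \<phi>1 in \<open>auto intro!: mult_left_le_one_le\<close>)
      show "AE x in lebesgue. (\<lambda>k. \<phi> k x * g x) \<longlonglongrightarrow> indicator (box l u) x * g x"
      proof (rule AE_I2)
        fix x
        show "(\<lambda>k. \<phi> k x * g x) \<longlonglongrightarrow> indicator (box l u) x * g x"
        proof (cases "x \<in> box l u")
          case True
          then have p: "box_bump l u x > 0" by (rule box_bump_pos)
          have "(\<lambda>k. exp (- box_bump l u x) ^ k) \<longlonglongrightarrow> 0"
            using p by (intro LIMSEQ_power_zero) simp
          then have "(\<lambda>k. \<phi> k x) \<longlonglongrightarrow> 1 - 0"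
            unfolding \<phi>_def by (intro tendsto_diff) (simp_all add: exp_of_nat_mult[symmetric] mult.commute)
          from tendsto_mult_right[OF this, of "g x"] show ?thesis using True by simp
        qed (simp add: \<phi>0)
      qed
    qed
    moreover have "(LINT x|lebesgue. \<phi> k x * g x) = 0" for k
    proof -
      have "(LINT x|lebesgue_on \<Omega>. \<phi> k x * g x) = (LINT x|lebesgue. indicator \<Omega> x *\<^sub>R (\<phi> k x * g x))"
        using \<Omega> by (intro integral_restrict_space) auto
      also have "\<dots> = (LINT x|lebesgue. \<phi> k x * g x)"
        using test_function_zero[OF test] by (intro Bochner_Integration.integral_cong) (auto simp: indicator_def)
      finally show ?thesis using zero[OF test] by simp
    qed
    ultimately show ?thesis by (simp add: LIMSEQ_const_iff)
  qed
  have AE_box: "AE x in lebesgue. x \<in> box a c \<longrightarrow> g x = 0" if sub: "cbox a c \<subseteq> \<Omega>" for a c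
  proof -
    have "AE x in lebesgue. indicator (box a c) x * g x = 0"
    proof (rule AE_zero_if_box_integrals_zero[where a = a and c = c])
      have "integrable lebesgue (\<lambda>x. indicator (box a c) x *\<^sub>R (indicator (cbox a c) x * g x))"
        by (rule integrable_mult_indicator[OF _ int[OF sub]]) auto
      moreover have "(\<lambda>x. indicator (box a c) x *\<^sub>R (indicator (cbox a c) x * g x)) = (\<lambda>x. indicator (box a c) x * g x)"
        using box_subset_cbox by (auto simp: indicator_def fun_eq_iff)
      ultimately show "integrable lebesgue (\<lambda>x. indicator (box a c) x * g x)" by simp
      show "(LINT x:box l u|lebesgue. indicator (box a c) x * g x) = 0" for l u
      proof -
        \<comment> \<open>An intersection of boxes is a box, so \<open>box\<close> applies to it.
          Its closed box lies in \<open>cbox a c\<close> only if the intersection is nonempty; the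
          empty case is trivial.\<close>
        obtain l' u' where I: "box l u \<inter> box a c = box l' u'"
          unfolding box_Int_box by blast
        have "(LINT x:box l u|lebesgue. indicator (box a c) x * g x) = (LINT x|lebesgue. indicator (box l' u') x * g x)"
          unfolding set_lebesgue_integral_def I[symmetric]
          by (intro Bochner_Integration.integral_cong) (auto simp: indicator_def)
        also have "\<dots> = 0"
        proof (cases "box l' u' = {}")
          case False
          then have "cbox l' u' \<subseteq> cbox a c"
            using I closure_mono[of "box l' u'" "box a c"] closure_box[of l' u'] closure_box[of a c]
            by (metis Int_lower2 box_eq_empty(1) subset_empty)
          then show ?thesis using box sub by blast
        qed simp
        finally show ?thesis .
      qed
    qed auto
    then show ?thesis by eventually_elim (auto simp: indicator_def)
  qed
  show ?thesis by (rule AE_if_AE_boxes[OF \<Omega> AE_box])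
qed

text \<open>\<open>weak_gradient\<close> is chosen by \<open>SOME\<close>, so it can be computed
  only up to null sets; this lemma makes every such computation possible. It follows by testing each
  component of the difference.\<close>

lemma has_weak_gradient_unique:
  assumes \<Omega>: "open \<Omega>" and g: "has_weak_gradient \<Omega> u g" and h: "has_weak_gradient \<Omega> u h"
  shows "AE x in lebesgue_on \<Omega>. g x = h x"
proof -
  have "AE x in lebesgue_on \<Omega>. (g x - h x) \<bullet> b = 0" for b
  proof (rule AE_zero_if_test_integrals_zero[OF \<Omega>])
    show "integrable (lebesgue_on C) (\<lambda>x. (g x - h x) \<bullet> b)" if "compact C" "C \<subseteq> \<Omega>" for C
      using g h that unfolding has_weak_gradient_def
      by (intro integrable_inner_left Bochner_Integration.integrable_diff) auto
    show "(LINT x|lebesgue_on \<Omega>. \<phi> x * ((g x - h x) \<bullet> b)) = 0" if \<phi>: "\<phi> \<in> test_functions \<Omega>" for \<phi>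
    proof -
      have i: "integrable (lebesgue_on \<Omega>) (\<lambda>x. \<phi> x *\<^sub>R g x)" "integrable (lebesgue_on \<Omega>) (\<lambda>x. \<phi> x *\<^sub>R h x)"
        using g h unfolding has_weak_gradient_def by (auto intro!: integrable_test_mult[OF \<Omega> \<phi>])
      have "(LINT x|lebesgue_on \<Omega>. \<phi> x * ((g x - h x) \<bullet> b)) = (LINT x|lebesgue_on \<Omega>. (\<phi> x *\<^sub>R g x - \<phi> x *\<^sub>R h x) \<bullet> b)"
        by (simp add: algebra_simps inner_diff_left)
      also have "\<dots> = (LINT x|lebesgue_on \<Omega>. \<phi> x *\<^sub>R g x - \<phi> x *\<^sub>R h x) \<bullet> b"
        using i by (intro integral_inner_left) auto
      also have "\<dots> = 0"
        using g h \<phi> i unfolding has_weak_gradient_def by (simp add: equation_minus_iff)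
      finally show ?thesis .
    qed
  qed
  then have "AE x in lebesgue_on \<Omega>. \<forall>b\<in>Basis. (g x - h x) \<bullet> b = 0"
    by (intro AE_finite_allI) auto
  then show ?thesis
    by eventually_elim (simp add: euclidean_eq_iff[of "g _"] inner_diff_left)
qed

section \<open>Square integrable functions\<close>

text \<open>Along a subsequence whose successive L1 distances are below (1/2)^k, the series of
  absolute differences has finite integral, hence converges almost everywhere, and the telescoping
  sum gives the limit.\<close>

lemma L1_Cauchy_AE_subseq:
  fixes \<psi> :: "nat \<Rightarrow> 'a \<Rightarrow> 'b::{banach, second_countable_topology}"
  assumes int: "\<And>n. integrable M (\<psi> n)"
    and Cauchy: "\<And>e. e > 0 \<Longrightarrow> \<exists>N. \<forall>m\<ge>N. \<forall>n\<ge>N. (LINT x|M. norm (\<psi> m x - \<psi> n x)) < e"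
  obtains r u where "strict_mono (r :: nat \<Rightarrow> nat)" "u \<in> borel_measurable M" "AE x in M. (\<lambda>k. \<psi> (r k) x) \<longlonglongrightarrow> u x"
proof -
  have "\<exists>N. \<forall>m\<ge>N. \<forall>n\<ge>N. (LINT x|M. norm (\<psi> m x - \<psi> n x)) < (1/2)^k" for k
    by (rule Cauchy) simp
  then obtain N where N: "\<And>k m n. m \<ge> N k \<Longrightarrow> n \<ge> N k \<Longrightarrow> (LINT x|M. norm (\<psi> m x - \<psi> n x)) < (1/2)^k"
    by metis
  \<comment> \<open>Summing the thresholds makes r strictly increasing and at least
    \<open>N k\<close> at once.\<close>
  define r where "r k = (\<Sum>i\<le>k. Suc (N i))" for k
  have r: "strict_mono r"
    by (simp add: strict_mono_Suc_iff r_def)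
  have rN: "r k \<ge> N k" "r (Suc k) \<ge> N k" for k
    using member_le_sum[of k "{..k}" "\<lambda>i. Suc (N i)"] by (auto simp: r_def)
  define d where "d k x = norm (\<psi> (r (Suc k)) x - \<psi> (r k) x)" for k x
  have dint: "integrable M (d k)" for k
    unfolding d_def using int by auto
  then have [measurable]: "d k \<in> borel_measurable M" for k by auto
  have "(\<integral>\<^sup>+ x. d k x \<partial>M) \<le> ennreal ((1/2)^k)" for k
    using N[OF rN(2,1), of k] dint[of k]
    by (subst nn_integral_eq_integral) (auto simp: d_def[abs_def] intro!: ennreal_leI)
  then have "(\<Sum>k. \<integral>\<^sup>+ x. d k x \<partial>M) \<le> (\<Sum>k. ennreal ((1/2)^k))"
    by (intro suminf_le) auto
  also have "\<dots> = ennreal (\<Sum>k. (1/2)^k)"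
    by (intro suminf_ennreal2) auto
  also have "\<dots> < \<infinity>" by simp
  finally have "(\<integral>\<^sup>+ x. (\<Sum>k. ennreal (d k x)) \<partial>M) \<noteq> \<infinity>"
    by (subst nn_integral_suminf) auto
  then have "AE x in M. (\<Sum>k. ennreal (d k x)) \<noteq> \<infinity>"
    by (intro nn_integral_noteq_infinite) auto
  then have conv: "AE x in M. convergent (\<lambda>k. \<psi> (r k) x)"
  proof eventually_elim
    case (elim x)
    then have "summable (\<lambda>k. d k x)"
      by (intro summable_suminf_not_top) (auto simp: d_def)
    then have "summable (\<lambda>k. norm (\<psi> (r (Suc k)) x - \<psi> (r k) x))"
      by (simp add: d_def)
    then have "summable (\<lambda>k. \<psi> (r (Suc k)) x - \<psi> (r k) x)"
      by (rule summable_norm_cancel)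
    then have "convergent (\<lambda>n. \<Sum>k<n. \<psi> (r (Suc k)) x - \<psi> (r k) x)"
      by (simp add: summable_iff_convergent)
    then have "convergent (\<lambda>n. \<psi> (r n) x - \<psi> (r 0) x)"
      using sum_lessThan_telescope[of "\<lambda>k. \<psi> (r k) x"] by simp
    then have "convergent (\<lambda>n. (\<psi> (r n) x - \<psi> (r 0) x) + \<psi> (r 0) x)"
      by (intro convergent_add convergent_const)
    then show ?case by simp
  qed
  show ?thesis
  proof (rule that[OF r])
    show "(\<lambda>x. lim (\<lambda>k. \<psi> (r k) x)) \<in> borel_measurable M"
      using int by (intro borel_measurable_lim_metric) auto
    show "AE x in M. (\<lambda>k. \<psi> (r k) x) \<longlonglongrightarrow> lim (\<lambda>k. \<psi> (r k) x)"
      using conv by eventually_elim (simp add: convergent_LIMSEQ_iff)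
  qed
qed

text \<open>Fatou's lemma, arranged to give integrability of the limit together with the bound. The
  bound is asked only from \<open>N\<close> on, because Cauchy conditions supply it only for late
  indices.\<close>

lemma integral_Fatou_bound:
  fixes h :: "nat \<Rightarrow> 'a \<Rightarrow> real"
  assumes int: "\<And>k. integrable M (h k)" and nn: "\<And>k x. h k x \<ge> 0" and le: "\<And>k. k \<ge> N \<Longrightarrow> (LINT x|M. h k x) \<le> C"
    and lim: "AE x in M. (\<lambda>k. h k x) \<longlonglongrightarrow> g x" and g: "g \<in> borel_measurable M"
  shows "integrable M g" and "(LINT x|M. g x) \<le> C"
proof -
  have C: "C \<ge> 0" using le[of N] nn by (meson Bochner_Integration.integral_nonneg order_trans order_refl)
  have pos: "AE x in M. 0 \<le> g x"
    using lim by eventually_elim (use nn in \<open>auto intro: LIMSEQ_le_const\<close>)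
  have "(\<integral>\<^sup>+ x. ennreal (g x) \<partial>M) = (\<integral>\<^sup>+ x. liminf (\<lambda>k. ennreal (h k x)) \<partial>M)"
    by (rule nn_integral_cong_AE, use lim in eventually_elim)
      (auto intro!: lim_imp_Liminf[symmetric] tendsto_ennrealI)
  also have "\<dots> \<le> liminf (\<lambda>k. \<integral>\<^sup>+ x. ennreal (h k x) \<partial>M)"
    using int by (intro nn_integral_liminf) auto
  also have "\<dots> \<le> liminf (\<lambda>k. ennreal C)"
    by (intro Liminf_mono eventually_sequentiallyI[of N])
      (use int le nn in \<open>auto simp: nn_integral_eq_integral intro!: ennreal_leI\<close>)
  also have "\<dots> = ennreal C" by (simp add: Liminf_const)
  finally have *: "(\<integral>\<^sup>+ x. ennreal (g x) \<partial>M) \<le> ennreal C" .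
  show i: "integrable M g"
    using * pos g by (intro integrableI_nonneg) (auto simp: order_le_less_trans)
  show "(LINT x|M. g x) \<le> C"
    using * C by (subst (asm) nn_integral_eq_integral[OF i pos]) (simp add: ennreal_le_iff)
qed

lemma LIMSEQ_null_squeeze:
  fixes f g :: "nat \<Rightarrow> real"
  assumes "g \<longlonglongrightarrow> 0" and "\<And>n. 0 \<le> f n" and "\<And>n. f n \<le> g n"
  shows "f \<longlonglongrightarrow> 0"
  by (rule tendsto_sandwich[OF _ _ tendsto_const assms(1)]) (simp_all add: assms(2,3))

lemma power2_sum_le: "(y + z)\<^sup>2 \<le> 2 * y\<^sup>2 + 2 * (z::real)\<^sup>2"
  using zero_le_power2[of "y - z"] by (simp add: power2_diff power2_sum)

lemma L1_null_imp_AE_eq: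
  assumes "integrable M h" and "(LINT x|M. \<bar>h x\<bar>) \<le> (0::real)"
  shows "AE x in M. h x = 0"
proof -
  have "0 \<le> (LINT x|M. \<bar>h x\<bar>)" by simp
  then have "(LINT x|M. \<bar>h x\<bar>) = 0" using assms(2) by linarith
  then have "AE x in M. \<bar>h x\<bar> = 0"
    using integral_nonneg_eq_0_iff_AE[of M "\<lambda>x. \<bar>h x\<bar>"] assms(1) by auto
  then show ?thesis by simp
qed

section \<open>The Hilbert space of square integrable functions\<close>

locale bounded_open =
  fixes \<Omega> :: "'a::euclidean_space set"
  assumes open_domain: "open \<Omega>" and bounded_domain: "bounded \<Omega>"
begin

abbreviation "\<mu> \<equiv> lebesgue_on \<Omega>"

lemma sets_domain: "\<Omega> \<in> sets lebesgue"
  using open_domain by auto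

lemma finite_measure_domain: "finite_measure \<mu>"
  using bounded_domain sets_domain by (intro finite_measure_lebesgue_on bounded_set_imp_lmeasurable)

lemma continuous_borel_measurable:
  fixes h :: "'a \<Rightarrow> 'b::euclidean_space"
  shows "continuous_on UNIV h \<Longrightarrow> h \<in> borel_measurable \<mu>"
  by (intro continuous_imp_measurable_on_sets_lebesgue sets_domain) (auto intro: continuous_on_subset)

text \<open>Completeness of Lebesgue measure. It gives measurability of the chosen weak gradient,
  which is known only almost everywhere.\<close>

lemma borel_measurable_AE_cong:
  fixes g :: "'a \<Rightarrow> 'b::euclidean_space"
  assumes f: "f \<in> borel_measurable \<mu>" and ae: "AE x in \<mu>. f x = g x"
  shows "g \<in> borel_measurable \<mu>"
proof -
  have "AE x in lebesgue. x \<in> \<Omega> \<longrightarrow> f x = g x"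
    using ae sets_domain by (subst (asm) AE_restrict_space_iff) auto
  then have eq: "AE x in lebesgue. (if x \<in> \<Omega> then f x else 0) = (if x \<in> \<Omega> then g x else 0)"
    by eventually_elim auto
  have "(\<lambda>x. if x \<in> \<Omega> then f x else 0) \<in> borel_measurable lebesgue"
    by (rule borel_measurable_if[OF sets_domain, THEN iffD2, OF f])
  from borel_measurable_AE[OF this eq] show ?thesis
    by (rule borel_measurable_if[OF sets_domain, THEN iffD1])
qed

lemma integrable_bounded:
  fixes h :: "'a \<Rightarrow> 'b::euclidean_space"
  assumes "h \<in> borel_measurable \<mu>" and "\<And>x. norm (h x) \<le> C"
  shows "integrable \<mu> h"
  using finite_measure.integrable_const_bound[OF finite_measure_domain] assms by blast

lemma L2_measurable: "u \<in> L2 \<Omega> \<Longrightarrow> u \<in> borel_measurable \<mu>"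
  by (simp add: L2_def)

lemma L2_norm2: "u \<in> L2 \<Omega> \<Longrightarrow> integrable \<mu> (\<lambda>x. (norm (u x))\<^sup>2)"
  by (simp add: L2_def)

lemma L2_inner_integrable:
  assumes "u \<in> L2 \<Omega>" and "v \<in> L2 \<Omega>"
  shows "integrable \<mu> (\<lambda>x. u x \<bullet> v x)"
proof (rule Bochner_Integration.integrable_bound)
  show "integrable \<mu> (\<lambda>x. (norm (u x))\<^sup>2 + (norm (v x))\<^sup>2)"
    using assms by (intro Bochner_Integration.integrable_add L2_norm2)
  show "(\<lambda>x. u x \<bullet> v x) \<in> borel_measurable \<mu>"
    using assms L2_measurable by measurable
  have "\<bar>a \<bullet> b\<bar> \<le> (norm a)\<^sup>2 + (norm b)\<^sup>2" for a b :: 'b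
  proof -
    have "2 * (norm a * norm b) \<le> (norm a)\<^sup>2 + (norm b)\<^sup>2"
      using zero_le_power2[of "norm a - norm b"] by (simp add: power2_diff)
    moreover have "0 \<le> norm a * norm b" by simp
    ultimately show ?thesis using Cauchy_Schwarz_ineq2[of a b] by linarith
  qed
  then show "AE x in \<mu>. norm (u x \<bullet> v x) \<le> norm ((norm (u x))\<^sup>2 + (norm (v x))\<^sup>2)"
    by auto
qed

lemma L2_mult_integrable:
  fixes u v :: "'a \<Rightarrow> real"
  shows "u \<in> L2 \<Omega> \<Longrightarrow> v \<in> L2 \<Omega> \<Longrightarrow> integrable \<mu> (\<lambda>x. u x * v x)"
  using L2_inner_integrable[of u v] by simp

lemma L2_dominated:
  fixes u :: "'a \<Rightarrow> 'b::euclidean_space" and v :: "'a \<Rightarrow> 'c::euclidean_space"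
  assumes v: "v \<in> L2 \<Omega>" and u: "u \<in> borel_measurable \<mu>" and le: "AE x in \<mu>. norm (u x) \<le> norm (v x)"
  shows "u \<in> L2 \<Omega>"
proof -
  have "integrable \<mu> (\<lambda>x. (norm (u x))\<^sup>2)"
    by (rule Bochner_Integration.integrable_bound[OF L2_norm2[OF v]])
      (use u le in \<open>auto elim!: eventually_mono intro: power_mono\<close>)
  then show ?thesis using u by (simp add: L2_def)
qed

lemma L2_AE_cong:
  fixes u v :: "'a \<Rightarrow> 'b::euclidean_space"
  shows "u \<in> L2 \<Omega> \<Longrightarrow> AE x in \<mu>. u x = v x \<Longrightarrow> v \<in> L2 \<Omega>"
  by (rule L2_dominated) (auto intro: borel_measurable_AE_cong L2_measurable elim!: eventually_mono)

lemma L2_scaleR: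
  fixes u :: "'a \<Rightarrow> 'b::euclidean_space"
  assumes "u \<in> L2 \<Omega>"
  shows "(\<lambda>x. c *\<^sub>R u x) \<in> L2 \<Omega>"
  using assms by (auto simp: L2_def power_mult_distrib)

lemma L2_cmult:
  fixes u :: "'a \<Rightarrow> real"
  shows "u \<in> L2 \<Omega> \<Longrightarrow> (\<lambda>x. c * u x) \<in> L2 \<Omega>"
  using L2_scaleR[of u c] by simp

lemma L2_add:
  fixes u v :: "'a \<Rightarrow> 'b::euclidean_space"
  assumes "u \<in> L2 \<Omega>" and "v \<in> L2 \<Omega>"
  shows "(\<lambda>x. u x + v x) \<in> L2 \<Omega>"
proof -
  have "integrable \<mu> (\<lambda>x. (norm (u x))\<^sup>2 + (norm (v x))\<^sup>2 + 2 * (u x \<bullet> v x))"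
    using assms by (intro Bochner_Integration.integrable_add L2_norm2 integrable_mult_right L2_inner_integrable)
  moreover have "(norm (u x + v x))\<^sup>2 = (norm (u x))\<^sup>2 + (norm (v x))\<^sup>2 + 2 * (u x \<bullet> v x)" for x
    by (simp add: power2_norm_eq_inner inner_add_left inner_add_right inner_commute)
  ultimately show ?thesis using assms by (auto simp: L2_def)
qed

lemma L2_diff:
  fixes u v :: "'a \<Rightarrow> 'b::euclidean_space"
  shows "u \<in> L2 \<Omega> \<Longrightarrow> v \<in> L2 \<Omega> \<Longrightarrow> (\<lambda>x. u x - v x) \<in> L2 \<Omega>"
  using L2_add[of u "\<lambda>x. -1 *\<^sub>R v x"] L2_scaleR[of v "-1"] by simp

lemma L2_bounded:
  fixes h :: "'a \<Rightarrow> 'b::euclidean_space"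
  assumes "h \<in> borel_measurable \<mu>" and "\<And>x. norm (h x) \<le> C"
  shows "h \<in> L2 \<Omega>"
proof -
  have "integrable \<mu> (\<lambda>x. (norm (h x))\<^sup>2)"
    by (rule integrable_bounded[where C = "C\<^sup>2"]) (use assms in \<open>auto intro: power_mono\<close>)
  then show ?thesis using assms by (simp add: L2_def)
qed

lemma L2_const: "(\<lambda>x. c :: 'b::euclidean_space) \<in> L2 \<Omega>"
  by (rule L2_bounded[where C = "norm c"]) auto

lemma L2_norm: 
  fixes u :: "'a \<Rightarrow> 'b::euclidean_space"
  shows "u \<in> L2 \<Omega> \<Longrightarrow> (\<lambda>x. norm (u x)) \<in> L2 \<Omega>"
  by (auto simp: L2_def)

lemma L2_integrable:
  fixes u :: "'a \<Rightarrow> 'b::euclidean_space"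
  assumes "u \<in> L2 \<Omega>"
  shows "integrable \<mu> u"
proof -
  have "integrable \<mu> (\<lambda>x. norm (u x) * 1)"
    by (rule L2_mult_integrable[OF L2_norm[OF assms] L2_const])
  then show ?thesis using L2_measurable[OF assms] by (simp add: integrable_norm_iff)
qed

lemma L2_bounded_scaleR:
  fixes u :: "'a \<Rightarrow> 'b::euclidean_space"
  assumes u: "u \<in> L2 \<Omega>" and h: "h \<in> borel_measurable \<mu>" and le: "\<And>x. \<bar>h x\<bar> \<le> C"
  shows "(\<lambda>x. h x *\<^sub>R u x) \<in> L2 \<Omega>"
proof (rule L2_dominated[OF L2_scaleR[OF u, of C]])
  show "(\<lambda>x. h x *\<^sub>R u x) \<in> borel_measurable \<mu>"
    using h L2_measurable[OF u] by measurable
  show "AE x in \<mu>. norm (h x *\<^sub>R u x) \<le> norm (C *\<^sub>R u x)"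
    using le by (auto intro!: mult_right_mono order_trans[OF le abs_ge_self])
qed

text \<open>A single polymorphic form serves functions and gradient fields, since on the reals the
  inner product is multiplication.\<close>

definition ip :: "('a \<Rightarrow> 'b::euclidean_space) \<Rightarrow> ('a \<Rightarrow> 'b) \<Rightarrow> real" where
  "ip u v = (LINT x|\<mu>. u x \<bullet> v x)"

lemma ip_self: "ip u u = (LINT x|\<mu>. (norm (u x))\<^sup>2)"
  by (simp add: ip_def power2_norm_eq_inner)

lemma ip_self_nonneg: "0 \<le> ip u u"
  by (simp add: ip_self)

lemma ip_commute: "ip u v = ip v u"
  by (simp add: ip_def inner_commute)

lemma ip_add_left:
  "u \<in> L2 \<Omega> \<Longrightarrow> v \<in> L2 \<Omega> \<Longrightarrow> w \<in> L2 \<Omega> \<Longrightarrow> ip (\<lambda>x. u x + v x) w = ip u w + ip v w"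
  by (simp add: ip_def inner_add_left L2_inner_integrable)

lemma ip_diff_left:
  "u \<in> L2 \<Omega> \<Longrightarrow> v \<in> L2 \<Omega> \<Longrightarrow> w \<in> L2 \<Omega> \<Longrightarrow> ip (\<lambda>x. u x - v x) w = ip u w - ip v w"
  by (simp add: ip_def inner_diff_left L2_inner_integrable)

lemma ip_scaleR_left: "ip (\<lambda>x. c *\<^sub>R u x) w = c * ip u w"
  by (simp add: ip_def)

lemma ip_add_right:
  "u \<in> L2 \<Omega> \<Longrightarrow> v \<in> L2 \<Omega> \<Longrightarrow> w \<in> L2 \<Omega> \<Longrightarrow> ip w (\<lambda>x. u x + v x) = ip w u + ip w v"
  by (simp add: ip_def inner_add_right L2_inner_integrable)

lemma ip_diff_right:
  "u \<in> L2 \<Omega> \<Longrightarrow> v \<in> L2 \<Omega> \<Longrightarrow> w \<in> L2 \<Omega> \<Longrightarrow> ip w (\<lambda>x. u x - v x) = ip w u - ip w v"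
  by (simp add: ip_def inner_diff_right L2_inner_integrable)

lemma ip_scaleR_right: "ip w (\<lambda>x. c *\<^sub>R u x) = c * ip w u"
  by (simp add: ip_def)

lemma ip_AE_cong:
  fixes u :: "'a \<Rightarrow> 'b::euclidean_space"
  assumes "u \<in> L2 \<Omega>" "v \<in> L2 \<Omega>" and "AE x in \<mu>. u x = u' x" and "AE x in \<mu>. v x = v' x"
  shows "ip u' v' = ip u v"
  unfolding ip_def
proof (rule integral_cong_AE)
  have "u' \<in> L2 \<Omega>" "v' \<in> L2 \<Omega>" using assms L2_AE_cong by blast+
  then show "(\<lambda>x. u' x \<bullet> v' x) \<in> borel_measurable \<mu>"
    using L2_inner_integrable by blast
  show "(\<lambda>x. u x \<bullet> v x) \<in> borel_measurable \<mu>"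
    using assms L2_inner_integrable by blast
  show "AE x in \<mu>. u' x \<bullet> v' x = u x \<bullet> v x"
    using assms(3,4) by eventually_elim simp
qed

lemma ip_add_self:
  assumes "u \<in> L2 \<Omega>" "v \<in> L2 \<Omega>"
  shows "ip (\<lambda>x. u x + v x) (\<lambda>x. u x + v x) = ip u u + 2 * ip u v + ip v v"
  using assms by (simp add: ip_add_left ip_add_right L2_add ip_commute)

lemma ip_diff_self:
  assumes "u \<in> L2 \<Omega>" "v \<in> L2 \<Omega>"
  shows "ip (\<lambda>x. u x - v x) (\<lambda>x. u x - v x) = ip u u - 2 * ip u v + ip v v"
  using assms by (simp add: ip_diff_left ip_diff_right L2_diff ip_commute)

lemma ip_Cauchy_Schwarz:
  assumes u: "u \<in> L2 \<Omega>" and v: "v \<in> L2 \<Omega>"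
  shows "\<bar>ip u v\<bar> \<le> sqrt (ip u u) * sqrt (ip v v)"
proof -
  have t: "0 \<le> ip u u + 2 * t * ip u v + t\<^sup>2 * ip v v" for t
    using ip_add_self[OF u L2_scaleR[OF v, of t]] ip_self_nonneg[of "\<lambda>x. u x + t *\<^sub>R v x"]
    by (simp add: ip_scaleR_left ip_scaleR_right power2_eq_square mult.assoc)
  have "(ip u v)\<^sup>2 \<le> ip u u * ip v v"
  proof (cases "ip v v = 0")
    case True
    have "ip u v = 0"
    proof (rule ccontr)
      assume "ip u v \<noteq> 0"
      \<comment> \<open>If \<open>ip v v\<close> vanishes, the expression is affine in t, and this t
        gives it the value -1.\<close>
      then show False
        using t[of "- (ip u u + 1) / (2 * ip u v)"] True by (simp add: field_simps)
    qed
    then show ?thesis using True by simp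
  next
    case False
    then have p: "ip v v > 0" using ip_self_nonneg[of v] by simp
    \<comment> \<open>The parameter inserted here minimises the quadratic polynomial in t.\<close>
    have "0 \<le> (ip u u + 2 * (- ip u v / ip v v) * ip u v + (- ip u v / ip v v)\<^sup>2 * ip v v) * ip v v"
      using t[of "- ip u v / ip v v"] p by (intro mult_nonneg_nonneg) auto
    also have "\<dots> = ip u u * ip v v - (ip u v)\<^sup>2"
      using p by (simp add: field_simps power2_eq_square)
    finally show ?thesis by simp
  qed
  then have "sqrt ((ip u v)\<^sup>2) \<le> sqrt (ip u u * ip v v)"
    by (rule real_sqrt_le_mono)
  then show ?thesis by (simp add: real_sqrt_mult)
qed

lemma ip_triangle:
  assumes u: "u \<in> L2 \<Omega>" and v: "v \<in> L2 \<Omega>"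
  shows "sqrt (ip (\<lambda>x. u x + v x) (\<lambda>x. u x + v x)) \<le> sqrt (ip u u) + sqrt (ip v v)"
proof (rule real_le_lsqrt)
  show "0 \<le> sqrt (ip u u) + sqrt (ip v v)" by (simp add: ip_self_nonneg)
  have "ip u v \<le> sqrt (ip u u) * sqrt (ip v v)"
    using ip_Cauchy_Schwarz[OF u v] by linarith
  then show "ip (\<lambda>x. u x + v x) (\<lambda>x. u x + v x) \<le> (sqrt (ip u u) + sqrt (ip v v))\<^sup>2"
    unfolding ip_add_self[OF u v] by (simp add: power2_sum ip_self_nonneg)
qed

text \<open>The parallelogram law with the square of the difference dropped.\<close>

lemma ip_add_le:
  assumes u: "u \<in> L2 \<Omega>" and v: "v \<in> L2 \<Omega>"
  shows "ip (\<lambda>x. u x + v x) (\<lambda>x. u x + v x) \<le> 2 * ip u u + 2 * ip v v"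
  using ip_add_self[OF u v] ip_diff_self[OF u v] ip_self_nonneg[of "\<lambda>x. u x - v x"] by linarith

text \<open>Cauchy-Schwarz against the constant 1, which is square integrable because the domain is
  bounded.\<close>

lemma integral_norm_le_ip:
  fixes u :: "'a \<Rightarrow> 'b::euclidean_space"
  assumes u: "u \<in> L2 \<Omega>"
  shows "(LINT x|\<mu>. norm (u x)) \<le> sqrt (ip u u) * sqrt (measure \<mu> \<Omega>)"
proof -
  have "ip (\<lambda>x. norm (u x)) (\<lambda>x. 1::real) \<le> sqrt (ip (\<lambda>x. norm (u x)) (\<lambda>x. norm (u x))) * sqrt (ip (\<lambda>x. 1::real) (\<lambda>x. 1))"
    using ip_Cauchy_Schwarz[OF L2_norm[OF u] L2_const[of "1::real"]] by linarith
  moreover have "ip (\<lambda>x. norm (u x)) (\<lambda>x. norm (u x)) = ip u u" by (simp add: ip_self)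
  moreover have "ip (\<lambda>x. 1::real) (\<lambda>x. 1) = measure \<mu> \<Omega>"
    by (simp add: ip_def space_restrict_space)
  ultimately show ?thesis by (simp add: ip_def)
qed

lemma L2_square: "u \<in> L2 \<Omega> \<Longrightarrow> integrable \<mu> (\<lambda>x. (u x)\<^sup>2)" for u :: "'a \<Rightarrow> real"
  using L2_norm2[of u] by simp

lemma L2_abs: "u \<in> L2 \<Omega> \<Longrightarrow> integrable \<mu> (\<lambda>x. \<bar>u x\<bar>)" for u :: "'a \<Rightarrow> real"
  using integrable_norm[OF L2_integrable[of u]] by simp

lemma ip_real: "ip u u = (LINT x|\<mu>. (u x)\<^sup>2)" for u :: "'a \<Rightarrow> real"
  by (simp add: ip_self)

text \<open>Membership in \<open>L2\<close> is part of the notion because the integral of a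
  non-integrable function is 0 by default, so the limit alone would carry no information.\<close>

definition L2_tendsto :: "(nat \<Rightarrow> 'a \<Rightarrow> 'b::euclidean_space) \<Rightarrow> ('a \<Rightarrow> 'b) \<Rightarrow> bool" where
  "L2_tendsto u v \<longleftrightarrow> (\<forall>n. u n \<in> L2 \<Omega>) \<and> v \<in> L2 \<Omega> \<and>
     (\<lambda>n. ip (\<lambda>x. u n x - v x) (\<lambda>x. u n x - v x)) \<longlonglongrightarrow> 0"

lemma L2_tendsto_sqrt:
  "L2_tendsto u v \<Longrightarrow> (\<lambda>n. sqrt (ip (\<lambda>x. u n x - v x) (\<lambda>x. u n x - v x))) \<longlonglongrightarrow> 0"
  unfolding L2_tendsto_def using tendsto_real_sqrt[of _ 0] by force

lemma L2_tendsto_ip: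
  assumes u: "L2_tendsto u u0" and v: "L2_tendsto v v0"
  shows "(\<lambda>n. ip (u n) (v n)) \<longlonglongrightarrow> ip u0 v0"
proof -
  have [simp]: "u n \<in> L2 \<Omega>" "u0 \<in> L2 \<Omega>" "v n \<in> L2 \<Omega>" "v0 \<in> L2 \<Omega>" for n
    using u v by (auto simp: L2_tendsto_def)
  define a where "a n = sqrt (ip (\<lambda>x. u n x - u0 x) (\<lambda>x. u n x - u0 x))" for n
  define b where "b n = sqrt (ip (\<lambda>x. v n x - v0 x) (\<lambda>x. v n x - v0 x))" for n
  have ab: "a \<longlonglongrightarrow> 0" "b \<longlonglongrightarrow> 0"
    using L2_tendsto_sqrt[OF u] L2_tendsto_sqrt[OF v] by (simp_all add: a_def[abs_def] b_def[abs_def])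
  have "\<bar>ip (u n) (v n) - ip u0 v0\<bar> \<le> a n * (b n + sqrt (ip v0 v0)) + sqrt (ip u0 u0) * b n" for n
  proof -
    have "ip (u n) (v n) - ip u0 v0 = ip (\<lambda>x. u n x - u0 x) (v n) + ip u0 (\<lambda>x. v n x - v0 x)"
      by (simp add: ip_diff_left ip_diff_right)
    moreover have "\<bar>ip (\<lambda>x. u n x - u0 x) (v n)\<bar> \<le> a n * sqrt (ip (v n) (v n))"
      unfolding a_def by (rule ip_Cauchy_Schwarz) (simp_all add: L2_diff)
    moreover have "sqrt (ip (v n) (v n)) \<le> b n + sqrt (ip v0 v0)"
      using ip_triangle[OF L2_diff[of "v n" v0], of v0] by (simp add: b_def)
    then have "a n * sqrt (ip (v n) (v n)) \<le> a n * (b n + sqrt (ip v0 v0))"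
      by (rule mult_left_mono) (simp add: a_def ip_self_nonneg)
    moreover have "\<bar>ip u0 (\<lambda>x. v n x - v0 x)\<bar> \<le> sqrt (ip u0 u0) * b n"
      unfolding b_def by (rule ip_Cauchy_Schwarz) (simp_all add: L2_diff)
    ultimately show ?thesis by linarith
  qed
  then have bound: "\<forall>\<^sub>F n in sequentially. norm (ip (u n) (v n) - ip u0 v0) \<le> a n * (b n + sqrt (ip v0 v0)) + sqrt (ip u0 u0) * b n"
    by simp
  have "(\<lambda>n. a n * (b n + sqrt (ip v0 v0)) + sqrt (ip u0 u0) * b n) \<longlonglongrightarrow> 0 * (0 + sqrt (ip v0 v0)) + sqrt (ip u0 u0) * 0"
    by (intro tendsto_intros ab)
  then have "(\<lambda>n. ip (u n) (v n) - ip u0 v0) \<longlonglongrightarrow> 0"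
    by (intro Lim_null_comparison[OF bound]) simp
  then show ?thesis by (simp add: LIM_zero_iff)
qed

lemma L2_tendsto_bounded:
  assumes "L2_tendsto u v"
  obtains B where "B > 0" "\<And>n. ip (u n) (u n) \<le> B"
proof -
  have "Bseq (\<lambda>n. ip (u n) (u n))"
    using L2_tendsto_ip[OF assms assms] by (intro convergent_imp_Bseq) (auto simp: convergent_def)
  then obtain B where B: "B > 0" "\<And>n. norm (ip (u n) (u n)) \<le> B" by (rule BseqE) blast
  have "ip (u n) (u n) \<le> B" for n using B(2)[of n] by simp
  then show ?thesis using that B(1) by blast
qed

lemma L2_tendsto_const: "u \<in> L2 \<Omega> \<Longrightarrow> L2_tendsto (\<lambda>n. u) u"
  by (simp add: L2_tendsto_def ip_def)

lemma L2_tendsto_dominated: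
  fixes w :: "nat \<Rightarrow> 'a \<Rightarrow> 'b::euclidean_space" and u :: "nat \<Rightarrow> 'a \<Rightarrow> 'c::euclidean_space"
  assumes u: "L2_tendsto u v" and w: "\<And>n. w n \<in> L2 \<Omega>" "w0 \<in> L2 \<Omega>"
    and le: "\<And>n. AE x in \<mu>. norm (w n x - w0 x) \<le> c * norm (u n x - v x)"
  shows "L2_tendsto w w0"
proof -
  have uL: "u n \<in> L2 \<Omega>" "v \<in> L2 \<Omega>" for n using u by (auto simp: L2_tendsto_def)
  have "ip (\<lambda>x. w n x - w0 x) (\<lambda>x. w n x - w0 x) \<le> c\<^sup>2 * ip (\<lambda>x. u n x - v x) (\<lambda>x. u n x - v x)" for n
  proof -
    have i: "integrable \<mu> (\<lambda>x. (norm (u n x - v x))\<^sup>2)" by (rule L2_norm2[OF L2_diff[OF uL]])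
    have "(LINT x|\<mu>. (norm (w n x - w0 x))\<^sup>2) \<le> (LINT x|\<mu>. c\<^sup>2 * (norm (u n x - v x))\<^sup>2)"
    proof (rule integral_mono_AE[OF L2_norm2[OF L2_diff[OF w]]])
      show "integrable \<mu> (\<lambda>x. c\<^sup>2 * (norm (u n x - v x))\<^sup>2)" using i by simp
      show "AE x in \<mu>. (norm (w n x - w0 x))\<^sup>2 \<le> c\<^sup>2 * (norm (u n x - v x))\<^sup>2"
        using le[of n] by eventually_elim (metis norm_ge_zero power_mono power_mult_distrib)
    qed
    then show ?thesis by (simp add: ip_self)
  qed
  moreover have "(\<lambda>n. c\<^sup>2 * ip (\<lambda>x. u n x - v x) (\<lambda>x. u n x - v x)) \<longlonglongrightarrow> c\<^sup>2 * 0"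
    using u by (intro tendsto_intros) (auto simp: L2_tendsto_def)
  ultimately have "(\<lambda>n. ip (\<lambda>x. w n x - w0 x) (\<lambda>x. w n x - w0 x)) \<longlonglongrightarrow> 0"
    by (intro LIMSEQ_null_squeeze[OF _ ip_self_nonneg]) auto
  then show ?thesis using w by (simp add: L2_tendsto_def)
qed

lemma L2_tendsto_L1:
  fixes u :: "nat \<Rightarrow> 'a \<Rightarrow> 'b::euclidean_space"
  assumes "L2_tendsto u v"
  shows "(\<lambda>n. LINT x|\<mu>. norm (u n x - v x)) \<longlonglongrightarrow> 0"
proof (rule Lim_null_comparison)
  show "(\<lambda>n. sqrt (ip (\<lambda>x. u n x - v x) (\<lambda>x. u n x - v x)) * sqrt (measure \<mu> \<Omega>)) \<longlonglongrightarrow> 0"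
    using tendsto_mult[OF L2_tendsto_sqrt[OF assms] tendsto_const, of "sqrt (measure \<mu> \<Omega>)"] by simp
  show "\<forall>\<^sub>F n in sequentially. norm (LINT x|\<mu>. norm (u n x - v x)) \<le> sqrt (ip (\<lambda>x. u n x - v x) (\<lambda>x. u n x - v x)) * sqrt (measure \<mu> \<Omega>)"
  proof (rule always_eventually, rule allI)
    fix n
    have "(\<lambda>x. u n x - v x) \<in> L2 \<Omega>"
      using assms by (auto simp: L2_tendsto_def intro: L2_diff)
    from integral_norm_le_ip[OF this]
    show "norm (LINT x|\<mu>. norm (u n x - v x)) \<le> sqrt (ip (\<lambda>x. u n x - v x) (\<lambda>x. u n x - v x)) * sqrt (measure \<mu> \<Omega>)"
      by simp
  qed
qed

text \<open>An L2 Cauchy sequence is L1 Cauchy, hence has a subsequence converging almost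
  everywhere. Fatou's lemma, applied to the differences from one fixed late member, then shows both
  that the limit is square integrable and that it is close to that member.\<close>

lemma L2_complete:
  fixes \<psi> :: "nat \<Rightarrow> 'a \<Rightarrow> 'b::euclidean_space"
  assumes \<psi>: "\<And>n. \<psi> n \<in> L2 \<Omega>"
    and Cauchy: "\<And>e. e > 0 \<Longrightarrow> \<exists>N. \<forall>m\<ge>N. \<forall>n\<ge>N. ip (\<lambda>x. \<psi> m x - \<psi> n x) (\<lambda>x. \<psi> m x - \<psi> n x) < e"
  obtains g where "L2_tendsto \<psi> g"
proof -
  \<comment> \<open>Adding 1 only makes c positive, so that division by it is possible.\<close>
  define c where "c = sqrt (measure \<mu> \<Omega>) + 1"
  have c: "c > 0" by (simp add: c_def add_nonneg_pos)
  have "\<exists>N. \<forall>m\<ge>N. \<forall>n\<ge>N. (LINT x|\<mu>. norm (\<psi> m x - \<psi> n x)) < e" if "e > 0" for e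
  proof -
    obtain N where N: "\<forall>m\<ge>N. \<forall>n\<ge>N. ip (\<lambda>x. \<psi> m x - \<psi> n x) (\<lambda>x. \<psi> m x - \<psi> n x) < (e / c)\<^sup>2"
      using Cauchy[of "(e / c)\<^sup>2"] \<open>e > 0\<close> c by auto
    have "(LINT x|\<mu>. norm (\<psi> m x - \<psi> n x)) < e" if "m \<ge> N" "n \<ge> N" for m n
    proof -
      let ?i = "ip (\<lambda>x. \<psi> m x - \<psi> n x) (\<lambda>x. \<psi> m x - \<psi> n x)"
      have "sqrt ?i < e / c"
        using N that \<open>e > 0\<close> c by (intro real_less_lsqrt) (auto simp: ip_self_nonneg)
      then have "sqrt ?i * c < e" using c by (simp add: field_simps)
      moreover have "sqrt ?i * sqrt (measure \<mu> \<Omega>) \<le> sqrt ?i * c"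
        by (intro mult_left_mono) (auto simp: c_def ip_self_nonneg)
      ultimately show ?thesis
        using integral_norm_le_ip[OF L2_diff[OF \<psi> \<psi>], of m n] by linarith
    qed
    then show ?thesis by blast
  qed
  with L2_integrable[OF \<psi>] obtain r g where r: "strict_mono (r :: nat \<Rightarrow> nat)" "g \<in> borel_measurable \<mu>"
    "AE x in \<mu>. (\<lambda>k. \<psi> (r k) x) \<longlonglongrightarrow> g x"
    using L1_Cauchy_AE_subseq[of \<mu> \<psi>] by blast
  have close: "integrable \<mu> (\<lambda>x. (norm (\<psi> n x - g x))\<^sup>2)" "ip (\<lambda>x. \<psi> n x - g x) (\<lambda>x. \<psi> n x - g x) \<le> e"
    if N: "\<forall>m\<ge>N. \<forall>n\<ge>N. ip (\<lambda>x. \<psi> m x - \<psi> n x) (\<lambda>x. \<psi> m x - \<psi> n x) < e" and n: "n \<ge> N" for N n e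
  proof -
    have 1: "integrable \<mu> (\<lambda>x. (norm (\<psi> n x - \<psi> (r k) x))\<^sup>2)" for k
      by (intro L2_norm2 L2_diff \<psi>)
    have 2: "(LINT x|\<mu>. (norm (\<psi> n x - \<psi> (r k) x))\<^sup>2) \<le> e" if "k \<ge> N" for k
      using N n that strict_mono_imp_increasing[OF r(1), of k] by (auto simp: ip_self intro!: less_imp_le)
    have 3: "AE x in \<mu>. (\<lambda>k. (norm (\<psi> n x - \<psi> (r k) x))\<^sup>2) \<longlonglongrightarrow> (norm (\<psi> n x - g x))\<^sup>2"
      using r(3) by eventually_elim (intro tendsto_intros)
    have 4: "(\<lambda>x. (norm (\<psi> n x - g x))\<^sup>2) \<in> borel_measurable \<mu>"
      using L2_measurable[OF \<psi>] r(2) by measurable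
    show "integrable \<mu> (\<lambda>x. (norm (\<psi> n x - g x))\<^sup>2)"
      by (rule integral_Fatou_bound(1)[OF 1 _ 2 3 4]) auto
    show "ip (\<lambda>x. \<psi> n x - g x) (\<lambda>x. \<psi> n x - g x) \<le> e"
      unfolding ip_self by (rule integral_Fatou_bound(2)[OF 1 _ 2 3 4]) auto
  qed
  obtain N where N: "\<forall>m\<ge>N. \<forall>n\<ge>N. ip (\<lambda>x. \<psi> m x - \<psi> n x) (\<lambda>x. \<psi> m x - \<psi> n x) < 1"
    using Cauchy[of 1] by auto
  have "(\<lambda>x. \<psi> N x - g x) \<in> L2 \<Omega>"
    using close(1)[OF N order_refl] L2_measurable[OF \<psi>, of N] r(2) by (simp add: L2_def)
  then have "(\<lambda>x. \<psi> N x - (\<psi> N x - g x)) \<in> L2 \<Omega>"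
    by (rule L2_diff[OF \<psi>])
  then have g: "g \<in> L2 \<Omega>" by simp
  have "(\<lambda>n. ip (\<lambda>x. \<psi> n x - g x) (\<lambda>x. \<psi> n x - g x)) \<longlonglongrightarrow> 0"
  proof (rule LIMSEQ_I)
    fix e :: real assume "e > 0"
    then obtain N where N: "\<forall>m\<ge>N. \<forall>n\<ge>N. ip (\<lambda>x. \<psi> m x - \<psi> n x) (\<lambda>x. \<psi> m x - \<psi> n x) < e / 2"
      using Cauchy[of "e / 2"] by auto
    show "\<exists>N. \<forall>n\<ge>N. norm (ip (\<lambda>x. \<psi> n x - g x) (\<lambda>x. \<psi> n x - g x) - 0) < e"
    proof (intro exI[of _ N] allI impI)
      fix n assume "N \<le> n"
      then show "norm (ip (\<lambda>x. \<psi> n x - g x) (\<lambda>x. \<psi> n x - g x) - 0) < e"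
        using close(2)[OF N, of n] \<open>e > 0\<close> ip_self_nonneg[of "\<lambda>x. \<psi> n x - g x"] by simp
    qed
  qed
  then show ?thesis using that g \<psi> by (simp add: L2_tendsto_def)
qed

section \<open>Sobolev functions with zero boundary values\<close>

abbreviation "TF \<equiv> test_functions \<Omega>"

abbreviation "E \<phi> \<equiv> ip (gradient \<phi>) (gradient \<phi>)"

lemma test_L2:
  assumes "\<phi> \<in> TF" shows "\<phi> \<in> L2 \<Omega>" and "gradient \<phi> \<in> L2 \<Omega>"
proof -
  obtain B where B: "\<And>x. \<bar>\<phi> x\<bar> \<le> B" "\<And>x. norm (gradient \<phi> x) \<le> B"
    using test_function_bounded[OF assms] by metis
  have sm: "smooth \<phi>" using assms by (rule test_function_smooth)
  show "\<phi> \<in> L2 \<Omega>"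
    by (rule L2_bounded[where C = B]) (use B in \<open>auto intro: continuous_borel_measurable smooth_continuous[OF sm]\<close>)
  show "gradient \<phi> \<in> L2 \<Omega>"
    by (rule L2_bounded[where C = B])
      (use B in \<open>auto intro: continuous_borel_measurable smooth_continuous_gradient[OF sm]\<close>)
qed

lemma L2_test_scaleR_integrable:
  fixes g :: "'a \<Rightarrow> 'b::euclidean_space"
  assumes "g \<in> L2 \<Omega>" and "\<phi> \<in> TF"
  shows "integrable \<mu> (\<lambda>x. \<phi> x *\<^sub>R g x)"
proof -
  obtain B where B: "\<And>x. \<bar>\<phi> x\<bar> \<le> B" using test_function_bounded[OF assms(2)] by metis
  show ?thesis
    by (rule L2_integrable[OF L2_bounded_scaleR[OF assms(1) L2_measurable[OF test_L2(1)[OF assms(2)]] B]])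
qed

lemma L2_test_gradient_integrable:
  assumes "u \<in> L2 \<Omega>" and "\<phi> \<in> TF"
  shows "integrable \<mu> (\<lambda>x. u x *\<^sub>R gradient \<phi> x)"
proof (rule Bochner_Integration.integrable_bound[OF L2_mult_integrable[OF L2_norm[OF assms(1)] L2_norm[OF test_L2(2)[OF assms(2)]]]])
  show "(\<lambda>x. u x *\<^sub>R gradient \<phi> x) \<in> borel_measurable \<mu>"
    using L2_measurable[OF assms(1)] L2_measurable[OF test_L2(2)[OF assms(2)]] by measurable
qed auto

text \<open>Taking for b the integral itself gives its squared norm. This reduces vector identities
  to scalar ones.\<close>

lemma integral_eq_zeroI:
  fixes h :: "'a \<Rightarrow> 'b::euclidean_space"
  assumes "integrable \<mu> h" and "\<And>b. (LINT x|\<mu>. h x \<bullet> b) = 0"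
  shows "(LINT x|\<mu>. h x) = 0"
  using integral_inner_left[of "LINT x|\<mu>. h x" \<mu> h] assms(1) assms(2)[of "LINT x|\<mu>. h x"] by simp

lemma integral_by_parts:
  assumes "\<phi> \<in> TF" and "\<psi> \<in> TF"
  shows "(LINT x|\<mu>. \<phi> x *\<^sub>R gradient \<psi> x) = - (LINT x|\<mu>. \<psi> x *\<^sub>R gradient \<phi> x)"
proof -
  have sm: "smooth \<phi>" "smooth \<psi>" using assms test_function_smooth by blast+
  have i: "integrable \<mu> (\<lambda>x. \<phi> x *\<^sub>R gradient \<psi> x)" "integrable \<mu> (\<lambda>x. \<psi> x *\<^sub>R gradient \<phi> x)"
    using assms by (auto intro: L2_test_gradient_integrable test_L2)
  have "(LINT x|\<mu>. \<phi> x *\<^sub>R gradient \<psi> x + \<psi> x *\<^sub>R gradient \<phi> x) = 0"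
  proof (rule integral_eq_zeroI)
    show "(LINT x|\<mu>. (\<phi> x *\<^sub>R gradient \<psi> x + \<psi> x *\<^sub>R gradient \<phi> x) \<bullet> b) = 0" for b
      using integral_gradient_test[OF sets_domain test_function_mult[OF assms(1) sm(2)], of b]
      by (simp add: gradient_mult[OF sm])
  qed (use i in auto)
  then show ?thesis using i by (simp add: eq_neg_iff_add_eq_0)
qed

lemma L2_integrable_subset:
  fixes h :: "'a \<Rightarrow> 'b::euclidean_space"
  assumes "compact C" "C \<subseteq> \<Omega>" "h \<in> L2 \<Omega>"
  shows "integrable (lebesgue_on C) h"
proof -
  have C: "C \<in> sets lebesgue" using assms(1) by (auto simp: compact_imp_closed)
  have "integrable lebesgue (\<lambda>x. indicator \<Omega> x *\<^sub>R h x)"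
    using L2_integrable[OF assms(3)] sets_domain by (subst (asm) integrable_restrict_space) auto
  then have "integrable lebesgue (\<lambda>x. indicator C x *\<^sub>R indicator \<Omega> x *\<^sub>R h x)"
    by (rule integrable_mult_indicator[OF C])
  moreover have "(\<lambda>x. indicator C x *\<^sub>R indicator \<Omega> x *\<^sub>R h x) = (\<lambda>x. indicator C x *\<^sub>R h x)"
    using assms(2) by (auto simp: indicator_def fun_eq_iff)
  ultimately show ?thesis using C by (subst integrable_restrict_space) auto
qed

lemma has_weak_gradient_L2I:
  assumes "u \<in> L2 \<Omega>" and "g \<in> L2 \<Omega>"
    and "\<And>\<phi>. \<phi> \<in> TF \<Longrightarrow> (LINT x|\<mu>. u x *\<^sub>R gradient \<phi> x) = - (LINT x|\<mu>. \<phi> x *\<^sub>R g x)"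
  shows "has_weak_gradient \<Omega> u g"
  unfolding has_weak_gradient_def
  by (intro conjI allI impI ballI L2_integrable_subset assms) simp_all

lemma weak_gradient_AE:
  assumes "has_weak_gradient \<Omega> u g"
  shows "AE x in \<mu>. weak_gradient \<Omega> u x = g x"
  unfolding weak_gradient_def
  by (rule has_weak_gradient_unique[OF open_domain _ assms]) (rule someI[of "has_weak_gradient \<Omega> u", OF assms])

section \<open>Weak gradients of functions in H1\<close>

lemma H1_L2: "u \<in> H1 \<Omega> \<Longrightarrow> u \<in> L2 \<Omega>"
  by (simp add: H1_def)

lemma H1_weak_gradient:
  assumes "u \<in> H1 \<Omega>"
  shows "has_weak_gradient \<Omega> u (weak_gradient \<Omega> u)" and "weak_gradient \<Omega> u \<in> L2 \<Omega>"
proof -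
  obtain g where g: "g \<in> L2 \<Omega>" "has_weak_gradient \<Omega> u g" using assms by (auto simp: H1_def)
  show "has_weak_gradient \<Omega> u (weak_gradient \<Omega> u)"
    unfolding weak_gradient_def by (rule someI[of "has_weak_gradient \<Omega> u", OF g(2)])
  have "AE x in \<mu>. g x = weak_gradient \<Omega> u x"
    using weak_gradient_AE[OF g(2)] by eventually_elim simp
  then show "weak_gradient \<Omega> u \<in> L2 \<Omega>" using g(1) L2_AE_cong by blast
qed

lemma H1_parts:
  assumes "u \<in> H1 \<Omega>" "\<phi> \<in> TF"
  shows "(LINT x|\<mu>. u x *\<^sub>R gradient \<phi> x) = - (LINT x|\<mu>. \<phi> x *\<^sub>R weak_gradient \<Omega> u x)"
  using H1_weak_gradient(1)[OF assms(1)] assms(2) by (simp add: has_weak_gradient_def)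

lemma H1I:
  assumes "u \<in> L2 \<Omega>" and "g \<in> L2 \<Omega>" and "has_weak_gradient \<Omega> u g"
  shows "u \<in> H1 \<Omega>"
  using assms by (auto simp: H1_def)

lemma test_weak_gradient:
  assumes "\<phi> \<in> TF"
  shows "\<phi> \<in> H1 \<Omega>" and "AE x in \<mu>. weak_gradient \<Omega> \<phi> x = gradient \<phi> x"
    and "AE x in \<mu>. gradient \<phi> x = weak_gradient \<Omega> \<phi> x"
proof -
  have "has_weak_gradient \<Omega> \<phi> (gradient \<phi>)"
    using assms by (intro has_weak_gradient_L2I test_L2 integral_by_parts)
  then show "\<phi> \<in> H1 \<Omega>" "AE x in \<mu>. weak_gradient \<Omega> \<phi> x = gradient \<phi> x"
    using assms H1I test_L2 weak_gradient_AE by blast+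
  then show "AE x in \<mu>. gradient \<phi> x = weak_gradient \<Omega> \<phi> x"
    by (auto elim!: eventually_mono)
qed

lemma integral_combination:
  fixes f g :: "'a \<Rightarrow> 'b::euclidean_space"
  assumes "integrable \<mu> f" "integrable \<mu> g"
  shows "(LINT x|\<mu>. a *\<^sub>R f x + b *\<^sub>R g x) = a *\<^sub>R (LINT x|\<mu>. f x) + b *\<^sub>R (LINT x|\<mu>. g x)"
  using assms by simp

lemma H1_combination:
  assumes u: "u \<in> H1 \<Omega>" and v: "v \<in> H1 \<Omega>"
  shows "(\<lambda>x. a * u x + b * v x) \<in> H1 \<Omega>"
    and "AE x in \<mu>. weak_gradient \<Omega> (\<lambda>x. a * u x + b * v x) x = a *\<^sub>R weak_gradient \<Omega> u x + b *\<^sub>R weak_gradient \<Omega> v x"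
proof -
  let ?g = "\<lambda>x. a *\<^sub>R weak_gradient \<Omega> u x + b *\<^sub>R weak_gradient \<Omega> v x"
  note L = H1_L2[OF u] H1_L2[OF v] H1_weak_gradient(2)[OF u] H1_weak_gradient(2)[OF v]
  have L': "(\<lambda>x. a * u x + b * v x) \<in> L2 \<Omega>" "?g \<in> L2 \<Omega>"
    by (rule L2_add[OF L2_cmult[OF L(1)] L2_cmult[OF L(2)]], rule L2_add[OF L2_scaleR[OF L(3)] L2_scaleR[OF L(4)]])
  have "has_weak_gradient \<Omega> (\<lambda>x. a * u x + b * v x) ?g"
  proof (rule has_weak_gradient_L2I[OF L'])
    fix \<phi> assume \<phi>: "\<phi> \<in> TF"
    have i: "integrable \<mu> (\<lambda>x. \<phi> x *\<^sub>R weak_gradient \<Omega> u x)" "integrable \<mu> (\<lambda>x. \<phi> x *\<^sub>R weak_gradient \<Omega> v x)"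
      "integrable \<mu> (\<lambda>x. u x *\<^sub>R gradient \<phi> x)" "integrable \<mu> (\<lambda>x. v x *\<^sub>R gradient \<phi> x)"
      using L \<phi> by (auto intro: L2_test_scaleR_integrable L2_test_gradient_integrable)
    have "(LINT x|\<mu>. (a * u x + b * v x) *\<^sub>R gradient \<phi> x)
        = (LINT x|\<mu>. a *\<^sub>R (u x *\<^sub>R gradient \<phi> x) + b *\<^sub>R (v x *\<^sub>R gradient \<phi> x))"
      by (simp add: scaleR_add_left)
    also have "\<dots> = a *\<^sub>R (LINT x|\<mu>. u x *\<^sub>R gradient \<phi> x) + b *\<^sub>R (LINT x|\<mu>. v x *\<^sub>R gradient \<phi> x)"
      by (rule integral_combination[OF i(3,4)])
    also have "\<dots> = - (a *\<^sub>R (LINT x|\<mu>. \<phi> x *\<^sub>R weak_gradient \<Omega> u x) + b *\<^sub>R (LINT x|\<mu>. \<phi> x *\<^sub>R weak_gradient \<Omega> v x))"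
      using H1_parts[OF u \<phi>] H1_parts[OF v \<phi>] by simp
    also have "a *\<^sub>R (LINT x|\<mu>. \<phi> x *\<^sub>R weak_gradient \<Omega> u x) + b *\<^sub>R (LINT x|\<mu>. \<phi> x *\<^sub>R weak_gradient \<Omega> v x)
        = (LINT x|\<mu>. a *\<^sub>R (\<phi> x *\<^sub>R weak_gradient \<Omega> u x) + b *\<^sub>R (\<phi> x *\<^sub>R weak_gradient \<Omega> v x))"
      by (rule integral_combination[OF i(1,2), symmetric])
    also have "\<dots> = (LINT x|\<mu>. \<phi> x *\<^sub>R ?g x)"
      by (simp add: scaleR_add_right mult.commute)
    finally show "(LINT x|\<mu>. (a * u x + b * v x) *\<^sub>R gradient \<phi> x) = - (LINT x|\<mu>. \<phi> x *\<^sub>R ?g x)" .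
  qed
  then show "(\<lambda>x. a * u x + b * v x) \<in> H1 \<Omega>"
    "AE x in \<mu>. weak_gradient \<Omega> (\<lambda>x. a * u x + b * v x) x = ?g x"
    using L' H1I weak_gradient_AE by blast+
qed

definition gip :: "('a \<Rightarrow> real) \<Rightarrow> ('a \<Rightarrow> real) \<Rightarrow> real" where
  "gip u v = ip (weak_gradient \<Omega> u) (weak_gradient \<Omega> v)"

lemma dirichlet_gip: "dirichlet \<Omega> u = gip u u"
  by (simp add: dirichlet_def gip_def ip_self)

lemma gip_commute: "gip u v = gip v u"
  by (simp add: gip_def ip_commute)

lemma gip_left:
  assumes "u \<in> H1 \<Omega>" "v \<in> H1 \<Omega>" "w \<in> H1 \<Omega>"
  shows "gip (\<lambda>x. a * u x + b * v x) w = a * gip u w + b * gip v w"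
proof -
  note L = assms[THEN H1_weak_gradient(2)]
  have "gip (\<lambda>x. a * u x + b * v x) w
      = ip (\<lambda>x. a *\<^sub>R weak_gradient \<Omega> u x + b *\<^sub>R weak_gradient \<Omega> v x) (weak_gradient \<Omega> w)"
    unfolding gip_def
    by (rule ip_AE_cong[OF _ L(3)])
      (use H1_combination(2)[OF assms(1,2), of a b] L in \<open>auto intro: L2_add L2_scaleR\<close>)
  also have "\<dots> = a * gip u w + b * gip v w"
    using L by (simp add: gip_def ip_add_left ip_scaleR_left L2_scaleR)
  finally show ?thesis .
qed

lemma gip_combination_self:
  assumes "u \<in> H1 \<Omega>" "v \<in> H1 \<Omega>"
  shows "gip (\<lambda>x. a * u x + b * v x) (\<lambda>x. a * u x + b * v x) = a\<^sup>2 * gip u u + 2 * a * b * gip u v + b\<^sup>2 * gip v v"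
proof -
  let ?w = "\<lambda>x. a * u x + b * v x"
  have "gip ?w ?w = a * gip ?w u + b * gip ?w v"
    using gip_left[OF assms H1_combination(1)[OF assms, of a b], of a b] unfolding gip_commute[of u ?w] gip_commute[of v ?w] .
  then show ?thesis
    unfolding gip_left[OF assms assms(1)] gip_left[OF assms assms(2)] gip_commute[of v u]
    by (simp add: algebra_simps power2_eq_square)
qed

lemma gip_test: "\<phi> \<in> TF \<Longrightarrow> \<psi> \<in> TF \<Longrightarrow> gip \<phi> \<psi> = ip (gradient \<phi>) (gradient \<psi>)"
  unfolding gip_def
  by (rule ip_AE_cong[OF test_L2(2) test_L2(2) test_weak_gradient(3) test_weak_gradient(3)])

lemma gip_H1_test: "u \<in> H1 \<Omega> \<Longrightarrow> \<psi> \<in> TF \<Longrightarrow> gip u \<psi> = ip (weak_gradient \<Omega> u) (gradient \<psi>)"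
  unfolding gip_def
  by (rule ip_AE_cong[OF H1_weak_gradient(2) test_L2(2) _ test_weak_gradient(3)]) simp_all

lemma gip_diff_test:
  assumes u: "u \<in> H1 \<Omega>" and \<phi>: "\<phi> \<in> TF"
  shows "gip (\<lambda>x. u x - \<phi> x) (\<lambda>x. u x - \<phi> x)
    = ip (\<lambda>x. gradient \<phi> x - weak_gradient \<Omega> u x) (\<lambda>x. gradient \<phi> x - weak_gradient \<Omega> u x)"
proof -
  have "AE x in \<mu>. gradient \<phi> x - weak_gradient \<Omega> u x = -1 *\<^sub>R weak_gradient \<Omega> (\<lambda>x. u x - \<phi> x) x"
    using H1_combination(2)[OF u test_weak_gradient(1)[OF \<phi>], of 1 "-1"] test_weak_gradient(2)[OF \<phi>]
    by eventually_elim (simp add: algebra_simps)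
  then have "ip (\<lambda>x. -1 *\<^sub>R weak_gradient \<Omega> (\<lambda>x. u x - \<phi> x) x) (\<lambda>x. -1 *\<^sub>R weak_gradient \<Omega> (\<lambda>x. u x - \<phi> x) x)
     = ip (\<lambda>x. gradient \<phi> x - weak_gradient \<Omega> u x) (\<lambda>x. gradient \<phi> x - weak_gradient \<Omega> u x)"
    by (intro ip_AE_cong L2_diff test_L2(2)[OF \<phi>] H1_weak_gradient(2)[OF u]) (auto elim!: eventually_mono)
  then show ?thesis by (simp add: gip_def ip_def)
qed

section \<open>Approximation by test functions\<close>

lemma H10_H1: "u \<in> H10 \<Omega> \<Longrightarrow> u \<in> H1 \<Omega>"
  by (simp add: H10_def)

lemma H1_norm_diff_test:
  assumes u: "u \<in> H1 \<Omega>" and \<phi>: "\<phi> \<in> TF"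
  shows "H1_norm \<Omega> (\<lambda>x. u x - \<phi> x) = sqrt (ip (\<lambda>x. \<phi> x - u x) (\<lambda>x. \<phi> x - u x)
    + ip (\<lambda>x. gradient \<phi> x - weak_gradient \<Omega> u x) (\<lambda>x. gradient \<phi> x - weak_gradient \<Omega> u x))"
  unfolding H1_norm_def dirichlet_gip gip_diff_test[OF assms]
  by (simp add: ip_def power2_eq_square algebra_simps)

text \<open>The H1 distance splits into the L2 distances of the functions and of the gradients, so
  the epsilon form of the definition becomes a pair of L2 limits to which
  \<open>L2_tendsto_ip\<close> applies.\<close>

lemma H10_iff:
  "u \<in> H10 \<Omega> \<longleftrightarrow> u \<in> H1 \<Omega> \<and> (\<exists>\<phi>. (\<forall>n. \<phi> n \<in> TF) \<and> L2_tendsto \<phi> u \<and>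
     L2_tendsto (\<lambda>n. gradient (\<phi> n)) (weak_gradient \<Omega> u))"
proof (intro iffI conjI)
  assume u: "u \<in> H10 \<Omega>"
  then show u1: "u \<in> H1 \<Omega>" by (rule H10_H1)
  have "\<exists>\<phi>\<in>TF. H1_norm \<Omega> (\<lambda>x. u x - \<phi> x) < inverse (real (Suc n))" for n
    using u by (auto simp: H10_def)
  then obtain \<phi> where \<phi>: "\<And>n. \<phi> n \<in> TF" "\<And>n. H1_norm \<Omega> (\<lambda>x. u x - \<phi> n x) < inverse (real (Suc n))"
    by metis
  define a where "a n = ip (\<lambda>x. \<phi> n x - u x) (\<lambda>x. \<phi> n x - u x)" for n
  define b where "b n = ip (\<lambda>x. gradient (\<phi> n) x - weak_gradient \<Omega> u x) (\<lambda>x. gradient (\<phi> n) x - weak_gradient \<Omega> u x)" for n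
  have ab: "a n \<ge> 0" "b n \<ge> 0" for n by (simp_all add: a_def b_def ip_self_nonneg)
  have lt: "a n + b n \<le> (inverse (real (Suc n)))\<^sup>2" for n
    using \<phi>(2)[of n] unfolding H1_norm_diff_test[OF u1 \<phi>(1)] a_def[symmetric] b_def[symmetric]
    by (intro sqrt_le_D less_imp_le)
  have lim: "(\<lambda>n. (inverse (real (Suc n)))\<^sup>2) \<longlonglongrightarrow> 0"
    using tendsto_power[OF LIMSEQ_inverse_real_of_nat, of 2] by simp
  have "a n \<le> (inverse (real (Suc n)))\<^sup>2" "b n \<le> (inverse (real (Suc n)))\<^sup>2" for n
    using lt[of n] ab[of n] by linarith+
  then have "a \<longlonglongrightarrow> 0" "b \<longlonglongrightarrow> 0"
    using ab by (auto intro!: LIMSEQ_null_squeeze[OF lim])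
  then show "\<exists>\<phi>. (\<forall>n. \<phi> n \<in> TF) \<and> L2_tendsto \<phi> u \<and> L2_tendsto (\<lambda>n. gradient (\<phi> n)) (weak_gradient \<Omega> u)"
    using \<phi>(1) test_L2 H1_L2[OF u1] H1_weak_gradient(2)[OF u1]
    by (intro exI[of _ \<phi>]) (simp add: L2_tendsto_def a_def[abs_def] b_def[abs_def])
next
  assume R: "u \<in> H1 \<Omega> \<and> (\<exists>\<phi>. (\<forall>n. \<phi> n \<in> TF) \<and> L2_tendsto \<phi> u \<and> L2_tendsto (\<lambda>n. gradient (\<phi> n)) (weak_gradient \<Omega> u))"
  then obtain \<phi> where \<phi>: "\<And>n. \<phi> n \<in> TF" "L2_tendsto \<phi> u" "L2_tendsto (\<lambda>n. gradient (\<phi> n)) (weak_gradient \<Omega> u)"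
    by blast
  have u: "u \<in> H1 \<Omega>" using R by blast
  have "(\<lambda>n. H1_norm \<Omega> (\<lambda>x. u x - \<phi> n x)) \<longlonglongrightarrow> sqrt (0 + 0)"
    unfolding H1_norm_diff_test[OF u \<phi>(1)]
    using \<phi>(2,3) by (intro tendsto_real_sqrt tendsto_add) (auto simp: L2_tendsto_def)
  then have "\<forall>e>0. \<exists>n. H1_norm \<Omega> (\<lambda>x. u x - \<phi> n x) < e"
    by (metis (no_types, lifting) add_0 eventually_sequentially order_refl order_tendstoD(2) real_sqrt_zero)
  then show "u \<in> H10 \<Omega>"
    using u \<phi>(1) unfolding H10_def by blast
qed

lemma H10_approx:
  assumes "u \<in> H10 \<Omega>"
  obtains \<phi> where "\<And>n. \<phi> n \<in> TF" "L2_tendsto \<phi> u" "L2_tendsto (\<lambda>n. gradient (\<phi> n)) (weak_gradient \<Omega> u)"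
  using assms unfolding H10_iff by blast

lemma L2_tendsto_AE_cong:
  fixes v w :: "'a \<Rightarrow> 'b::euclidean_space"
  assumes "L2_tendsto u v" and "AE x in \<mu>. v x = w x"
  shows "L2_tendsto u w"
proof -
  have "ip (\<lambda>x. u n x - w x) (\<lambda>x. u n x - w x) = ip (\<lambda>x. u n x - v x) (\<lambda>x. u n x - v x)" for n
    using assms by (intro ip_AE_cong L2_diff) (auto simp: L2_tendsto_def elim!: eventually_mono)
  then show ?thesis using assms L2_AE_cong by (auto simp: L2_tendsto_def)
qed

lemma test_H10:
  assumes "\<phi> \<in> TF" shows "\<phi> \<in> H10 \<Omega>"
proof -
  have "L2_tendsto (\<lambda>n. gradient \<phi>) (weak_gradient \<Omega> \<phi>)"
    by (rule L2_tendsto_AE_cong[OF L2_tendsto_const[OF test_L2(2)[OF assms]] test_weak_gradient(3)[OF assms]])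
  then show ?thesis
    unfolding H10_iff using assms test_weak_gradient(1)[OF assms] L2_tendsto_const[OF test_L2(1)[OF assms]]
    by (intro conjI exI[of _ "\<lambda>n. \<phi>"]) simp_all
qed

lemma L2_tendsto_combination:
  fixes u v :: "nat \<Rightarrow> 'a \<Rightarrow> 'b::euclidean_space"
  assumes u: "L2_tendsto u u0" and v: "L2_tendsto v v0"
  shows "L2_tendsto (\<lambda>n x. a *\<^sub>R u n x + b *\<^sub>R v n x) (\<lambda>x. a *\<^sub>R u0 x + b *\<^sub>R v0 x)"
proof -
  have [simp]: "u n \<in> L2 \<Omega>" "u0 \<in> L2 \<Omega>" "v n \<in> L2 \<Omega>" "v0 \<in> L2 \<Omega>" for n
    using u v by (auto simp: L2_tendsto_def)
  let ?U = "\<lambda>n x. u n x - u0 x" and ?V = "\<lambda>n x. v n x - v0 x"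
  have le: "ip (\<lambda>x. (a *\<^sub>R u n x + b *\<^sub>R v n x) - (a *\<^sub>R u0 x + b *\<^sub>R v0 x)) (\<lambda>x. (a *\<^sub>R u n x + b *\<^sub>R v n x) - (a *\<^sub>R u0 x + b *\<^sub>R v0 x))
     \<le> 2 * a\<^sup>2 * ip (?U n) (?U n) + 2 * b\<^sup>2 * ip (?V n) (?V n)" for n
  proof -
    have "(\<lambda>x. (a *\<^sub>R u n x + b *\<^sub>R v n x) - (a *\<^sub>R u0 x + b *\<^sub>R v0 x)) = (\<lambda>x. a *\<^sub>R ?U n x + b *\<^sub>R ?V n x)"
      by (simp add: algebra_simps)
    then show ?thesis
      using ip_add_le[of "\<lambda>x. a *\<^sub>R ?U n x" "\<lambda>x. b *\<^sub>R ?V n x"]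
      by (simp add: L2_scaleR L2_diff ip_scaleR_left ip_scaleR_right power2_eq_square mult.assoc)
  qed
  have "(\<lambda>n. 2 * a\<^sup>2 * ip (?U n) (?U n) + 2 * b\<^sup>2 * ip (?V n) (?V n)) \<longlonglongrightarrow> 2 * a\<^sup>2 * 0 + 2 * b\<^sup>2 * 0"
    using u v by (intro tendsto_intros) (auto simp: L2_tendsto_def)
  then have "(\<lambda>n. ip (\<lambda>x. (a *\<^sub>R u n x + b *\<^sub>R v n x) - (a *\<^sub>R u0 x + b *\<^sub>R v0 x)) (\<lambda>x. (a *\<^sub>R u n x + b *\<^sub>R v n x) - (a *\<^sub>R u0 x + b *\<^sub>R v0 x))) \<longlonglongrightarrow> 0"
    by (intro LIMSEQ_null_squeeze[OF _ ip_self_nonneg le]) simp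
  then show ?thesis by (simp add: L2_tendsto_def L2_add L2_scaleR)
qed

lemma H10_combination:
  assumes u: "u \<in> H10 \<Omega>" and v: "v \<in> H10 \<Omega>"
  shows "(\<lambda>x. a * u x + b * v x) \<in> H10 \<Omega>"
proof -
  obtain \<phi> where \<phi>: "\<And>n. \<phi> n \<in> TF" "L2_tendsto \<phi> u" "L2_tendsto (\<lambda>n. gradient (\<phi> n)) (weak_gradient \<Omega> u)"
    using H10_approx[OF u] by metis
  obtain \<psi> where \<psi>: "\<And>n. \<psi> n \<in> TF" "L2_tendsto \<psi> v" "L2_tendsto (\<lambda>n. gradient (\<psi> n)) (weak_gradient \<Omega> v)"
    using H10_approx[OF v] by metis
  note uv = u[THEN H10_H1] v[THEN H10_H1]
  have "(\<lambda>x. a * \<phi> n x + b * \<psi> n x) \<in> TF" for n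
    by (intro test_function_add test_function_cmult \<phi> \<psi>)
  moreover have "L2_tendsto (\<lambda>n x. a * \<phi> n x + b * \<psi> n x) (\<lambda>x. a * u x + b * v x)"
    using L2_tendsto_combination[OF \<phi>(2) \<psi>(2), of a b] by simp
  moreover have "L2_tendsto (\<lambda>n. gradient (\<lambda>x. a * \<phi> n x + b * \<psi> n x)) (weak_gradient \<Omega> (\<lambda>x. a * u x + b * v x))"
  proof (rule L2_tendsto_AE_cong)
    have "gradient (\<lambda>x. a * \<phi> n x + b * \<psi> n x) = (\<lambda>x. a *\<^sub>R gradient (\<phi> n) x + b *\<^sub>R gradient (\<psi> n) x)" for n
      using test_function_smooth[OF \<phi>(1), of n] test_function_smooth[OF \<psi>(1), of n]
      by (auto simp: gradient_add gradient_cmult smooth_cmult)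
    then show "L2_tendsto (\<lambda>n. gradient (\<lambda>x. a * \<phi> n x + b * \<psi> n x)) (\<lambda>x. a *\<^sub>R weak_gradient \<Omega> u x + b *\<^sub>R weak_gradient \<Omega> v x)"
      using L2_tendsto_combination[OF \<phi>(3) \<psi>(3), of a b] by simp
    show "AE x in \<mu>. a *\<^sub>R weak_gradient \<Omega> u x + b *\<^sub>R weak_gradient \<Omega> v x = weak_gradient \<Omega> (\<lambda>x. a * u x + b * v x) x"
      using H1_combination(2)[OF uv, of a b] by eventually_elim simp
  qed
  ultimately show ?thesis
    unfolding H10_iff using H1_combination(1)[OF uv, of a b]
    by (intro conjI exI[of _ "\<lambda>n x. a * \<phi> n x + b * \<psi> n x"]) auto
qed

text \<open>The source of new elements of \<open>H10\<close>. Integration by parts against a fixed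
  test function, paired with a fixed vector b, is a sum of two L2 inner products and therefore
  passes to the limit.\<close>

lemma H10_closed:
  assumes \<psi>: "\<And>n. \<psi> n \<in> TF" and u: "L2_tendsto \<psi> u" and g: "L2_tendsto (\<lambda>n. gradient (\<psi> n)) g"
  shows "u \<in> H10 \<Omega>" and "AE x in \<mu>. weak_gradient \<Omega> u x = g x"
proof -
  have L: "u \<in> L2 \<Omega>" "g \<in> L2 \<Omega>" using u g by (auto simp: L2_tendsto_def)
  have wg: "has_weak_gradient \<Omega> u g"
  proof (rule has_weak_gradient_L2I[OF L])
    fix \<phi> assume \<phi>: "\<phi> \<in> TF"
    have i: "integrable \<mu> (\<lambda>x. u x *\<^sub>R gradient \<phi> x)" "integrable \<mu> (\<lambda>x. \<phi> x *\<^sub>R g x)"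
      using L \<phi> by (auto intro: L2_test_scaleR_integrable L2_test_gradient_integrable)
    have "(LINT x|\<mu>. u x *\<^sub>R gradient \<phi> x + \<phi> x *\<^sub>R g x) = 0"
    proof (rule integral_eq_zeroI)
      show "integrable \<mu> (\<lambda>x. u x *\<^sub>R gradient \<phi> x + \<phi> x *\<^sub>R g x)" using i by simp
      fix b
      have Lb: "(\<lambda>x. gradient \<phi> x \<bullet> b) \<in> L2 \<Omega>"
      proof (rule L2_dominated[OF L2_scaleR[OF test_L2(2)[OF \<phi>], of "norm b"]])
        show "(\<lambda>x. gradient \<phi> x \<bullet> b) \<in> borel_measurable \<mu>"
          using L2_measurable[OF test_L2(2)[OF \<phi>]] by measurable
        show "AE x in \<mu>. norm (gradient \<phi> x \<bullet> b) \<le> norm (norm b *\<^sub>R gradient \<phi> x)"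
          using Cauchy_Schwarz_ineq2[of "gradient \<phi> _" b] by (intro AE_I2) (simp add: mult.commute)
      qed
      have Lb': "(\<lambda>x. \<phi> x *\<^sub>R b) \<in> L2 \<Omega>"
      proof (rule L2_dominated[OF L2_cmult[OF test_L2(1)[OF \<phi>], of "norm b"]])
        show "(\<lambda>x. \<phi> x *\<^sub>R b) \<in> borel_measurable \<mu>"
          using L2_measurable[OF test_L2(1)[OF \<phi>]] by measurable
      qed (auto simp: abs_mult mult.commute)
      have "(\<lambda>n. ip (\<psi> n) (\<lambda>x. gradient \<phi> x \<bullet> b) + ip (gradient (\<psi> n)) (\<lambda>x. \<phi> x *\<^sub>R b))
          \<longlonglongrightarrow> ip u (\<lambda>x. gradient \<phi> x \<bullet> b) + ip g (\<lambda>x. \<phi> x *\<^sub>R b)"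
        by (intro tendsto_add L2_tendsto_ip u g L2_tendsto_const Lb Lb')
      moreover have "ip (\<psi> n) (\<lambda>x. gradient \<phi> x \<bullet> b) + ip (gradient (\<psi> n)) (\<lambda>x. \<phi> x *\<^sub>R b) = 0" for n
      proof -
        have j: "integrable \<mu> (\<lambda>x. \<psi> n x *\<^sub>R gradient \<phi> x)" "integrable \<mu> (\<lambda>x. \<phi> x *\<^sub>R gradient (\<psi> n) x)"
          using \<psi> \<phi> by (auto intro: L2_test_gradient_integrable test_L2)
        have "ip (\<psi> n) (\<lambda>x. gradient \<phi> x \<bullet> b) + ip (gradient (\<psi> n)) (\<lambda>x. \<phi> x *\<^sub>R b)
          = (LINT x|\<mu>. (\<psi> n x *\<^sub>R gradient \<phi> x) \<bullet> b) + (LINT x|\<mu>. (\<phi> x *\<^sub>R gradient (\<psi> n) x) \<bullet> b)"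
          by (simp add: ip_def)
        also have "\<dots> = (LINT x|\<mu>. \<psi> n x *\<^sub>R gradient \<phi> x) \<bullet> b + (LINT x|\<mu>. \<phi> x *\<^sub>R gradient (\<psi> n) x) \<bullet> b"
          using integral_inner_left[of b \<mu>] j by presburger
        also have "\<dots> = 0" using integral_by_parts[OF \<psi> \<phi>, of n] by simp
        finally show ?thesis .
      qed
      ultimately have "ip u (\<lambda>x. gradient \<phi> x \<bullet> b) + ip g (\<lambda>x. \<phi> x *\<^sub>R b) = 0"
        by (simp add: LIMSEQ_const_iff)
      moreover have "(LINT x|\<mu>. (u x *\<^sub>R gradient \<phi> x + \<phi> x *\<^sub>R g x) \<bullet> b)
          = ip u (\<lambda>x. gradient \<phi> x \<bullet> b) + ip g (\<lambda>x. \<phi> x *\<^sub>R b)"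
        unfolding ip_def using L2_inner_integrable[OF L(1) Lb] L2_inner_integrable[OF L(2) Lb']
        by (simp add: inner_add_left)
      ultimately show "(LINT x|\<mu>. (u x *\<^sub>R gradient \<phi> x + \<phi> x *\<^sub>R g x) \<bullet> b) = 0" by simp
    qed
    then show "(LINT x|\<mu>. u x *\<^sub>R gradient \<phi> x) = - (LINT x|\<mu>. \<phi> x *\<^sub>R g x)"
      using i by (simp add: eq_neg_iff_add_eq_0)
  qed
  show AE: "AE x in \<mu>. weak_gradient \<Omega> u x = g x" by (rule weak_gradient_AE[OF wg])
  have "L2_tendsto (\<lambda>n. gradient (\<psi> n)) (weak_gradient \<Omega> u)"
    by (rule L2_tendsto_AE_cong[OF g]) (use AE in \<open>auto elim!: eventually_mono\<close>)
  then show "u \<in> H10 \<Omega>"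
    unfolding H10_iff using H1I[OF L wg] \<psi> u by blast
qed

text \<open>The divergence of \<open>(x \<bullet> b) \<phi>\<^sup>2 b\<close> has integral zero.\<close>

lemma Poincare:
  obtains C where "C > 0" and "\<And>\<phi>. \<phi> \<in> TF \<Longrightarrow> ip \<phi> \<phi> \<le> C * ip (gradient \<phi>) (gradient \<phi>)"
proof -
  obtain R where R: "R > 0" "\<And>x. x \<in> \<Omega> \<Longrightarrow> norm x \<le> R"
    using bounded_domain by (auto simp: bounded_pos)
  obtain b :: 'a where b: "b \<in> Basis" using nonempty_Basis by blast
  have "ip \<phi> \<phi> \<le> (4 * R\<^sup>2) * ip (gradient \<phi>) (gradient \<phi>)" if \<phi>: "\<phi> \<in> TF" for \<phi>
  proof -
    have sm: "smooth \<phi>" using \<phi> by (rule test_function_smooth)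
    have grad: "gradient (\<lambda>x. (\<phi> x * \<phi> x) * (x \<bullet> b)) x \<bullet> b = (\<phi> x)\<^sup>2 + 2 * (x \<bullet> b) * \<phi> x * (gradient \<phi> x \<bullet> b)" for x
      unfolding gradient_mult[OF smooth_mult[OF sm sm] smooth_inner] gradient_mult[OF sm sm] gradient_linear
      using b by (simp add: inner_add_left algebra_simps power2_eq_square)
    have test: "(\<lambda>x. (\<phi> x * \<phi> x) * (x \<bullet> b)) \<in> TF"
      by (intro test_function_mult[OF test_function_mult[OF \<phi> sm] smooth_inner])
    have zero: "(LINT x|\<mu>. (\<phi> x)\<^sup>2 + 2 * (x \<bullet> b) * \<phi> x * (gradient \<phi> x \<bullet> b)) = 0"
      using integral_gradient_test[OF sets_domain test, of b] by (simp only: grad)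
    have int: "integrable \<mu> (\<lambda>x. (\<phi> x)\<^sup>2 + 2 * (x \<bullet> b) * \<phi> x * (gradient \<phi> x \<bullet> b))"
    proof -
      have "integrable \<mu> (\<lambda>x. gradient (\<lambda>x. (\<phi> x * \<phi> x) * (x \<bullet> b)) x \<bullet> b)"
        by (intro integrable_inner_left L2_integrable test_L2 test)
      then show ?thesis by (simp only: grad)
    qed
    have i: "integrable \<mu> (\<lambda>x. (\<phi> x)\<^sup>2)" "integrable \<mu> (\<lambda>x. (norm (gradient \<phi> x))\<^sup>2)"
      using L2_norm2[OF test_L2(1)[OF \<phi>]] L2_norm2[OF test_L2(2)[OF \<phi>]] by simp_all
    \<comment> \<open>Young's inequality absorbs the cross term into half of \<phi>^2 and 2 R^2
      times the squared gradient. The right integral is zero, which gives the constant 4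
      R^2.\<close>
    have "(LINT x|\<mu>. (\<phi> x)\<^sup>2 / 2 - 2 * R\<^sup>2 * (norm (gradient \<phi> x))\<^sup>2)
        \<le> (LINT x|\<mu>. (\<phi> x)\<^sup>2 + 2 * (x \<bullet> b) * \<phi> x * (gradient \<phi> x \<bullet> b))"
    proof (rule integral_mono[OF _ int])
      show "integrable \<mu> (\<lambda>x. (\<phi> x)\<^sup>2 / 2 - 2 * R\<^sup>2 * (norm (gradient \<phi> x))\<^sup>2)"
        using i by simp
      fix x assume "x \<in> space \<mu>"
      then have x: "norm x \<le> R" using R(2) by (simp add: space_restrict_space)
      have "\<bar>x \<bullet> b\<bar> \<le> R" "\<bar>gradient \<phi> x \<bullet> b\<bar> \<le> norm (gradient \<phi> x)"
        using Basis_le_norm[OF b, of x] Basis_le_norm[OF b, of "gradient \<phi> x"] x by auto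
      then have "\<bar>x \<bullet> b\<bar> * \<bar>gradient \<phi> x \<bullet> b\<bar> * \<bar>\<phi> x\<bar> \<le> R * norm (gradient \<phi> x) * \<bar>\<phi> x\<bar>"
        by (intro mult_right_mono mult_mono) auto
      then have "\<bar>(x \<bullet> b) * \<phi> x * (gradient \<phi> x \<bullet> b)\<bar> \<le> R * norm (gradient \<phi> x) * \<bar>\<phi> x\<bar>"
        by (simp add: abs_mult mult.commute mult.left_commute)
      moreover have "2 * (R * norm (gradient \<phi> x) * \<bar>\<phi> x\<bar>) \<le> (\<phi> x)\<^sup>2 / 2 + 2 * R\<^sup>2 * (norm (gradient \<phi> x))\<^sup>2"
        using zero_le_power2[of "\<bar>\<phi> x\<bar> - 2 * (R * norm (gradient \<phi> x))"]
        by (simp add: power2_diff power_mult_distrib algebra_simps)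
      ultimately show "(\<phi> x)\<^sup>2 / 2 - 2 * R\<^sup>2 * (norm (gradient \<phi> x))\<^sup>2 \<le> (\<phi> x)\<^sup>2 + 2 * (x \<bullet> b) * \<phi> x * (gradient \<phi> x \<bullet> b)"
        by (simp add: abs_le_iff algebra_simps)
    qed
    then show ?thesis
      unfolding zero ip_self using i by simp
  qed
  then show ?thesis using that[of "4 * R\<^sup>2"] R(1) by simp
qed

definition CP :: real where
  "CP = (SOME C. C > 0 \<and> (\<forall>\<phi>\<in>TF. ip \<phi> \<phi> \<le> C * E \<phi>))"

lemma CP_pos: "CP > 0" and CP: "\<phi> \<in> TF \<Longrightarrow> ip \<phi> \<phi> \<le> CP * E \<phi>"
proof -
  have "\<exists>C. C > 0 \<and> (\<forall>\<phi>\<in>TF. ip \<phi> \<phi> \<le> C * E \<phi>)"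
    using Poincare by metis
  from someI_ex[OF this] show "CP > 0" "\<phi> \<in> TF \<Longrightarrow> ip \<phi> \<phi> \<le> CP * E \<phi>"
    by (auto simp: CP_def)
qed

lemma CP_le: "\<phi> \<in> TF \<Longrightarrow> E \<phi> \<le> t \<Longrightarrow> ip \<phi> \<phi> \<le> CP * t"
  using CP[of \<phi>] CP_pos by (meson mult_left_mono less_imp_le order_trans)

lemma integral_test_le: "\<phi> \<in> TF \<Longrightarrow> E \<phi> \<le> t \<Longrightarrow> (LINT x|\<mu>. \<bar>\<phi> x\<bar>) \<le> sqrt (CP * t) * sqrt (measure \<mu> \<Omega>)"
  using integral_norm_le_ip[OF test_L2(1), of \<phi>] CP_le[of \<phi> t]
  by (smt (verit, best) mult_right_mono real_norm_def real_sqrt_ge_zero real_sqrt_le_mono measure_nonneg Bochner_Integration.integral_cong)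

lemma zero_test: "(\<lambda>x. 0) \<in> TF"
  by (rule test_functionI[OF smooth_const, of "{}"]) auto

lemma E_zero: "E (\<lambda>x. 0) = 0"
  by (simp add: gradient_const[abs_def] ip_def gradient_const)

lemma E_cmult:
  assumes "\<phi> \<in> TF" shows "E (\<lambda>x. c * \<phi> x) = c\<^sup>2 * E \<phi>"
proof -
  have "gradient (\<lambda>x. c * \<phi> x) = (\<lambda>x. c *\<^sub>R gradient \<phi> x)"
    by (rule ext) (rule gradient_cmult[OF test_function_smooth[OF assms]])
  then show ?thesis by (simp add: ip_scaleR_left ip_scaleR_right power2_eq_square)
qed

text \<open>The term \<open>e\<^sup>2\<close> makes the quadratic mean smooth, and subtracting \<open>e\<close> restores the compact support.\<close>

definition rms :: "real \<Rightarrow> real \<Rightarrow> real \<Rightarrow> ('a \<Rightarrow> real) \<Rightarrow> ('a \<Rightarrow> real) \<Rightarrow> 'a \<Rightarrow> real" where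
  "rms l m e \<phi> \<psi> x = sqrt (l * (\<phi> x)\<^sup>2 + m * (\<psi> x)\<^sup>2 + e\<^sup>2) - e"

lemma rms_nonneg: "l \<ge> 0 \<Longrightarrow> m \<ge> 0 \<Longrightarrow> e > 0 \<Longrightarrow> 0 \<le> rms l m e \<phi> \<psi> x"
  unfolding rms_def by (simp add: real_le_rsqrt)

lemma rms_error:
  assumes "l \<ge> 0" "m \<ge> 0" "e > 0"
  shows "\<bar>rms l m e \<phi> \<psi> x - sqrt (l * (\<phi> x)\<^sup>2 + m * (\<psi> x)\<^sup>2)\<bar> \<le> e"
proof -
  let ?a = "l * (\<phi> x)\<^sup>2 + m * (\<psi> x)\<^sup>2"
  have a: "?a \<ge> 0" using assms by simp
  have "sqrt (?a + e\<^sup>2) \<le> sqrt ?a + sqrt (e\<^sup>2)"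
    by (rule sqrt_add_le_add_sqrt[OF a]) simp
  moreover have "sqrt ?a \<le> sqrt (?a + e\<^sup>2)" by simp
  ultimately show ?thesis using assms(3) by (simp add: rms_def abs_le_iff)
qed

text \<open>The gradient is the weighted sum of \<phi> \<nabla>\<phi> and \<psi> \<nabla>\<psi>
  divided by the square root of q, so the weighted Cauchy-Schwarz inequality gives the bound
  pointwise; the term e^2 only enlarges the denominator. Weights summing to one give means, weights
  1 and 0 a smooth absolute value, and weights 1 and s the perturbation in
  \<open>minimiser_gain\<close>.\<close>

lemma rms_test:
  assumes \<phi>: "\<phi> \<in> TF" and \<psi>: "\<psi> \<in> TF" and lm: "l \<ge> 0" "m \<ge> 0" and e: "e > 0"
  shows "rms l m e \<phi> \<psi> \<in> TF"
    and "ip (gradient (rms l m e \<phi> \<psi>)) (gradient (rms l m e \<phi> \<psi>))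
      \<le> l * ip (gradient \<phi>) (gradient \<phi>) + m * ip (gradient \<psi>) (gradient \<psi>)"
proof -
  have sm: "smooth \<phi>" "smooth \<psi>" using \<phi> \<psi> test_function_smooth by blast+
  define q where "q x = (l * (\<phi> x * \<phi> x) + m * (\<psi> x * \<psi> x)) + e\<^sup>2" for x
  have rms: "rms l m e \<phi> \<psi> = (\<lambda>x. sqrt (q x) - e)"
    by (simp add: rms_def[abs_def] q_def power2_eq_square)
  have qe: "l * (\<phi> x)\<^sup>2 + m * (\<psi> x)\<^sup>2 \<le> q x" for x
    by (simp add: q_def power2_eq_square)
  have qpos: "q x > 0" for x
    unfolding q_def using lm e by (intro add_nonneg_pos add_nonneg_nonneg mult_nonneg_nonneg zero_le_square) auto
  note sm2 = smooth_cmult[OF smooth_mult[OF sm(1) sm(1)], of l] smooth_cmult[OF smooth_mult[OF sm(2) sm(2)], of m]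
  have smq: "smooth q"
    unfolding q_def[abs_def] by (rule smooth_add[OF smooth_add[OF sm2] smooth_const])
  have smr: "smooth (rms l m e \<phi> \<psi>)"
    unfolding rms by (rule smooth_diff[OF smooth_sqrt[OF smq qpos] smooth_const])
  obtain S where S: "compact S" "S \<subseteq> \<Omega>" "\<And>x. x \<notin> S \<Longrightarrow> \<phi> x = 0"
    using test_functionE[OF \<phi>] by metis
  obtain T where T: "compact T" "T \<subseteq> \<Omega>" "\<And>x. x \<notin> T \<Longrightarrow> \<psi> x = 0"
    using test_functionE[OF \<psi>] by metis
  show test: "rms l m e \<phi> \<psi> \<in> TF"
  proof (rule test_functionI[OF smr, of "S \<union> T"])
    show "rms l m e \<phi> \<psi> x = 0" if "x \<notin> S \<union> T" for x
      using that S(3)[of x] T(3)[of x] e by (simp add: rms_def)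
  qed (use S T in auto)
  have gq: "gradient q x = 2 *\<^sub>R ((l * \<phi> x) *\<^sub>R gradient \<phi> x + (m * \<psi> x) *\<^sub>R gradient \<psi> x)" for x
    unfolding q_def[abs_def] gradient_add[OF smooth_add[OF sm2] smooth_const] gradient_add[OF sm2]
      gradient_cmult[OF smooth_mult[OF sm(1) sm(1)]] gradient_cmult[OF smooth_mult[OF sm(2) sm(2)]]
      gradient_mult[OF sm(1) sm(1)] gradient_mult[OF sm(2) sm(2)] gradient_const
    by (simp only: scaleR_2 scaleR_add_right scaleR_scaleR add_0_right mult_2 scaleR_add_left)
  have "((\<lambda>y. sqrt y - e) has_real_derivative inverse (sqrt (q x)) / 2) (at (q x))" for x
    using qpos[of x] by (auto intro!: derivative_eq_intros)
  from gradient_compose[OF smq this]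
  have gr: "gradient (rms l m e \<phi> \<psi>) x = inverse (sqrt (q x)) *\<^sub>R ((l * \<phi> x) *\<^sub>R gradient \<phi> x + (m * \<psi> x) *\<^sub>R gradient \<psi> x)" for x
    unfolding rms gq by simp
  have le: "(norm (gradient (rms l m e \<phi> \<psi>) x))\<^sup>2 \<le> l * (norm (gradient \<phi> x))\<^sup>2 + m * (norm (gradient \<psi> x))\<^sup>2" for x
  proof -
    let ?a = "\<bar>\<phi> x\<bar>" and ?b = "\<bar>\<psi> x\<bar>" and ?A = "norm (gradient \<phi> x)" and ?B = "norm (gradient \<psi> x)"
    let ?n = "norm ((l * \<phi> x) *\<^sub>R gradient \<phi> x + (m * \<psi> x) *\<^sub>R gradient \<psi> x)"
    have "?n \<le> l * ?a * ?A + m * ?b * ?B"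
      using norm_triangle_ineq[of "(l * \<phi> x) *\<^sub>R gradient \<phi> x" "(m * \<psi> x) *\<^sub>R gradient \<psi> x"] lm
      by (simp add: abs_mult)
    then have "?n\<^sup>2 \<le> (l * ?a * ?A + m * ?b * ?B)\<^sup>2"
      by (rule power_mono) simp
    \<comment> \<open>Lagrange's identity: the two sides differ by a square with nonnegative
      weight.\<close>
    also have "\<dots> \<le> (l * ?a\<^sup>2 + m * ?b\<^sup>2) * (l * ?A\<^sup>2 + m * ?B\<^sup>2)"
    proof -
      have "(l * ?a\<^sup>2 + m * ?b\<^sup>2) * (l * ?A\<^sup>2 + m * ?B\<^sup>2) - (l * ?a * ?A + m * ?b * ?B)\<^sup>2
          = l * m * (?a * ?B - ?b * ?A)\<^sup>2"
        by (simp add: algebra_simps power2_eq_square)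
      moreover have "0 \<le> l * m * (?a * ?B - ?b * ?A)\<^sup>2" using lm by simp
      ultimately show ?thesis by linarith
    qed
    also have "\<dots> \<le> q x * (l * ?A\<^sup>2 + m * ?B\<^sup>2)"
      using qe[of x] lm by (intro mult_right_mono) auto
    finally have "?n\<^sup>2 \<le> q x * (l * ?A\<^sup>2 + m * ?B\<^sup>2)" .
    moreover have "(norm (gradient (rms l m e \<phi> \<psi>) x))\<^sup>2 = ?n\<^sup>2 / q x"
      unfolding gr using qpos[of x] by (simp add: power_mult_distrib power_inverse divide_inverse mult.commute)
    ultimately show ?thesis
      using qpos[of x] by (simp add: pos_divide_le_eq mult.commute)
  qed
  have i: "integrable \<mu> (\<lambda>x. (norm (gradient \<phi> x))\<^sup>2)" "integrable \<mu> (\<lambda>x. (norm (gradient \<psi> x))\<^sup>2)"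
    by (rule L2_norm2[OF test_L2(2)[OF \<phi>]], rule L2_norm2[OF test_L2(2)[OF \<psi>]])
  have "(LINT x|\<mu>. (norm (gradient (rms l m e \<phi> \<psi>) x))\<^sup>2)
      \<le> (LINT x|\<mu>. l * (norm (gradient \<phi> x))\<^sup>2 + m * (norm (gradient \<psi> x))\<^sup>2)"
    using i le by (intro integral_mono L2_norm2[OF test_L2(2)[OF test]]) auto
  then show "ip (gradient (rms l m e \<phi> \<psi>)) (gradient (rms l m e \<phi> \<psi>))
      \<le> l * ip (gradient \<phi>) (gradient \<phi>) + m * ip (gradient \<psi>) (gradient \<psi>)"
    using i by (simp add: ip_self)
qed

text \<open>Moving both derivatives to the test function lets \<open>gip\<close> pass to the limit
  under L2 convergence of the functions alone, when nothing is known about convergence of their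
  gradients.\<close>

lemma gip_laplacian:
  assumes u: "u \<in> H1 \<Omega>" and \<phi>: "\<phi> \<in> TF"
  shows "gip u \<phi> = - ip u (\<lambda>x. \<Sum>b\<in>Basis. gradient (\<lambda>y. gradient \<phi> y \<bullet> b) x \<bullet> b)"
    and "(\<lambda>x. \<Sum>b\<in>Basis. gradient (\<lambda>y. gradient \<phi> y \<bullet> b) x \<bullet> b) \<in> L2 \<Omega>"
proof -
  have T: "(\<lambda>y. gradient \<phi> y \<bullet> b) \<in> TF" if "b \<in> Basis" for b
    by (rule test_function_partial[OF \<phi> that])
  note wL = H1_weak_gradient(2)[OF u] and uL = H1_L2[OF u]
  have D: "(\<lambda>x. gradient (\<lambda>y. gradient \<phi> y \<bullet> b) x \<bullet> b) \<in> L2 \<Omega>" if "b \<in> Basis" for b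
    by (rule test_L2(1)[OF test_function_partial[OF T[OF that] that]])
  have b: "(LINT x|\<mu>. (weak_gradient \<Omega> u x \<bullet> b) * (gradient \<phi> x \<bullet> b)) = - (LINT x|\<mu>. u x * (gradient (\<lambda>y. gradient \<phi> y \<bullet> b) x \<bullet> b))"
    "integrable \<mu> (\<lambda>x. (weak_gradient \<Omega> u x \<bullet> b) * (gradient \<phi> x \<bullet> b))"
    "integrable \<mu> (\<lambda>x. u x * (gradient (\<lambda>y. gradient \<phi> y \<bullet> b) x \<bullet> b))"
    if b: "b \<in> Basis" for b
  proof -
    have i1: "integrable \<mu> (\<lambda>x. (gradient \<phi> x \<bullet> b) *\<^sub>R weak_gradient \<Omega> u x)"
      by (rule L2_test_scaleR_integrable[OF wL T[OF b]])
    have i2: "integrable \<mu> (\<lambda>x. u x *\<^sub>R gradient (\<lambda>y. gradient \<phi> y \<bullet> b) x)"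
      by (rule L2_test_gradient_integrable[OF uL T[OF b]])
    show "integrable \<mu> (\<lambda>x. (weak_gradient \<Omega> u x \<bullet> b) * (gradient \<phi> x \<bullet> b))"
      using integrable_inner_left[of b \<mu>, OF i1] by (simp add: mult.commute)
    show "integrable \<mu> (\<lambda>x. u x * (gradient (\<lambda>y. gradient \<phi> y \<bullet> b) x \<bullet> b))"
      using integrable_inner_left[of b \<mu>, OF i2] by simp
    have "(LINT x|\<mu>. (weak_gradient \<Omega> u x \<bullet> b) * (gradient \<phi> x \<bullet> b)) = (LINT x|\<mu>. (gradient \<phi> x \<bullet> b) *\<^sub>R weak_gradient \<Omega> u x) \<bullet> b"
      using integral_inner_left[of b \<mu>, OF i1] by (simp add: mult.commute)
    moreover have "(LINT x|\<mu>. u x * (gradient (\<lambda>y. gradient \<phi> y \<bullet> b) x \<bullet> b)) = (LINT x|\<mu>. u x *\<^sub>R gradient (\<lambda>y. gradient \<phi> y \<bullet> b) x) \<bullet> b"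
      using integral_inner_left[of b \<mu>, OF i2] by simp
    ultimately show "(LINT x|\<mu>. (weak_gradient \<Omega> u x \<bullet> b) * (gradient \<phi> x \<bullet> b)) = - (LINT x|\<mu>. u x * (gradient (\<lambda>y. gradient \<phi> y \<bullet> b) x \<bullet> b))"
      using H1_parts[OF u T[OF b]] by simp
  qed
  have "gip u \<phi> = (LINT x|\<mu>. (\<Sum>b\<in>Basis. (weak_gradient \<Omega> u x \<bullet> b) * (gradient \<phi> x \<bullet> b)))"
    unfolding gip_H1_test[OF u \<phi>] ip_def
    by (intro Bochner_Integration.integral_cong refl euclidean_inner)
  also have "\<dots> = (\<Sum>b\<in>Basis. (LINT x|\<mu>. (weak_gradient \<Omega> u x \<bullet> b) * (gradient \<phi> x \<bullet> b)))"
    by (rule Bochner_Integration.integral_sum[OF b(2)])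
  also have "\<dots> = (\<Sum>b\<in>Basis. - (LINT x|\<mu>. u x * (gradient (\<lambda>y. gradient \<phi> y \<bullet> b) x \<bullet> b)))"
    by (rule sum.cong[OF refl b(1)])
  also have "\<dots> = - (LINT x|\<mu>. (\<Sum>b\<in>Basis. u x * (gradient (\<lambda>y. gradient \<phi> y \<bullet> b) x \<bullet> b)))"
    unfolding sum_negf by (simp only: Bochner_Integration.integral_sum[OF b(3)])
  finally show "gip u \<phi> = - ip u (\<lambda>x. \<Sum>b\<in>Basis. gradient (\<lambda>y. gradient \<phi> y \<bullet> b) x \<bullet> b)"
    by (simp add: ip_def sum_distrib_left)
  have "(\<lambda>x. \<Sum>b\<in>B. gradient (\<lambda>y. gradient \<phi> y \<bullet> b) x \<bullet> b) \<in> L2 \<Omega>" if "finite B" "B \<subseteq> Basis" for B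
    using that
  proof (induction B rule: finite_induct)
    case (insert c B)
    then show ?case using L2_add[OF D[of c], of "\<lambda>x. \<Sum>b\<in>B. gradient (\<lambda>y. gradient \<phi> y \<bullet> b) x \<bullet> b"] by simp
  qed (simp add: L2_const)
  from this[OF finite_Basis subset_refl]
  show "(\<lambda>x. \<Sum>b\<in>Basis. gradient (\<lambda>y. gradient \<phi> y \<bullet> b) x \<bullet> b) \<in> L2 \<Omega>" .
qed

text \<open>Against the gradient of a fixed test function the convergence comes from
  \<open>gip_laplacian\<close>. The gradients are bounded and the gradient of u is a limit of test
  gradients, so the gradient of u may be used instead.\<close>

lemma gradients_converge_weakly:
  assumes q: "\<And>n. q n \<in> TF" "L2_tendsto q u" "\<And>n. E (q n) \<le> B" and u: "u \<in> H10 \<Omega>"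
  shows "(\<lambda>n. ip (gradient (q n)) (weak_gradient \<Omega> u)) \<longlonglongrightarrow> gip u u"
proof (rule LIMSEQ_I)
  fix e :: real assume e: "e > 0"
  obtain \<phi> where \<phi>: "\<And>k. \<phi> k \<in> TF" "L2_tendsto (\<lambda>k. gradient (\<phi> k)) (weak_gradient \<Omega> u)"
    using H10_approx[OF u] by metis
  note u1 = H10_H1[OF u] and wL = H1_weak_gradient(2)[OF H10_H1[OF u]]
  define \<delta> where "\<delta> k = sqrt (ip (\<lambda>x. gradient (\<phi> k) x - weak_gradient \<Omega> u x) (\<lambda>x. gradient (\<phi> k) x - weak_gradient \<Omega> u x))" for k
  have \<delta>lim: "\<delta> \<longlonglongrightarrow> 0" using L2_tendsto_sqrt[OF \<phi>(2)] by (simp add: \<delta>_def[abs_def])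
  \<comment> \<open>Replacing the gradient of u by that of \<open>\<phi> k\<close> costs at most
    \<open>sqrt B * \<delta> k\<close> in the sequence and
    \<open>sqrt (gip u u) * \<delta> k\<close> in the limit.\<close>
  define c where "c = sqrt B + sqrt (gip u u)"
  have "(\<lambda>k. c * \<delta> k) \<longlonglongrightarrow> c * 0" by (intro tendsto_intros \<delta>lim)
  then have "eventually (\<lambda>k. c * \<delta> k < e / 2) sequentially"
    using e by (intro order_tendstoD(2)) auto
  then obtain k where k: "c * \<delta> k < e / 2" by (auto simp: eventually_sequentially)
  let ?\<Delta> = "\<lambda>x. \<Sum>b\<in>Basis. gradient (\<lambda>y. gradient (\<phi> k) y \<bullet> b) x \<bullet> b"
  have \<Delta>: "?\<Delta> \<in> L2 \<Omega>" by (rule gip_laplacian(2)[OF u1 \<phi>(1)])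
  have "(\<lambda>n. - ip (q n) ?\<Delta>) \<longlonglongrightarrow> - ip u ?\<Delta>"
    by (intro tendsto_minus L2_tendsto_ip q(2) L2_tendsto_const \<Delta>)
  then have "(\<lambda>n. gip (q n) (\<phi> k)) \<longlonglongrightarrow> gip u (\<phi> k)"
    by (simp only: gip_laplacian(1)[OF test_weak_gradient(1)[OF q(1)] \<phi>(1)] gip_laplacian(1)[OF u1 \<phi>(1)])
  then have "(\<lambda>n. ip (gradient (q n)) (gradient (\<phi> k))) \<longlonglongrightarrow> ip (weak_gradient \<Omega> u) (gradient (\<phi> k))"
    by (simp only: gip_test[OF q(1) \<phi>(1)] gip_H1_test[OF u1 \<phi>(1)])
  from LIMSEQ_D[OF this, of "e / 2"] e
  obtain N where N: "\<And>n. n \<ge> N \<Longrightarrow> \<bar>ip (gradient (q n)) (gradient (\<phi> k)) - ip (weak_gradient \<Omega> u) (gradient (\<phi> k))\<bar> < e / 2"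
    by auto
  have "\<bar>ip (gradient (q n)) (weak_gradient \<Omega> u) - gip u u\<bar> < e" if n: "n \<ge> N" for n
  proof -
    note gL = test_L2(2)[OF q(1)[of n]] and pL = test_L2(2)[OF \<phi>(1)[of k]]
    let ?w = "\<lambda>x. gradient (\<phi> k) x - weak_gradient \<Omega> u x"
    have 1: "\<bar>ip (gradient (q n)) ?w\<bar> \<le> sqrt (E (q n)) * \<delta> k"
      unfolding \<delta>_def by (rule ip_Cauchy_Schwarz[OF gL L2_diff[OF pL wL]])
    have 2: "\<bar>ip (weak_gradient \<Omega> u) ?w\<bar> \<le> sqrt (gip u u) * \<delta> k"
      unfolding \<delta>_def gip_def by (rule ip_Cauchy_Schwarz[OF wL L2_diff[OF pL wL]])
    have \<delta>0: "\<delta> k \<ge> 0" by (simp add: \<delta>_def ip_self_nonneg)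
    have 3: "sqrt (E (q n)) * \<delta> k \<le> sqrt B * \<delta> k"
      using q(3) \<delta>0 by (intro mult_right_mono) auto
    have "c * \<delta> k = sqrt B * \<delta> k + sqrt (gip u u) * \<delta> k" by (simp add: c_def distrib_right)
    then show ?thesis
      using 1 2 3 N[OF n] k ip_diff_right[OF pL wL gL] ip_diff_right[OF pL wL wL] unfolding gip_def[symmetric]
      by linarith
  qed
  then show "\<exists>N. \<forall>n\<ge>N. norm (ip (gradient (q n)) (weak_gradient \<Omega> u) - gip u u) < e" by auto
qed

text \<open>The smoothed absolute values of approximating test functions are nonnegative, do not
  increase the Dirichlet integral, and converge in L2 to \<bar>u\<bar> = u. Weak convergence of the
  gradients together with norms that do not exceed \<open>gip u u\<close> in the limit forces strong
  convergence.\<close>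

lemma H10_approx_nonneg:
  assumes u: "u \<in> H10 \<Omega>" and nonneg: "AE x in \<mu>. u x \<ge> 0"
  obtains q where "\<And>n. q n \<in> TF" "\<And>n x. 0 \<le> q n x" "L2_tendsto q u" "L2_tendsto (\<lambda>n. gradient (q n)) (weak_gradient \<Omega> u)"
proof -
  obtain \<phi> where \<phi>: "\<And>n. \<phi> n \<in> TF" "L2_tendsto \<phi> u" "L2_tendsto (\<lambda>n. gradient (\<phi> n)) (weak_gradient \<Omega> u)"
    using H10_approx[OF u] by metis
  define e where "e n = inverse (real (Suc n))" for n
  have e: "e n > 0" for n by (simp add: e_def)
  have elim: "e \<longlonglongrightarrow> 0" unfolding e_def by (rule LIMSEQ_inverse_real_of_nat)
  define q where "q n = rms 1 0 (e n) (\<phi> n) (\<phi> n)" for n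
  have lm: "(0::real) \<le> 1" "(0::real) \<le> 0" by auto
  have q: "q n \<in> TF" "E (q n) \<le> E (\<phi> n)" "0 \<le> q n x" for n x
    using rms_test[OF \<phi>(1) \<phi>(1) lm e] rms_nonneg[OF lm e] by (auto simp: q_def)
  have uL: "u \<in> L2 \<Omega>" and wL: "weak_gradient \<Omega> u \<in> L2 \<Omega>"
    using \<phi>(2,3) by (auto simp: L2_tendsto_def)
  have qL: "q n \<in> L2 \<Omega>" for n by (rule test_L2(1)[OF q(1)])
  have err: "\<bar>q n x - \<bar>\<phi> n x\<bar>\<bar> \<le> e n" for n x
    using rms_error[OF lm e, of n "\<phi> n" "\<phi> n" x] by (simp add: q_def)
  have "ip (\<lambda>x. q n x - u x) (\<lambda>x. q n x - u x) \<le> 2 * (e n)\<^sup>2 * measure \<mu> \<Omega> + 2 * ip (\<lambda>x. \<phi> n x - u x) (\<lambda>x. \<phi> n x - u x)" for n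
  proof -
    have i: "integrable \<mu> (\<lambda>x. (\<phi> n x - u x)\<^sup>2)" by (rule L2_square[OF L2_diff[OF test_L2(1)[OF \<phi>(1)] uL]])
    have c: "integrable \<mu> (\<lambda>x. 2 * (e n)\<^sup>2)" by (rule L2_integrable[OF L2_const])
    have "(LINT x|\<mu>. (q n x - u x)\<^sup>2) \<le> (LINT x|\<mu>. 2 * (e n)\<^sup>2 + 2 * (\<phi> n x - u x)\<^sup>2)"
    proof (rule integral_mono_AE[OF L2_square[OF L2_diff[OF qL uL]]])
      show "integrable \<mu> (\<lambda>x. 2 * (e n)\<^sup>2 + 2 * (\<phi> n x - u x)\<^sup>2)" using i c by simp
      show "AE x in \<mu>. (q n x - u x)\<^sup>2 \<le> 2 * (e n)\<^sup>2 + 2 * (\<phi> n x - u x)\<^sup>2"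
        using nonneg
      proof eventually_elim
        case (elim x)
        have "\<bar>q n x - u x\<bar> \<le> e n + \<bar>\<phi> n x - u x\<bar>" using err[of n x] elim by linarith
        then have "\<bar>q n x - u x\<bar>\<^sup>2 \<le> (e n + \<bar>\<phi> n x - u x\<bar>)\<^sup>2" by (rule power_mono) simp
        also have "\<dots> \<le> 2 * (e n)\<^sup>2 + 2 * \<bar>\<phi> n x - u x\<bar>\<^sup>2"
          by (rule power2_sum_le)
        finally show ?case by simp
      qed
    qed
    then show ?thesis using i c by (simp add: ip_real space_restrict_space mult_ac)
  qed
  moreover have "(\<lambda>n. 2 * (e n)\<^sup>2 * measure \<mu> \<Omega> + 2 * ip (\<lambda>x. \<phi> n x - u x) (\<lambda>x. \<phi> n x - u x)) \<longlonglongrightarrow> 2 * 0\<^sup>2 * measure \<mu> \<Omega> + 2 * 0"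
    using \<phi>(2) by (intro tendsto_intros elim) (auto simp: L2_tendsto_def)
  ultimately have "(\<lambda>n. ip (\<lambda>x. q n x - u x) (\<lambda>x. q n x - u x)) \<longlonglongrightarrow> 0"
    by (intro LIMSEQ_null_squeeze[OF _ ip_self_nonneg]) auto
  then have qu: "L2_tendsto q u" using qL uL by (simp add: L2_tendsto_def)
  obtain B where B: "\<And>n. E (\<phi> n) \<le> B" using L2_tendsto_bounded[OF \<phi>(3)] by metis
  have weak: "(\<lambda>n. ip (gradient (q n)) (weak_gradient \<Omega> u)) \<longlonglongrightarrow> gip u u"
    by (rule gradients_converge_weakly[OF q(1) qu _ u]) (use q(2) B order_trans in blast)
  note gL = test_L2(2)[OF q(1)]
  \<comment> \<open>This upper bound for the squared gradient distance arises by replacing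
    \<open>E (q n)\<close> with \<open>E (\<phi> n)\<close>, whose limit is known.\<close>
  have "(\<lambda>n. E (\<phi> n) - 2 * ip (gradient (q n)) (weak_gradient \<Omega> u) + gip u u) \<longlonglongrightarrow> gip u u - 2 * gip u u + gip u u"
    by (intro tendsto_intros weak) (use L2_tendsto_ip[OF \<phi>(3) \<phi>(3)] in \<open>simp add: gip_def\<close>)
  then have "(\<lambda>n. E (\<phi> n) - 2 * ip (gradient (q n)) (weak_gradient \<Omega> u) + gip u u) \<longlonglongrightarrow> 0" by simp
  moreover have "ip (\<lambda>x. gradient (q n) x - weak_gradient \<Omega> u x) (\<lambda>x. gradient (q n) x - weak_gradient \<Omega> u x)
      \<le> E (\<phi> n) - 2 * ip (gradient (q n)) (weak_gradient \<Omega> u) + gip u u" for n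
    unfolding ip_diff_self[OF gL wL] gip_def using q(2)[of n] by simp
  ultimately have "(\<lambda>n. ip (\<lambda>x. gradient (q n) x - weak_gradient \<Omega> u x) (\<lambda>x. gradient (q n) x - weak_gradient \<Omega> u x)) \<longlonglongrightarrow> 0"
    by (intro LIMSEQ_null_squeeze[OF _ ip_self_nonneg]) auto
  then have "L2_tendsto (\<lambda>n. gradient (q n)) (weak_gradient \<Omega> u)" using gL wL by (simp add: L2_tendsto_def)
  then show ?thesis using that q(1,3) qu by blast
qed

end

section \<open>The nonlinearity\<close>

locale nonlinearity =
  fixes f :: "real \<Rightarrow> real"
  assumes f_continuous: "continuous_on {0..} f"
    and f_nonneg: "\<And>\<xi>. \<xi> \<ge> 0 \<Longrightarrow> f \<xi> \<ge> 0"
    and f_zero: "f 0 = 0"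
    and f_quotient: "strict_antimono_on {0<..} (\<lambda>\<xi>. f \<xi> / \<xi>)"
    and f_sublinear: "((\<lambda>\<xi>. f \<xi> / \<xi>) \<longlongrightarrow> 0) at_top"
    and f_singular: "filterlim (\<lambda>\<xi>. f \<xi> / \<xi>) at_top (at_right 0)"
begin

lemma quotient_less: "0 < x \<Longrightarrow> x < y \<Longrightarrow> f y / y < f x / x"
  using f_quotient by (auto simp: monotone_on_def)

lemma f_pos:
  assumes "s > 0" shows "f s > 0"
proof -
  have "0 \<le> f (s + 1) / (s + 1)" using f_nonneg[of "s + 1"] assms by simp
  also have "\<dots> < f s / s" using quotient_less[of s "s + 1"] assms by simp
  finally show ?thesis using assms by (simp add: zero_less_divide_iff)
qed

text \<open>Beyond some point the quotient is below e, and on the remaining compact interval f is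
  bounded. That the slope may be arbitrarily small is what \<open>G_uniformly_continuous\<close>
  depends on.\<close>

lemma f_growth:
  assumes "e > 0"
  obtains C where "C \<ge> 0" "\<And>s. s \<ge> 0 \<Longrightarrow> f s \<le> C + e * s"
proof -
  have "eventually (\<lambda>s. f s / s < e) at_top"
    using order_tendstoD(2)[OF f_sublinear assms] .
  then obtain S where S: "\<And>s. s \<ge> S \<Longrightarrow> f s / s < e"
    by (auto simp: eventually_at_top_linorder)
  define T where "T = max S 1"
  have "compact (f ` {0..T})"
    by (intro compact_continuous_image continuous_on_subset[OF f_continuous]) auto
  then have "bounded (f ` {0..T})" by (rule compact_imp_bounded)
  then obtain C where C: "C > 0" "\<And>s. 0 \<le> s \<Longrightarrow> s \<le> T \<Longrightarrow> \<bar>f s\<bar> \<le> C"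
    by (auto simp: bounded_pos)
  have "f s \<le> C + e * s" if "s \<ge> 0" for s
  proof (cases "s \<le> T")
    case True
    have "0 \<le> e * s" using assms that by simp
    then show ?thesis using C(2)[OF that True] by linarith
  next
    case False
    then have "s > 0" "f s / s < e" using S[of s] by (auto simp: T_def)
    then have "f s \<le> e * s" by (simp add: pos_divide_less_eq)
    then show ?thesis using C(1) by linarith
  qed
  then show ?thesis using that[of C] C(1) by simp
qed

text \<open>The hypotheses do not restrict \<open>f\<close> on the negative numbers.\<close>

abbreviation f0 :: "real \<Rightarrow> real" where "f0 s \<equiv> f (max 0 s)"

lemma f0_continuous: "continuous_on S f0"
  by (rule continuous_on_compose2[OF f_continuous]) (auto intro!: continuous_intros)

lemma f0_nonneg: "f0 s \<ge> 0"
  by (simp add: f_nonneg)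

section \<open>The primitive of the nonlinearity\<close>

definition F :: "real \<Rightarrow> real" where
  "F y = integral {0..max 0 y} f"

lemma F_nonpos: "y \<le> 0 \<Longrightarrow> F y = 0"
  by (simp add: F_def)

lemma F_deriv: "(F has_real_derivative f0 y) (at y)"
proof -
  \<comment> \<open>An interval with y inside that begins below 0: there f0 equals
    \<open>f 0 = 0\<close> and contributes nothing, so F is an integral from a fixed lower end and
    the fundamental theorem applies on both sides of y.\<close>
  define a where "a = - \<bar>y\<bar> - 1"
  define b where "b = \<bar>y\<bar> + 1"
  have int: "f0 integrable_on {c..d}" for c d
    by (intro integrable_continuous_real f0_continuous)
  have neg: "integral {a..z} f0 = 0" if "z \<le> 0" for z
  proof -
    have "integral {a..z} f0 = integral {a..z} (\<lambda>x. 0)"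
      using that by (intro integral_cong) (simp add: f_zero max_absorb1)
    then show ?thesis by simp
  qed
  have F: "F z = integral {a..z} f0" if "z \<in> {a<..<b}" for z
  proof (cases "z \<le> 0")
    case True
    then show ?thesis using neg by (simp add: F_nonpos)
  next
    case False
    have "integral {a..0} f0 + integral {0..z} f0 = integral {a..z} f0"
      using False by (intro Henstock_Kurzweil_Integration.integral_combine int) (auto simp: a_def)
    moreover have "integral {0..z} f0 = integral {0..z} f"
      by (intro integral_cong) (simp add: max_absorb2)
    moreover have "F z = integral {0..z} f"
      using False by (simp add: F_def max_absorb2)
    ultimately show ?thesis using neg[of 0] by simp
  qed
  have "((\<lambda>z. integral {a..z} f0) has_real_derivative f0 y) (at y within {a..b})"
    by (intro integral_has_real_derivative f0_continuous) (auto simp: a_def b_def)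
  then have "((\<lambda>z. integral {a..z} f0) has_real_derivative f0 y) (at y)"
    by (subst (asm) at_within_Icc_at) (auto simp: a_def b_def)
  then show ?thesis
    by (rule has_field_derivative_transform_within_open[of _ _ _ "{a<..<b}"]) (auto simp: F a_def b_def)
qed

lemma F_continuous: "continuous_on S F"
  using F_deriv DERIV_isCont continuous_at_imp_continuous_on by blast

lemma F_mono: "x \<le> y \<Longrightarrow> F x \<le> F y"
  by (rule DERIV_nonneg_imp_nondecreasing) (use F_deriv f0_nonneg in blast)+

lemma F_nonneg: "F y \<ge> 0"
  using F_mono[of "min 0 y" y] by (simp add: F_nonpos)

lemma F_strict_mono:
  assumes "0 \<le> x" "x < y" shows "F x < F y"
proof (rule DERIV_pos_imp_increasing_open[OF assms(2)])
  show "\<exists>d. DERIV F z :> d \<and> 0 < d" if "x < z" "z < y" for z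
    using that assms F_deriv[of z] f_pos[of z] by (intro exI[of _ "f0 z"]) auto
  show "continuous_on {x..y} F" by (rule F_continuous)
qed

lemma F_Lipschitz:
  assumes "e \<ge> 0" and C: "C \<ge> 0" "\<And>s. s \<ge> 0 \<Longrightarrow> f s \<le> C + e * s"
  shows "\<bar>F x - F y\<bar> \<le> \<bar>x - y\<bar> * (C + e * (\<bar>x\<bar> + \<bar>y\<bar>))"
proof -
  have *: "F y - F x \<le> (y - x) * (C + e * (\<bar>x\<bar> + \<bar>y\<bar>))" if xy: "x < y" for x y
  proof -
    obtain z where z: "x < z" "z < y" "F y - F x = (y - x) * f0 z"
      using MVT2[OF xy, of F f0] F_deriv by auto
    have "f0 z \<le> C + e * max 0 z" using C(2)[of "max 0 z"] by simp
    also have "\<dots> \<le> C + e * (\<bar>x\<bar> + \<bar>y\<bar>)"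
      using z assms(1) by (intro add_left_mono mult_left_mono) auto
    finally show ?thesis
      unfolding z(3) using xy by (intro mult_left_mono) auto
  qed
  consider "x < y" | "x = y" | "y < x" by linarith
  then show ?thesis
  proof cases
    case 1
    then show ?thesis using *[OF 1] F_mono[of x y] by (simp add: abs_if)
  next
    case 3
    then show ?thesis using *[OF 3] F_mono[of y x] by (simp add: abs_if add.commute)
  qed simp
qed

text \<open>Since \<open>f \<xi> / \<xi>\<close> decreases, \<open>F\<close> is a strictly concave function of the square of its argument.\<close>

lemma F_tangent_less:
  assumes x: "x > 0" and "y \<noteq> x"
  shows "F y - F x < f x / (2 * x) * (y\<^sup>2 - x\<^sup>2)"
proof -
  \<comment> \<open>H is the tangent parabola minus F, up to a constant. The comparison of the
    quotients at s and x determines the sign of its derivative, so x is the strict minimum on the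
    nonnegative numbers.\<close>
  define H where "H s = f x / (2 * x) * s\<^sup>2 - F s" for s
  have dH: "(H has_real_derivative (f x / x * s - f0 s)) (at s)" for s
    unfolding H_def[abs_def] using x by (auto intro!: derivative_eq_intros F_deriv simp: field_simps)
  have contH: "continuous_on S H" for S
    using dH DERIV_isCont continuous_at_imp_continuous_on by blast
  have main: "H x < H y" if y: "y \<ge> 0" "y \<noteq> x" for y
  proof (cases "y < x")
    case True
    show ?thesis
    proof (rule DERIV_neg_imp_decreasing_open[OF True _ contH])
      fix s assume s: "y < s" "s < x"
      then have "s > 0" using y by simp
      then have "f x / x * s < f0 s"
        using quotient_less[of s x] s by (simp add: pos_less_divide_eq)
      then show "\<exists>d. DERIV H s :> d \<and> d < 0"
        using dH[of s] by (intro exI[of _ "f x / x * s - f0 s"]) simp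
    qed
  next
    case False
    then have xy: "x < y" using y by simp
    show ?thesis
    proof (rule DERIV_pos_imp_increasing_open[OF xy _ contH])
      fix s assume s: "x < s" "s < y"
      then have "s > 0" using x by simp
      then have "f0 s < f x / x * s"
        using quotient_less[of x s] s x by (simp add: pos_divide_less_eq)
      then show "\<exists>d. DERIV H s :> d \<and> d > 0"
        using dH[of s] by (intro exI[of _ "f x / x * s - f0 s"]) simp
    qed
  qed
  \<comment> \<open>For negative y the primitive is 0 as at 0, while the parabola is only
    larger.\<close>
  have "H x < H y"
  proof (cases "y \<ge> 0")
    case False
    have "H x < H 0" using main[of 0] x by simp
    also have "H 0 \<le> H y"
      using False f_nonneg[of x] x by (simp add: H_def F_nonpos)
    finally show ?thesis .
  qed (use main assms in simp)
  then show ?thesis by (simp add: H_def algebra_simps)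
qed

lemma F_tangent: "x > 0 \<Longrightarrow> F y - F x \<le> f x / (2 * x) * (y\<^sup>2 - x\<^sup>2)"
  using F_tangent_less[of x y] by (cases "y = x") auto

text \<open>The tangent inequality at r, evaluated at 0.\<close>

lemma F_lower:
  assumes "r > 0" shows "r * f r / 2 \<le> F r"
  using F_tangent[OF assms, of 0] assms by (simp add: F_nonpos power2_eq_square mult.commute)

text \<open>Jensen's inequality in the squared variable. Both values are compared with the tangent
  at the quadratic mean z, and the quadratic terms cancel. If z = 0 there is no such tangent, but
  then both weighted terms vanish.\<close>

lemma F_rms:
  assumes lm: "l \<ge> 0" "m \<ge> 0" "l + m = 1"
  shows "l * F a + m * F b \<le> F (sqrt (l * a\<^sup>2 + m * b\<^sup>2))"
proof -
  define z where "z = sqrt (l * a\<^sup>2 + m * b\<^sup>2)"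
  have z2: "z\<^sup>2 = l * a\<^sup>2 + m * b\<^sup>2" using lm by (simp add: z_def)
  show ?thesis
  proof (cases "z = 0")
    case True
    then have "l * a\<^sup>2 = 0" "m * b\<^sup>2 = 0"
      using z2 lm by (metis add_nonneg_eq_0_iff mult_nonneg_nonneg power2_eq_square mult_zero_left zero_le_power2)+
    then have "l * F a = 0" "m * F b = 0" by (auto simp: F_nonpos)
    then have "l * F a + m * F b = 0" by (simp only: add_0)
    then show ?thesis using F_nonneg by (simp only:)
  next
    case False
    then have z: "z > 0" using lm by (simp add: z_def less_le)
    have "l * (F a - F z) + m * (F b - F z) \<le> l * (f z / (2 * z) * (a\<^sup>2 - z\<^sup>2)) + m * (f z / (2 * z) * (b\<^sup>2 - z\<^sup>2))"
      using lm by (intro add_mono mult_left_mono F_tangent z) auto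
    also have "\<dots> = f z / (2 * z) * (l * a\<^sup>2 + m * b\<^sup>2 - (l + m) * z\<^sup>2)"
      by (simp only: algebra_simps)
    also have "\<dots> = 0" using lm z2 by simp
    finally have "l * F a + m * F b \<le> (l + m) * F z" by (simp add: algebra_simps)
    then show ?thesis using lm by (simp add: z_def)
  qed
qed

end

text \<open>At \<open>t\<close> the slope \<open>K t / 2\<close> is too small if \<open>M\<close> has a larger slope to the right, and too large if \<open>M\<close> has a
  smaller slope to the left. Both kinds of \<open>t\<close> form nonempty open sets, which are disjoint by concavity, so they
  do not exhaust the connected set \<open>I\<close>.\<close>

lemma concave_supporting_slope:
  fixes M K :: "real \<Rightarrow> real"
  assumes I: "open I" "is_interval I" "I \<subseteq> {0<..}"
    and K: "strict_mono_on I K" "K ` I = {0<..}"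
    and M: "concave_on {0..} M" "0 \<le> M 0" "\<And>t. t > 0 \<Longrightarrow> M t < M (t + 1)"
  obtains t where "t \<in> I" "\<And>s. s \<ge> 0 \<Longrightarrow> M s \<le> M t + K t / 2 * (s - t)"
proof -
  have Kpos: "K t > 0" if "t \<in> I" for t using that K(2) by auto
  \<comment> \<open>Left secants are at least as steep as right ones, in a form without
    division.\<close>
  have slopes: "(M t - M r) * (s - t) \<ge> (M s - M t) * (t - r)" if "0 \<le> r" "r < t" "t < s" for r t s
  proof -
    define u where "u = (t - r) / (s - r)"
    have u: "0 \<le> u" "u \<le> 1" using that by (auto simp: u_def field_simps)
    have "M ((1 - u) *\<^sub>R r + u *\<^sub>R s) \<ge> (1 - u) * M r + u * M s"
      using concave_onD[OF M(1) u, of r s] that by auto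
    moreover have "(1 - u) *\<^sub>R r + u *\<^sub>R s = t"
    proof -
      have "(1 - u) *\<^sub>R r + u *\<^sub>R s = r + u * (s - r)" by (simp add: algebra_simps)
      then show ?thesis using that by (simp add: u_def)
    qed
    ultimately have le: "((1 - u) * M r + u * M s) * (s - r) \<le> M t * (s - r)"
      using that by (intro mult_right_mono) auto
    have us: "u * (s - r) = t - r"
      using that by (simp add: u_def)
    have us': "(1 - u) * (s - r) = s - t"
      unfolding left_diff_distrib us by simp
    have "((1 - u) * M r + u * M s) * (s - r) = (s - t) * M r + (t - r) * M s"
      unfolding us[symmetric] us'[symmetric] by (simp add: algebra_simps)
    with le show ?thesis by (simp add: algebra_simps)
  qed
  \<comment> \<open>A monotone function with open image has no jumps.\<close>
  have contK: "continuous_on I K"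
    by (rule continuous_onI_mono) (use K in \<open>auto simp: strict_mono_on_leD open_greaterThan\<close>)
  have "convex_on {0<..} (\<lambda>x. - M x)"
    using M(1) unfolding concave_on_def by (rule convex_on_subset) (auto simp: convex_real_interval)
  then have "continuous_on {0<..} (\<lambda>x. - M x)"
    by (intro convex_on_continuous) auto
  then have "continuous_on {0<..} M"
    using continuous_on_minus[of "{0<..}" "\<lambda>x. - M x"] by simp
  then have contM: "continuous_on I M"
    using I(3) by (rule continuous_on_subset)
  have open_slope: "open (I \<inter> (\<lambda>t. M s - M t - K t / 2 * (s - t)) -` {0<..})" for s
    using I(1) by (intro continuous_open_preimage continuous_intros contK contM) auto
  define low where "low s = {t \<in> I. s > t \<and> M s - M t > K t / 2 * (s - t)}" for s
  define high where "high s = {t \<in> I. s < t \<and> M s - M t > K t / 2 * (s - t)}" for s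
  have open_low: "open (low s)" for s
  proof -
    have "low s = {..<s} \<inter> (I \<inter> (\<lambda>t. M s - M t - K t / 2 * (s - t)) -` {0<..})"
      by (auto simp: low_def)
    then show ?thesis using open_slope[of s] by (simp add: open_Int)
  qed
  have open_high: "open (high s)" for s
  proof -
    have "high s = {s<..} \<inter> (I \<inter> (\<lambda>t. M s - M t - K t / 2 * (s - t)) -` {0<..})"
      by (auto simp: high_def)
    then show ?thesis using open_slope[of s] by (simp add: open_Int)
  qed
  \<comment> \<open>A common point would have a left secant flatter, and a right secant steeper,
    than \<open>K t / 2\<close>. Concavity is known on the nonnegative numbers only, whence the
    bound on r.\<close>
  have disjoint: "low s \<inter> high r = {}" if "r \<ge> 0" for r s
  proof (rule ccontr)
    assume "low s \<inter> high r \<noteq> {}"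
    then obtain t where t: "r < t" "t < s" "M s - M t > K t / 2 * (s - t)" "M r - M t > K t / 2 * (r - t)"
      by (auto simp: low_def high_def)
    have "K t / 2 * (t - r) = - (K t / 2 * (r - t))" by (simp add: field_simps)
    then have "M t - M r < K t / 2 * (t - r)" using t(4) by linarith
    then have "(M t - M r) * (s - t) < (K t / 2 * (t - r)) * (s - t)"
      using t by (intro mult_strict_right_mono) auto
    also have "\<dots> = (K t / 2 * (s - t)) * (t - r)" by simp
    also have "\<dots> < (M s - M t) * (t - r)"
      using t by (intro mult_strict_right_mono) auto
    finally show False using slopes[OF that t(1,2)] by simp
  qed
  have surj: "\<exists>t\<in>I. K t = c" if "c > 0" for c
  proof -
    have "c \<in> K ` I" unfolding K(2) using that by simp
    then show ?thesis by (metis imageE)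
  qed
  obtain t0 where t0: "t0 \<in> I" using surj[of 1] by auto
  then have t0pos: "t0 > 0" using I(3) by auto
  obtain t1 s1 where t1: "t1 \<in> low s1" "s1 > 0"
  proof -
    \<comment> \<open>The condition \<open>K t \<le> K t0\<close> places t to the left of t0, so by
      concavity M has slope at least d from t to t0 + 1, and \<open>K t / 2 < d\<close>.\<close>
    define d where "d = M (t0 + 1) - M t0"
    have d: "d > 0" using M(3)[OF t0pos] by (simp add: d_def)
    obtain t where t: "t \<in> I" "K t = min (K t0) d"
      using surj[of "min (K t0) d"] d Kpos[OF t0] by auto
    have tt0: "t \<le> t0"
      using strict_mono_onD[OF K(1) t0 t(1)] t(2) by (cases "t \<le> t0") auto
    have tpos: "t > 0" using t(1) I(3) by auto
    have "M (t0 + 1) - M t \<ge> d * (t0 + 1 - t)"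
    proof (cases "t = t0")
      case False
      then have "(M t0 - M t) * (t0 + 1 - t0) \<ge> (M (t0 + 1) - M t0) * (t0 - t)"
        using tt0 tpos by (intro slopes) auto
      then show ?thesis by (simp add: d_def algebra_simps)
    qed (simp add: d_def)
    moreover have "K t / 2 * (t0 + 1 - t) < d * (t0 + 1 - t)"
      using t d tt0 by (intro mult_strict_right_mono) auto
    ultimately have "K t / 2 * (t0 + 1 - t) < M (t0 + 1) - M t" by linarith
    then have "t \<in> low (t0 + 1)" using t(1) tt0 by (simp add: low_def)
    then show ?thesis using that t0pos by simp
  qed
  obtain t2 where t2: "t2 \<in> high 0"
  proof -
    \<comment> \<open>Here t is to the right of t0. Since \<open>M 0 \<ge> 0\<close>, concavity
      gives M t / t at most M t0 / t0, which is less than c / 2 thanks to the added 1.\<close>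
    define c where "c = max (K t0) (2 * \<bar>M t0\<bar> / t0 + 1)"
    have "c > 0" using Kpos[OF t0] by (simp add: c_def)
    then obtain t where t: "t \<in> I" "K t = c"
      using surj by blast
    have tt0: "t0 \<le> t"
      using strict_mono_onD[OF K(1) t(1) t0] t(2) by (cases "t0 \<le> t") (auto simp: c_def)
    have "M t * t0 \<le> M t0 * t"
    proof (cases "t = t0")
      case False
      then have "(M t0 - M 0) * (t - t0) \<ge> (M t - M t0) * (t0 - 0)"
        using tt0 t0pos by (intro slopes) auto
      moreover have "M 0 * (t - t0) \<ge> 0" using M(2) tt0 by simp
      ultimately show ?thesis by (simp add: algebra_simps)
    qed simp
    also have "\<dots> \<le> \<bar>M t0\<bar> * t" using tt0 t0pos by (intro mult_right_mono) auto
    also have "\<bar>M t0\<bar> * t < (c / 2 * t0) * t"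
    proof (rule mult_strict_right_mono)
      have "2 * \<bar>M t0\<bar> / t0 < c" by (simp add: c_def)
      then show "\<bar>M t0\<bar> < c / 2 * t0" using t0pos by (simp add: field_simps)
    qed (use tt0 t0pos in simp)
    finally have "M t * t0 < (c / 2 * t) * t0" by (simp add: mult.commute mult.left_commute)
    then have "M t < c / 2 * t" using t0pos by simp
    then have "t \<in> high 0" using t M(2) tt0 t0pos by (simp add: high_def)
    then show ?thesis using that by blast
  qed
  have sub: "low s \<subseteq> I" "high s \<subseteq> I" for s by (auto simp: low_def high_def)
  have t1': "t1 \<in> (\<Union>s. low s) \<inter> I" using t1 sub by blast
  have t2': "t2 \<in> (\<Union>r\<in>{0..}. high r) \<inter> I"
    using t2 sub(2)[of 0] by (intro IntI UN_I[of 0]) auto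
  have conn: "connected I" using I(2) is_interval_connected by blast
  have op: "open (\<Union>s. low s)" "open (\<Union>r\<in>{0..}. high r)"
    using open_low open_high by blast+
  have dis: "(\<Union>s. low s) \<inter> (\<Union>r\<in>{0..}. high r) \<inter> I = {}"
    using disjoint by auto
  have "\<not> I \<subseteq> (\<Union>s. low s) \<union> (\<Union>r\<in>{0..}. high r)"
    using connectedD[OF conn op dis] t1' t2' by blast
  then obtain t where "t \<in> I" "t \<notin> (\<Union>s. low s) \<union> (\<Union>r\<in>{0..}. high r)" by blast
  then have t: "t \<in> I" "\<And>s. t \<notin> low s" "\<And>r. r \<ge> 0 \<Longrightarrow> t \<notin> high r" by auto
  have "M s \<le> M t + K t / 2 * (s - t)" if "s \<ge> 0" for s
    using t(1) t(2)[of s] t(3)[OF that] by (cases s t rule: linorder_cases) (auto simp: low_def high_def)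
  then show ?thesis using that t(1) by blast
qed

section \<open>Maximisation under a bound on the Dirichlet integral\<close>

text \<open>Quantitative strict convexity of the quadratic mean. With d = R - (a + b) / 2, the
  square of the difference is at most 8 d R. Splitting this product as 4 (2 \<eta> R) (d / \<eta>)
  makes the bound linear in R and d, so that it can be integrated.\<close>

lemma abs_diff_le_rms_gap:
  fixes a b R \<eta> :: real
  assumes "R\<^sup>2 = 1/2 * a\<^sup>2 + 1/2 * b\<^sup>2" "R \<ge> 0" "\<eta> > 0"
  shows "\<bar>a - b\<bar> \<le> 2 * \<eta> * R + (R - (a + b) / 2) / \<eta>"
proof -
  define d where "d = R - (a + b) / 2"
  have sq: "(a - b)\<^sup>2 = 4 * (R\<^sup>2 - ((a + b) / 2)\<^sup>2)"
    using assms(1) by (simp add: power2_eq_square algebra_simps)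
  have "0 \<le> 4 * (R\<^sup>2 - ((a + b) / 2)\<^sup>2)" unfolding sq[symmetric] by simp
  then have "((a + b) / 2)\<^sup>2 \<le> R\<^sup>2" by simp
  then have am: "(a + b) / 2 \<le> R" using assms(2) by (rule power2_le_imp_le)
  then have d: "d \<ge> 0" by (simp add: d_def)
  have "R\<^sup>2 - ((a + b) / 2)\<^sup>2 = d * (R + (a + b) / 2)"
    by (simp add: d_def power2_eq_square algebra_simps)
  also have "\<dots> \<le> d * (2 * R)"
    using am d by (intro mult_left_mono) auto
  finally have "(a - b)\<^sup>2 \<le> 4 * (d * (2 * R))" unfolding sq by (rule mult_left_mono) simp
  also have "\<dots> = 4 * (2 * \<eta> * R) * (d / \<eta>)" using assms(3) by simp
  also have "\<dots> \<le> (2 * \<eta> * R + d / \<eta>)\<^sup>2"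
  proof -
    have "4 * x * y \<le> (x + y)\<^sup>2" for x y :: real
      using zero_le_power2[of "x - y"] by (simp add: power2_diff power2_sum)
    then show ?thesis .
  qed
  finally have "\<bar>a - b\<bar>\<^sup>2 \<le> (2 * \<eta> * R + d / \<eta>)\<^sup>2" by simp
  then have "\<bar>a - b\<bar> \<le> 2 * \<eta> * R + d / \<eta>"
    by (rule power2_le_imp_le) (use assms d in simp)
  then show ?thesis by (simp add: d_def)
qed

text \<open>The root is the norm of the plane vector with entries \<open>sqrt l * a\<close> and
  \<open>sqrt c\<close>, so this is the triangle inequality.\<close>

lemma sqrt_Lipschitz:
  assumes "l \<ge> 0" "c \<ge> 0"
  shows "\<bar>sqrt (l * a\<^sup>2 + c) - sqrt (l * b\<^sup>2 + c)\<bar> \<le> sqrt l * \<bar>a - b\<bar>"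
proof -
  have *: "sqrt (l * a\<^sup>2 + c) \<le> sqrt (l * b\<^sup>2 + c) + sqrt l * \<bar>a - b\<bar>" for a b
  proof -
    have "sqrt ((sqrt l * b + sqrt l * (a - b))\<^sup>2 + (sqrt c + 0)\<^sup>2)
        \<le> sqrt ((sqrt l * b)\<^sup>2 + (sqrt c)\<^sup>2) + sqrt ((sqrt l * (a - b))\<^sup>2 + 0\<^sup>2)"
      by (rule real_sqrt_sum_squares_triangle_ineq)
    moreover have "sqrt l * b + sqrt l * (a - b) = sqrt l * a" by (simp add: algebra_simps)
    ultimately show ?thesis using assms by (simp add: power_mult_distrib real_sqrt_mult)
  qed
  show ?thesis using *[of a b] *[of b a] by (simp add: abs_le_iff abs_minus_commute)
qed

section \<open>The reaction functional\<close>

locale sublinear_problem = bounded_open \<Omega> + nonlinearity f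
  for \<Omega> :: "'a::euclidean_space set" and f :: "real \<Rightarrow> real" +
  fixes \<alpha> :: "'a \<Rightarrow> real"
  assumes domain_nonempty: "\<Omega> \<noteq> {}"
    and \<alpha>_Linf: "\<alpha> \<in> Linf \<Omega>"
    and \<alpha>_pos: "AE x in lebesgue_on \<Omega>. \<alpha> x > 0"
begin

lemma \<alpha>_measurable: "\<alpha> \<in> borel_measurable \<mu>"
  using \<alpha>_Linf by (simp add: Linf_def)

definition A :: real where
  "A = (SOME A. A > 0 \<and> (AE x in \<mu>. 0 < \<alpha> x \<and> \<alpha> x \<le> A))"

lemma A_pos: "A > 0" and \<alpha>_bounds: "AE x in \<mu>. 0 < \<alpha> x \<and> \<alpha> x \<le> A"
proof -
  obtain C where C: "AE x in \<mu>. \<bar>\<alpha> x\<bar> \<le> C" using \<alpha>_Linf by (auto simp: Linf_def)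
  have "AE x in \<mu>. 0 < \<alpha> x \<and> \<alpha> x \<le> \<bar>C\<bar> + 1"
    using C \<alpha>_pos by eventually_elim auto
  then have "\<exists>A. A > 0 \<and> (AE x in \<mu>. 0 < \<alpha> x \<and> \<alpha> x \<le> A)"
    by (intro exI[of _ "\<bar>C\<bar> + 1"]) simp
  from someI_ex[OF this, folded A_def] show "A > 0" "AE x in \<mu>. 0 < \<alpha> x \<and> \<alpha> x \<le> A"
    by blast+
qed

lemma \<alpha>_mult_integrable:
  assumes "integrable \<mu> h" shows "integrable \<mu> (\<lambda>x. \<alpha> x * h x)"
proof (rule Bochner_Integration.integrable_bound)
  show "integrable \<mu> (\<lambda>x. A * h x)" using assms by simp
  show "(\<lambda>x. \<alpha> x * h x) \<in> borel_measurable \<mu>"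
    using \<alpha>_measurable assms by measurable
  show "AE x in \<mu>. norm (\<alpha> x * h x) \<le> norm (A * h x)"
    using \<alpha>_bounds by eventually_elim (auto simp: abs_mult intro!: mult_right_mono)
qed

lemma F_measurable:
  assumes "u \<in> borel_measurable \<mu>" shows "(\<lambda>x. F (u x)) \<in> borel_measurable \<mu>"
  by (rule measurable_compose[OF assms borel_measurable_continuous_onI[OF F_continuous]])

lemma f0_measurable:
  assumes "u \<in> borel_measurable \<mu>" shows "(\<lambda>x. f0 (u x)) \<in> borel_measurable \<mu>"
  by (rule measurable_compose[OF assms borel_measurable_continuous_onI[OF f0_continuous]])

lemma F_integrable:
  assumes u: "u \<in> L2 \<Omega>" shows "integrable \<mu> (\<lambda>x. F (u x))"
proof -
  obtain C where C: "C \<ge> 0" "\<And>s. s \<ge> 0 \<Longrightarrow> f s \<le> C + 1 * s" using f_growth[of 1] by auto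
  show ?thesis
  proof (rule Bochner_Integration.integrable_bound)
    show "integrable \<mu> (\<lambda>x. C * \<bar>u x\<bar> + (u x)\<^sup>2)"
      using L2_abs[OF u] L2_square[OF u] by simp
    show "(\<lambda>x. F (u x)) \<in> borel_measurable \<mu>"
      by (rule F_measurable[OF L2_measurable[OF u]])
    have "norm (F y) \<le> norm (C * \<bar>y\<bar> + y\<^sup>2)" for y
      using F_Lipschitz[OF _ C, of y 0] C(1) by (simp add: F_nonpos algebra_simps power2_eq_square)
    then show "AE x in \<mu>. norm (F (u x)) \<le> norm (C * \<bar>u x\<bar> + (u x)\<^sup>2)" by simp
  qed
qed

definition G :: "('a \<Rightarrow> real) \<Rightarrow> real" where
  "G u = (LINT x|\<mu>. \<alpha> x * F (u x))"

lemma G_integrable: "u \<in> L2 \<Omega> \<Longrightarrow> integrable \<mu> (\<lambda>x. \<alpha> x * F (u x))"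
  by (intro \<alpha>_mult_integrable F_integrable)

lemma energy_eq: "energy \<Omega> \<kappa> \<alpha> f u = 1/2 * \<kappa> * gip u u - G u"
  by (simp add: energy_def G_def F_def dirichlet_gip)

lemma G_mono:
  assumes "u \<in> L2 \<Omega>" "v \<in> L2 \<Omega>" "AE x in \<mu>. u x \<le> v x"
  shows "G u \<le> G v"
  unfolding G_def
proof (rule integral_mono_AE[OF G_integrable G_integrable])
  show "AE x in \<mu>. \<alpha> x * F (u x) \<le> \<alpha> x * F (v x)"
    using assms(3) \<alpha>_pos by eventually_elim (simp add: F_mono)
qed (use assms in auto)

lemma G_nonneg: "0 \<le> G u"
  unfolding G_def
  by (rule integral_nonneg_AE, use \<alpha>_pos in eventually_elim) (simp add: F_nonneg)

lemma G_diff_bound: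
  assumes u: "u \<in> L2 \<Omega>" and v: "v \<in> L2 \<Omega>" and e: "e \<ge> 0" and C: "C \<ge> 0" "\<And>s. s \<ge> 0 \<Longrightarrow> f s \<le> C + e * s"
  shows "\<bar>G u - G v\<bar> \<le> A * (C * (LINT x|\<mu>. \<bar>u x - v x\<bar>) + e * (2 * ip u u + 2 * ip v v))"
proof -
  note uv = L2_diff[OF u v]
  have int: "integrable \<mu> (\<lambda>x. A * (C * \<bar>u x - v x\<bar> + e * (2 * (u x)\<^sup>2 + 2 * (v x)\<^sup>2)))"
    using L2_abs[OF uv] L2_square[OF u] L2_square[OF v] by simp
  have pt: "\<bar>F a - F b\<bar> \<le> C * \<bar>a - b\<bar> + e * (2 * a\<^sup>2 + 2 * b\<^sup>2)" for a b
  proof -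
    have "\<bar>a - b\<bar> * (\<bar>a\<bar> + \<bar>b\<bar>) \<le> (\<bar>a\<bar> + \<bar>b\<bar>) * (\<bar>a\<bar> + \<bar>b\<bar>)"
      by (intro mult_right_mono) auto
    also have "\<dots> \<le> 2 * a\<^sup>2 + 2 * b\<^sup>2"
      using zero_le_power2[of "\<bar>a\<bar> - \<bar>b\<bar>"] by (simp add: power2_eq_square algebra_simps)
    finally have "e * (\<bar>a - b\<bar> * (\<bar>a\<bar> + \<bar>b\<bar>)) \<le> e * (2 * a\<^sup>2 + 2 * b\<^sup>2)"
      using e by (rule mult_left_mono)
    moreover have "\<bar>a - b\<bar> * (C + e * (\<bar>a\<bar> + \<bar>b\<bar>)) = C * \<bar>a - b\<bar> + e * (\<bar>a - b\<bar> * (\<bar>a\<bar> + \<bar>b\<bar>))"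
      by (simp add: algebra_simps)
    ultimately show ?thesis using F_Lipschitz[OF e C, of a b] by linarith
  qed
  have "\<bar>G u - G v\<bar> = \<bar>LINT x|\<mu>. \<alpha> x * F (u x) - \<alpha> x * F (v x)\<bar>"
    by (simp add: G_def G_integrable u v)
  also have "\<dots> \<le> (LINT x|\<mu>. \<bar>\<alpha> x * F (u x) - \<alpha> x * F (v x)\<bar>)"
    by (rule integral_abs_bound)
  also have "\<dots> \<le> (LINT x|\<mu>. A * (C * \<bar>u x - v x\<bar> + e * (2 * (u x)\<^sup>2 + 2 * (v x)\<^sup>2)))"
  proof (rule integral_mono_AE[OF _ int])
    show "integrable \<mu> (\<lambda>x. \<bar>\<alpha> x * F (u x) - \<alpha> x * F (v x)\<bar>)"
      using G_integrable[OF u] G_integrable[OF v] by auto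
    show "AE x in \<mu>. \<bar>\<alpha> x * F (u x) - \<alpha> x * F (v x)\<bar> \<le> A * (C * \<bar>u x - v x\<bar> + e * (2 * (u x)\<^sup>2 + 2 * (v x)\<^sup>2))"
      using \<alpha>_bounds
    proof eventually_elim
      case (elim x)
      have "\<bar>\<alpha> x * F (u x) - \<alpha> x * F (v x)\<bar> = \<alpha> x * \<bar>F (u x) - F (v x)\<bar>"
        using elim by (simp add: abs_mult flip: right_diff_distrib)
      also have "\<dots> \<le> A * (C * \<bar>u x - v x\<bar> + e * (2 * (u x)\<^sup>2 + 2 * (v x)\<^sup>2))"
        using elim pt by (intro mult_mono) auto
      finally show ?case .
    qed
  qed
  also have "\<dots> = A * (C * (LINT x|\<mu>. \<bar>u x - v x\<bar>) + e * (2 * ip u u + 2 * ip v v))"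
    using L2_abs[OF uv] L2_square[OF u] L2_square[OF v] by (simp add: ip_real)
  finally show ?thesis .
qed

text \<open>On L2 bounded sets, closeness in L1 suffices. In \<open>G_diff_bound\<close> the L2
  norms carry the factor e, which is chosen first to suit B; this fixes C, and the L1 distance is
  then made small enough for C.\<close>

lemma G_uniformly_continuous:
  assumes \<epsilon>: "\<epsilon> > 0"
  shows "\<exists>\<delta>>0. \<forall>w\<in>L2 \<Omega>. \<forall>v\<in>L2 \<Omega>. ip w w \<le> B \<longrightarrow> ip v v \<le> B \<longrightarrow>
    (LINT x|\<mu>. \<bar>w x - v x\<bar>) < \<delta> \<longrightarrow> \<bar>G w - G v\<bar> < \<epsilon>"
proof -
  \<comment> \<open>D exceeds the bracket multiplying e, so that the two terms of the bound
    contribute \<epsilon> / 2 each.\<close>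
  define D where "D = 4 * \<bar>B\<bar> + 1"
  have D: "D > 0" by (simp add: D_def)
  define e where "e = \<epsilon> / (2 * A * D)"
  have e: "e > 0" using \<epsilon> D A_pos by (simp add: e_def)
  have AeD: "A * (e * D) = \<epsilon> / 2" using A_pos D by (simp add: e_def)
  obtain C where C: "C \<ge> 0" "\<And>s. s \<ge> 0 \<Longrightarrow> f s \<le> C + e * s" using f_growth[OF e] by metis
  define \<delta> where "\<delta> = \<epsilon> / (2 * A * (C + 1))"
  have \<delta>: "\<delta> > 0" using \<epsilon> A_pos C(1) by (simp add: \<delta>_def)
  have AC: "A * ((C + 1) * \<delta>) = \<epsilon> / 2" using A_pos C(1) by (simp add: \<delta>_def)
  have "\<bar>G w - G v\<bar> < \<epsilon>"
    if w: "w \<in> L2 \<Omega>" "v \<in> L2 \<Omega>" "ip w w \<le> B" "ip v v \<le> B" and L: "(LINT x|\<mu>. \<bar>w x - v x\<bar>) < \<delta>" for w v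
  proof -
    have "\<bar>G w - G v\<bar> \<le> A * (C * (LINT x|\<mu>. \<bar>w x - v x\<bar>) + e * (2 * ip w w + 2 * ip v v))"
      using G_diff_bound[OF w(1,2) _ C] e by simp
    also have "\<dots> \<le> A * (C * (LINT x|\<mu>. \<bar>w x - v x\<bar>) + e * D)"
      using w(3,4) e A_pos by (intro mult_left_mono add_left_mono) (auto simp: D_def)
    also have "\<dots> < A * ((C + 1) * \<delta> + e * D)"
    proof (intro mult_strict_left_mono add_strict_right_mono A_pos)
      have "C * (LINT x|\<mu>. \<bar>w x - v x\<bar>) \<le> C * \<delta>" using L C(1) by (intro mult_left_mono) auto
      also have "\<dots> < (C + 1) * \<delta>" using \<delta> by simp
      finally show "C * (LINT x|\<mu>. \<bar>w x - v x\<bar>) < (C + 1) * \<delta>" .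
    qed
    also have "\<dots> = \<epsilon>" using AeD AC by (simp add: distrib_left)
    finally show ?thesis .
  qed
  then show ?thesis using \<delta> by blast
qed

lemma G_tendsto:
  assumes w: "\<And>n. w n \<in> L2 \<Omega>" and v: "v \<in> L2 \<Omega>"
    and L1: "(\<lambda>n. LINT x|\<mu>. \<bar>w n x - v x\<bar>) \<longlonglongrightarrow> 0" and B: "\<And>n. ip (w n) (w n) \<le> B"
  shows "(\<lambda>n. G (w n)) \<longlonglongrightarrow> G v"
proof (rule LIMSEQ_I)
  fix \<epsilon> :: real assume "\<epsilon> > 0"
  from G_uniformly_continuous[OF this, of "max B (ip v v)"]
  obtain \<delta> where \<delta>: "\<delta> > 0" "\<forall>w\<in>L2 \<Omega>. \<forall>v'\<in>L2 \<Omega>. ip w w \<le> max B (ip v v) \<longrightarrow> ip v' v' \<le> max B (ip v v) \<longrightarrow>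
      (LINT x|\<mu>. \<bar>w x - v' x\<bar>) < \<delta> \<longrightarrow> \<bar>G w - G v'\<bar> < \<epsilon>"
    by blast
  obtain N where N: "\<And>n. n \<ge> N \<Longrightarrow> (LINT x|\<mu>. \<bar>w n x - v x\<bar>) < \<delta>"
    using order_tendstoD(2)[OF L1 \<delta>(1)] by (auto simp: eventually_sequentially)
  have "\<bar>G (w n) - G v\<bar> < \<epsilon>" if "n \<ge> N" for n
    using \<delta>(2)[rule_format, OF w v _ _ N[OF that]] B[of n] by simp
  then show "\<exists>N. \<forall>n\<ge>N. norm (G (w n) - G v) < \<epsilon>" by auto
qed

lemma G_tendsto_L2:
  assumes "L2_tendsto w v"
  shows "(\<lambda>n. G (w n)) \<longlonglongrightarrow> G v"
proof -
  have L: "w n \<in> L2 \<Omega>" "v \<in> L2 \<Omega>" for n using assms by (auto simp: L2_tendsto_def)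
  obtain B where "\<And>n. ip (w n) (w n) \<le> B" using L2_tendsto_bounded[OF assms] by metis
  then show ?thesis
    using L2_tendsto_L1[OF assms] by (intro G_tendsto[OF L]) simp_all
qed

text \<open>The supremum runs over test functions because quadratic means are formed there; the
  passage to \<open>H10\<close> takes place in \<open>minimiser\<close>.\<close>

definition M :: "real \<Rightarrow> real" where
  "M t = Sup (G ` {\<phi> \<in> TF. E \<phi> \<le> t})"

lemma M_bdd: "bdd_above (G ` {\<phi> \<in> TF. E \<phi> \<le> t})"
proof -
  obtain C where C: "C \<ge> 0" "\<And>s. s \<ge> 0 \<Longrightarrow> f s \<le> C + 1 * s" using f_growth[of 1] by auto
  have "G \<phi> \<le> G (\<lambda>x. 0) + A * (C * (sqrt (CP * t) * sqrt (measure \<mu> \<Omega>)) + 2 * (CP * t))"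
    if \<phi>: "\<phi> \<in> TF" "E \<phi> \<le> t" for \<phi>
  proof -
    have "\<bar>G \<phi> - G (\<lambda>x. 0)\<bar> \<le> A * (C * (LINT x|\<mu>. \<bar>\<phi> x\<bar>) + 2 * ip \<phi> \<phi>)"
      using G_diff_bound[OF test_L2(1)[OF \<phi>(1)] L2_const[of 0] _ C] by (simp add: ip_def)
    also have "\<dots> \<le> A * (C * (sqrt (CP * t) * sqrt (measure \<mu> \<Omega>)) + 2 * (CP * t))"
      using integral_test_le[OF \<phi>] CP_le[OF \<phi>] A_pos C(1)
      by (intro mult_left_mono add_mono) auto
    finally show ?thesis by linarith
  qed
  then show ?thesis by (auto intro!: bdd_aboveI2)
qed

lemma G_le_M: "\<phi> \<in> TF \<Longrightarrow> E \<phi> \<le> t \<Longrightarrow> G \<phi> \<le> M t"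
  unfolding M_def by (rule cSup_upper[OF _ M_bdd]) auto

lemma M_approx:
  assumes "t \<ge> 0" and "d > 0"
  obtains \<phi> where "\<phi> \<in> TF" "E \<phi> \<le> t" "M t - d < G \<phi>"
proof -
  have "(\<lambda>x. 0) \<in> {\<phi> \<in> TF. E \<phi> \<le> t}" using zero_test E_zero assms by simp
  then have "G ` {\<phi> \<in> TF. E \<phi> \<le> t} \<noteq> {}" by blast
  moreover have "M t - d < Sup (G ` {\<phi> \<in> TF. E \<phi> \<le> t})" using assms by (simp add: M_def)
  ultimately obtain y where "y \<in> G ` {\<phi> \<in> TF. E \<phi> \<le> t}" "M t - d < y"
    using less_cSupE by blast
  then show ?thesis using that by blast
qed

lemma M_nonneg: "t \<ge> 0 \<Longrightarrow> 0 \<le> M t"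
  using G_le_M[OF zero_test, of t] G_nonneg[of "\<lambda>x. 0"] by (simp add: E_zero)

text \<open>The regularisation is removed while the first argument converges, and u may be a mere L2
  function. The error is at most the regularisation parameter plus \<open>sqrt l\<close> times the
  distance of the arguments, hence small in L1, and the uniform Poincare bound turns this into
  convergence of G.\<close>

lemma rms_tendsto:
  fixes \<phi> :: "nat \<Rightarrow> 'a \<Rightarrow> real"
  assumes \<phi>: "\<And>n. \<phi> n \<in> TF" "\<And>n. E (\<phi> n) \<le> t" and u: "u \<in> L2 \<Omega>"
    and L1: "(\<lambda>n. LINT x|\<mu>. \<bar>\<phi> n x - u x\<bar>) \<longlonglongrightarrow> 0"
    and \<psi>: "\<psi> \<in> TF" and lm: "l \<ge> 0" "m \<ge> 0"
  defines "z \<equiv> \<lambda>n. rms l m (inverse (real (Suc n))) (\<phi> n) \<psi>" and "R \<equiv> \<lambda>x. sqrt (l * (u x)\<^sup>2 + m * (\<psi> x)\<^sup>2)"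
  shows "R \<in> L2 \<Omega>" and "(\<lambda>n. LINT x|\<mu>. \<bar>z n x - R x\<bar>) \<longlonglongrightarrow> 0" and "(\<lambda>n. G (z n)) \<longlonglongrightarrow> G R"
proof -
  have e: "inverse (real (Suc n)) > 0" for n by simp
  have z: "z n \<in> TF" "E (z n) \<le> l * E (\<phi> n) + m * E \<psi>" for n
    unfolding z_def using rms_test[OF \<phi>(1) \<psi> lm e] by blast+
  have zL: "z n \<in> L2 \<Omega>" for n by (rule test_L2(1)[OF z(1)])
  show R: "R \<in> L2 \<Omega>"
  proof (rule L2_dominated)
    show "(\<lambda>x. sqrt l * \<bar>u x\<bar> + sqrt m * \<bar>\<psi> x\<bar>) \<in> L2 \<Omega>"
      using L2_norm[OF u] L2_norm[OF test_L2(1)[OF \<psi>]] by (intro L2_add L2_cmult) auto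
    show "R \<in> borel_measurable \<mu>"
      unfolding R_def using L2_measurable[OF u] L2_measurable[OF test_L2(1)[OF \<psi>]] by measurable
    have "norm (R x) \<le> norm (sqrt l * \<bar>u x\<bar> + sqrt m * \<bar>\<psi> x\<bar>)" for x
      using sqrt_add_le_add_sqrt[of "l * (u x)\<^sup>2" "m * (\<psi> x)\<^sup>2"] lm
      by (simp add: R_def real_sqrt_mult)
    then show "AE x in \<mu>. norm (R x) \<le> norm (sqrt l * \<bar>u x\<bar> + sqrt m * \<bar>\<psi> x\<bar>)" by simp
  qed
  show zR: "(\<lambda>n. LINT x|\<mu>. \<bar>z n x - R x\<bar>) \<longlonglongrightarrow> 0"
  proof (rule LIMSEQ_null_squeeze)
    have "(\<lambda>n. inverse (real (Suc n)) * measure \<mu> \<Omega> + sqrt l * (LINT x|\<mu>. \<bar>\<phi> n x - u x\<bar>))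
       \<longlonglongrightarrow> 0 * measure \<mu> \<Omega> + sqrt l * 0"
      by (intro tendsto_intros L1 LIMSEQ_inverse_real_of_nat)
    then show "(\<lambda>n. inverse (real (Suc n)) * measure \<mu> \<Omega> + sqrt l * (LINT x|\<mu>. \<bar>\<phi> n x - u x\<bar>)) \<longlonglongrightarrow> 0"
      by simp
    fix n
    show "0 \<le> (LINT x|\<mu>. \<bar>z n x - R x\<bar>)" by simp
    note d = L2_abs[OF L2_diff[OF test_L2(1)[OF \<phi>(1)[of n]] u]]
    have c: "integrable \<mu> (\<lambda>x. inverse (real (Suc n)))" by (rule L2_integrable[OF L2_const])
    have "(LINT x|\<mu>. \<bar>z n x - R x\<bar>) \<le> (LINT x|\<mu>. inverse (real (Suc n)) + sqrt l * \<bar>\<phi> n x - u x\<bar>)"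
    proof (rule integral_mono[OF L2_abs[OF L2_diff[OF zL R]]])
      show "integrable \<mu> (\<lambda>x. inverse (real (Suc n)) + sqrt l * \<bar>\<phi> n x - u x\<bar>)" using c d by simp
      fix x
      show "\<bar>z n x - R x\<bar> \<le> inverse (real (Suc n)) + sqrt l * \<bar>\<phi> n x - u x\<bar>"
        using rms_error[OF lm e[of n], of "\<phi> n" \<psi> x]
          sqrt_Lipschitz[OF lm(1) mult_nonneg_nonneg[OF lm(2) zero_le_power2], of "\<phi> n x" "\<psi> x" "u x"]
        unfolding z_def R_def by linarith
    qed
    also have "\<dots> = inverse (real (Suc n)) * measure \<mu> \<Omega> + sqrt l * (LINT x|\<mu>. \<bar>\<phi> n x - u x\<bar>)"
      using c d by (simp add: space_restrict_space mult.commute)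
    finally show "(LINT x|\<mu>. \<bar>z n x - R x\<bar>) \<le> inverse (real (Suc n)) * measure \<mu> \<Omega> + sqrt l * (LINT x|\<mu>. \<bar>\<phi> n x - u x\<bar>)" .
  qed
  show "(\<lambda>n. G (z n)) \<longlonglongrightarrow> G R"
  proof (rule G_tendsto[OF zL R zR])
    fix n
    have "l * E (\<phi> n) \<le> l * t" using \<phi>(2) lm(1) by (rule mult_left_mono)
    then show "ip (z n) (z n) \<le> CP * (l * t + m * E \<psi>)"
      using z(2)[of n] by (intro CP_le z(1)) linarith
  qed
qed

lemma G_rms:
  assumes u: "u \<in> L2 \<Omega>" and v: "v \<in> L2 \<Omega>" and R: "(\<lambda>x. sqrt (l * (u x)\<^sup>2 + m * (v x)\<^sup>2)) \<in> L2 \<Omega>"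
    and lm: "l \<ge> 0" "m \<ge> 0" "l + m = 1"
  shows "l * G u + m * G v \<le> G (\<lambda>x. sqrt (l * (u x)\<^sup>2 + m * (v x)\<^sup>2))"
proof -
  have "l * G u + m * G v = (LINT x|\<mu>. l * (\<alpha> x * F (u x)) + m * (\<alpha> x * F (v x)))"
    using G_integrable[OF u] G_integrable[OF v] by (simp add: G_def)
  also have "\<dots> \<le> G (\<lambda>x. sqrt (l * (u x)\<^sup>2 + m * (v x)\<^sup>2))"
    unfolding G_def
  proof (rule integral_mono_AE[OF _ G_integrable[OF R]])
    show "integrable \<mu> (\<lambda>x. l * (\<alpha> x * F (u x)) + m * (\<alpha> x * F (v x)))"
      using G_integrable[OF u] G_integrable[OF v] by simp
    show "AE x in \<mu>. l * (\<alpha> x * F (u x)) + m * (\<alpha> x * F (v x)) \<le> \<alpha> x * F (sqrt (l * (u x)\<^sup>2 + m * (v x)\<^sup>2))"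
      using \<alpha>_pos
    proof eventually_elim
      case (elim x)
      then have "\<alpha> x * (l * F (u x) + m * F (v x)) \<le> \<alpha> x * F (sqrt (l * (u x)\<^sup>2 + m * (v x)\<^sup>2))"
        by (intro mult_left_mono F_rms lm) auto
      then show ?case by (simp add: algebra_simps)
    qed
  qed
  finally show ?thesis .
qed

text \<open>The regularised mean of near maximisers at levels x and y is admissible at the combined
  level by \<open>rms_test\<close>, and by \<open>G_rms\<close> its value is, in the limit, at least
  the combination of the two values.\<close>

lemma M_concave: "concave_on {0..} M"
  unfolding concave_on_def
proof (rule convex_onI)
  fix s x y :: real
  assume s: "0 < s" "s < 1" and xy: "x \<in> {0..}" "y \<in> {0..}"
  have "(1 - s) * M x + s * M y \<le> M ((1 - s) * x + s * y) + d" if d: "d > 0" for d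
  proof -
    obtain \<phi> where \<phi>: "\<phi> \<in> TF" "E \<phi> \<le> x" "M x - d < G \<phi>" using M_approx[of x d] xy d by auto
    obtain \<psi> where \<psi>: "\<psi> \<in> TF" "E \<psi> \<le> y" "M y - d < G \<psi>" using M_approx[of y d] xy d by auto
    have L: "(\<lambda>n. LINT x|\<mu>. \<bar>\<phi> x - \<phi> x\<bar>) \<longlonglongrightarrow> 0" by simp
    have lm: "0 \<le> 1 - s" "0 \<le> s" "1 - s + s = 1" using s by auto
    note lim = rms_tendsto[of "\<lambda>n. \<phi>", OF \<phi>(1,2) test_L2(1)[OF \<phi>(1)] L \<psi>(1) lm(1,2)]
    have "G (rms (1 - s) s (inverse (real (Suc n))) \<phi> \<psi>) \<le> M ((1 - s) * x + s * y)" for n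
    proof (rule G_le_M)
      have e: "inverse (real (Suc n)) > 0" by simp
      show "rms (1 - s) s (inverse (real (Suc n))) \<phi> \<psi> \<in> TF"
        by (rule rms_test(1)[OF \<phi>(1) \<psi>(1) lm(1,2) e])
      have "(1 - s) * E \<phi> + s * E \<psi> \<le> (1 - s) * x + s * y"
        using \<phi>(2) \<psi>(2) lm by (intro add_mono mult_left_mono) auto
      then show "E (rms (1 - s) s (inverse (real (Suc n))) \<phi> \<psi>) \<le> (1 - s) * x + s * y"
        using rms_test(2)[OF \<phi>(1) \<psi>(1) lm(1,2) e] by linarith
    qed
    then have "G (\<lambda>x. sqrt ((1 - s) * (\<phi> x)\<^sup>2 + s * (\<psi> x)\<^sup>2)) \<le> M ((1 - s) * x + s * y)"
      by (intro LIMSEQ_le_const2[OF lim(3)]) auto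
    then have "(1 - s) * G \<phi> + s * G \<psi> \<le> M ((1 - s) * x + s * y)"
      using G_rms[OF test_L2(1)[OF \<phi>(1)] test_L2(1)[OF \<psi>(1)] lim(1) lm] by linarith
    moreover have "(1 - s) * M x + s * M y \<le> (1 - s) * (G \<phi> + d) + s * (G \<psi> + d)"
      using \<phi>(3) \<psi>(3) lm by (intro add_mono mult_left_mono) auto
    moreover have "(1 - s) * (G \<phi> + d) + s * (G \<psi> + d) = (1 - s) * G \<phi> + s * G \<psi> + d"
      by (simp add: algebra_simps)
    ultimately show ?thesis by linarith
  qed
  then have "(1 - s) * M x + s * M y \<le> M ((1 - s) * x + s * y)"
    by (rule field_le_epsilon)
  then show "- M ((1 - s) *\<^sub>R x + s *\<^sub>R y) \<le> (1 - s) * - M x + s * - M y"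
    by simp
qed simp

text \<open>Among nearly maximising nonnegative test functions, those that nearly maximise the integral form an \<open>L\<^sup>1\<close>
  Cauchy sequence, because quadratic means of such functions are again admissible.\<close>

lemma maximising_sequence:
  assumes t: "t \<ge> 0"
  shows "\<exists>\<psi> u. (\<forall>n. \<psi> n \<in> TF) \<and> (\<forall>n. E (\<psi> n) \<le> t) \<and> (\<forall>n x. 0 \<le> \<psi> n x) \<and> (\<lambda>n. G (\<psi> n)) \<longlonglongrightarrow> M t \<and>
    u \<in> L2 \<Omega> \<and> (\<lambda>n. LINT x|\<mu>. \<bar>\<psi> n x - u x\<bar>) \<longlonglongrightarrow> 0"
proof -
  define S where "S \<phi> = (LINT x|\<mu>. \<phi> x)" for \<phi> :: "'a \<Rightarrow> real"
  define Ad where "Ad d = {\<phi> \<in> TF. E \<phi> \<le> t \<and> (\<forall>x. 0 \<le> \<phi> x) \<and> M t - d < G \<phi>}" for d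
  define B where "B = sqrt (CP * t) * sqrt (measure \<mu> \<Omega>)"
  have B0: "B \<ge> 0" using CP_pos t by (simp add: B_def)
  define sg where "sg d = Sup (S ` Ad d)" for d
  have Ad_L2: "\<phi> \<in> L2 \<Omega>" if "\<phi> \<in> Ad d" for \<phi> d using that test_L2 by (auto simp: Ad_def)
  \<comment> \<open>Nonnegativity is achieved by the smoothed absolute value. Since F vanishes on
    negative numbers, the absolute value does not decrease G, and a small regularisation keeps the
    strict inequality.\<close>
  have Ad_ne: "Ad d \<noteq> {}" if d: "d > 0" for d
  proof -
    obtain \<phi> where \<phi>: "\<phi> \<in> TF" "E \<phi> \<le> t" "M t - d < G \<phi>" using M_approx[OF t d] by metis
    have L: "(\<lambda>n. LINT x|\<mu>. \<bar>\<phi> x - \<phi> x\<bar>) \<longlonglongrightarrow> 0" by simp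
    have lm: "(0::real) \<le> 1" "(0::real) \<le> 0" by auto
    note lim = rms_tendsto[of "\<lambda>n. \<phi>", OF \<phi>(1,2) test_L2(1)[OF \<phi>(1)] L \<phi>(1) lm]
    have "G \<phi> \<le> G (\<lambda>x. sqrt (1 * (\<phi> x)\<^sup>2 + 0 * (\<phi> x)\<^sup>2))"
      by (rule G_mono[OF test_L2(1)[OF \<phi>(1)] lim(1)]) simp
    then have "M t - d < G (\<lambda>x. sqrt (1 * (\<phi> x)\<^sup>2 + 0 * (\<phi> x)\<^sup>2))" using \<phi>(3) by linarith
    from order_tendstoD(1)[OF lim(3) this]
    obtain n where n: "M t - d < G (rms 1 0 (inverse (real (Suc n))) \<phi> \<phi>)"
      by (auto simp: eventually_sequentially)
    have e: "inverse (real (Suc n)) > 0" by simp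
    have "rms 1 0 (inverse (real (Suc n))) \<phi> \<phi> \<in> Ad d"
      using rms_test[OF \<phi>(1) \<phi>(1) lm e] rms_nonneg[OF lm e] n \<phi>(2) by (auto simp: Ad_def)
    then show ?thesis by blast
  qed
  have S_nonneg: "0 \<le> S \<phi>" if "\<phi> \<in> Ad d" for \<phi> d
    using that unfolding S_def Ad_def by (intro Bochner_Integration.integral_nonneg) auto
  have S_le: "S \<phi> \<le> B" if "\<phi> \<in> Ad d" for \<phi> d
    using integral_test_le[of \<phi> t] that by (simp add: S_def Ad_def B_def)
  have bdd: "bdd_above (S ` Ad d)" for d
    using S_le by (auto intro!: bdd_aboveI2)
  have S_sg: "S \<phi> \<le> sg d" if "\<phi> \<in> Ad d" for \<phi> d
    unfolding sg_def using that by (intro cSup_upper[OF _ bdd]) auto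
  have sg_nonneg: "0 \<le> sg d" if "d > 0" for d
    using Ad_ne[OF that] S_sg S_nonneg by (meson equals0I order_trans)
  have sg_le: "sg d \<le> B" if "d > 0" for d
    unfolding sg_def using Ad_ne[OF that] S_le by (intro cSup_least) auto
  \<comment> \<open>The unregularised mean need not be smooth, so it is not itself in
    \<open>Ad d\<close>; its integral is bounded as the limit of integrals of regularised means,
    which eventually are in \<open>Ad d\<close>.\<close>
  have mean: "(\<lambda>x. sqrt (1/2 * (\<phi> x)\<^sup>2 + 1/2 * (\<psi> x)\<^sup>2)) \<in> L2 \<Omega>" "S (\<lambda>x. sqrt (1/2 * (\<phi> x)\<^sup>2 + 1/2 * (\<psi> x)\<^sup>2)) \<le> sg d"
    if \<phi>: "\<phi> \<in> Ad d" and \<psi>: "\<psi> \<in> Ad d" for \<phi> \<psi> d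
  proof -
    have T: "\<phi> \<in> TF" "E \<phi> \<le> t" "M t - d < G \<phi>" "\<psi> \<in> TF" "E \<psi> \<le> t" "M t - d < G \<psi>"
      using \<phi> \<psi> by (auto simp: Ad_def)
    have L: "(\<lambda>n. LINT x|\<mu>. \<bar>\<phi> x - \<phi> x\<bar>) \<longlonglongrightarrow> 0" by simp
    have lm: "(0::real) \<le> 1/2" "(0::real) \<le> 1/2" "(1/2::real) + 1/2 = 1" by auto
    let ?R = "\<lambda>x. sqrt (1/2 * (\<phi> x)\<^sup>2 + 1/2 * (\<psi> x)\<^sup>2)"
    let ?z = "\<lambda>n. rms (1/2) (1/2) (inverse (real (Suc n))) \<phi> \<psi>"
    note lim = rms_tendsto[of "\<lambda>n. \<phi>", OF T(1,2) test_L2(1)[OF T(1)] L T(4) lm(1,2)]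
    show R: "?R \<in> L2 \<Omega>" by (rule lim(1))
    have "1/2 * G \<phi> + 1/2 * G \<psi> \<le> G ?R"
      by (rule G_rms[OF test_L2(1)[OF T(1)] test_L2(1)[OF T(4)] R lm])
    then have "M t - d < G ?R" using T(3,6) by linarith
    from order_tendstoD(1)[OF lim(3) this]
    have ev: "eventually (\<lambda>n. ?z n \<in> Ad d) sequentially"
    proof eventually_elim
      case (elim n)
      have e: "inverse (real (Suc n)) > 0" by simp
      have "E (?z n) \<le> t"
        using rms_test(2)[OF T(1,4) lm(1,2) e] T(2,5) by linarith
      then show ?case
        using rms_test(1)[OF T(1,4) lm(1,2) e] rms_nonneg[OF lm(1,2) e] elim by (auto simp: Ad_def)
    qed
    have zL: "?z n \<in> L2 \<Omega>" for n
      by (rule test_L2(1)[OF rms_test(1)[OF T(1,4) lm(1,2)]]) simp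
    have "(\<lambda>n. S (?z n) - S ?R) \<longlonglongrightarrow> 0"
    proof (rule Lim_null_comparison[OF _ lim(2)])
      have "\<bar>S (?z n) - S ?R\<bar> \<le> (LINT x|\<mu>. \<bar>?z n x - ?R x\<bar>)" for n
        unfolding S_def Bochner_Integration.integral_diff[OF L2_integrable[OF zL] L2_integrable[OF R], symmetric]
        by (rule integral_abs_bound)
      then show "eventually (\<lambda>n. norm (S (?z n) - S ?R) \<le> (LINT x|\<mu>. \<bar>?z n x - ?R x\<bar>)) sequentially"
        by simp
    qed
    then have "(\<lambda>n. S (?z n)) \<longlonglongrightarrow> S ?R" by (simp add: LIM_zero_iff)
    then show "S ?R \<le> sg d"
      by (rule tendsto_upperbound[OF _ eventually_mono[OF ev S_sg]]) auto
  qed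
  define d where "d n = inverse (real (Suc n))" for n
  have d: "d n > 0" for n by (simp add: d_def)
  have dlim: "d \<longlonglongrightarrow> 0" using LIMSEQ_inverse_real_of_nat by (simp add: d_def[abs_def])
  have ddec: "d n \<le> d m" if "m \<le> n" for m n using that by (simp add: d_def field_simps)
  have Ad_mono: "Ad (d n) \<subseteq> Ad (d m)" if "m \<le> n" for m n
    using ddec[OF that] by (auto simp: Ad_def)
  have "decseq (\<lambda>n. sg (d n))"
    unfolding sg_def decseq_def by (intro allI impI cSup_subset_mono bdd image_mono Ad_mono) (use Ad_ne d in auto)
  then obtain L where L: "(\<lambda>n. sg (d n)) \<longlonglongrightarrow> L" "\<And>i. L \<le> sg (d i)"
    using decseq_convergent[of "\<lambda>n. sg (d n)" 0] sg_nonneg d by metis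
  have "\<exists>\<phi>\<in>Ad (d n). sg (d n) - d n < S \<phi>" for n
  proof -
    have "sg (d n) - d n < Sup (S ` Ad (d n))" using d[of n] by (simp add: sg_def)
    moreover have "S ` Ad (d n) \<noteq> {}" using Ad_ne[OF d, of n] by simp
    ultimately obtain y where "y \<in> S ` Ad (d n)" "sg (d n) - d n < y"
      by (rule less_cSupE)
    then show ?thesis by blast
  qed
  then obtain \<psi> where \<psi>: "\<And>n. \<psi> n \<in> Ad (d n)" "\<And>n. sg (d n) - d n < S (\<psi> n)" by metis
  have T: "\<psi> n \<in> TF" "E (\<psi> n) \<le> t" "0 \<le> \<psi> n x" "M t - d n < G (\<psi> n)" for n x
    using \<psi>(1)[of n] by (auto simp: Ad_def)
  have L2: "\<psi> n \<in> L2 \<Omega>" for n by (rule test_L2(1)[OF T(1)])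
  \<comment> \<open>The mean has integral at most \<open>sg (d N)\<close>, while both members have
    integral at least \<open>L - d N\<close>. So the gap between the quadratic and the arithmetic
    mean has small integral, and \<open>abs_diff_le_rms_gap\<close> turns this into a small
    distance.\<close>
  have est: "(LINT x|\<mu>. \<bar>\<psi> m x - \<psi> n x\<bar>) \<le> 2 * \<eta> * B + (sg (d N) - L + d N) / \<eta>"
    if mn: "m \<ge> N" "n \<ge> N" and \<eta>: "\<eta> > 0" for m n N \<eta>
  proof -
    let ?R = "\<lambda>x. sqrt (1/2 * (\<psi> m x)\<^sup>2 + 1/2 * (\<psi> n x)\<^sup>2)"
    have A: "\<psi> m \<in> Ad (d N)" "\<psi> n \<in> Ad (d N)" using \<psi>(1) Ad_mono mn by blast+
    note R = mean[OF A]
    note iR = L2_integrable[OF R(1)] and im = L2_integrable[OF L2, of m] and ii = L2_integrable[OF L2, of n]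
    have "(LINT x|\<mu>. \<bar>\<psi> m x - \<psi> n x\<bar>) \<le> (LINT x|\<mu>. 2 * \<eta> * ?R x + (?R x - (\<psi> m x + \<psi> n x) / 2) / \<eta>)"
    proof (rule integral_mono[OF L2_abs[OF L2_diff[OF L2 L2]]])
      show "integrable \<mu> (\<lambda>x. 2 * \<eta> * ?R x + (?R x - (\<psi> m x + \<psi> n x) / 2) / \<eta>)"
        using iR im ii by simp
      show "\<bar>\<psi> m x - \<psi> n x\<bar> \<le> 2 * \<eta> * ?R x + (?R x - (\<psi> m x + \<psi> n x) / 2) / \<eta>" for x
        by (rule abs_diff_le_rms_gap[OF _ _ \<eta>]) auto
    qed
    also have "\<dots> = 2 * \<eta> * S ?R + (S ?R - (S (\<psi> m) + S (\<psi> n)) / 2) / \<eta>"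
      unfolding S_def using iR im ii by simp
    also have "\<dots> \<le> 2 * \<eta> * B + (sg (d N) - L + d N) / \<eta>"
    proof (intro add_mono mult_left_mono divide_right_mono)
      show "S ?R \<le> B" using R(2) sg_le[OF d, of N] by linarith
      have "L - d N \<le> S (\<psi> m)" "L - d N \<le> S (\<psi> n)"
        using \<psi>(2)[of m] \<psi>(2)[of n] L(2)[of m] L(2)[of n] ddec[OF mn(1)] ddec[OF mn(2)] by linarith+
      then show "S ?R - (S (\<psi> m) + S (\<psi> n)) / 2 \<le> sg (d N) - L + d N" using R(2) by (simp add: field_simps)
    qed (use \<eta> in auto)
    finally show ?thesis .
  qed
  have Cauchy: "\<exists>N. \<forall>m\<ge>N. \<forall>n\<ge>N. (LINT x|\<mu>. norm (\<psi> m x - \<psi> n x)) < e" if e: "e > 0" for e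
  proof -
    \<comment> \<open>\<eta> is fixed first, so that the term with B stays below e; afterwards N
      makes the gap small relative to \<eta>.\<close>
    define \<eta> where "\<eta> = e / (4 * (B + 1))"
    have \<eta>: "\<eta> > 0" using e B0 by (simp add: \<eta>_def)
    have "4 * \<eta> * (B + 1) = e" using B0 by (simp add: \<eta>_def field_simps)
    then have \<eta>B: "2 * \<eta> * B < e" using \<eta> B0 e by (simp add: algebra_simps)
    have "(\<lambda>N. 2 * \<eta> * B + (sg (d N) - L + d N) / \<eta>) \<longlonglongrightarrow> 2 * \<eta> * B + (L - L + 0) / \<eta>"
      using \<eta> by (intro tendsto_intros L dlim) auto
    from order_tendstoD(2)[OF this, of e]
    obtain N where N: "2 * \<eta> * B + (sg (d N) - L + d N) / \<eta> < e"
      using \<eta>B by (auto simp: eventually_sequentially)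
    show ?thesis
    proof (intro exI[of _ N] allI impI)
      fix m n assume "N \<le> m" "N \<le> n"
      from order_le_less_trans[OF est[OF this \<eta>] N]
      show "(LINT x|\<mu>. norm (\<psi> m x - \<psi> n x)) < e" by simp
    qed
  qed
  obtain r u where r: "strict_mono (r :: nat \<Rightarrow> nat)" "u \<in> borel_measurable \<mu>" "AE x in \<mu>. (\<lambda>k. \<psi> (r k) x) \<longlonglongrightarrow> u x"
    using L1_Cauchy_AE_subseq[OF L2_integrable[OF L2] Cauchy] by blast
  have "integrable \<mu> (\<lambda>x. (norm (u x))\<^sup>2)"
  proof (rule integral_Fatou_bound(1)[where h = "\<lambda>k x. (norm (\<psi> (r k) x))\<^sup>2" and N = 0])
    show "integrable \<mu> (\<lambda>x. (norm (\<psi> (r k) x))\<^sup>2)" for k by (rule L2_norm2[OF L2])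
    show "(LINT x|\<mu>. (norm (\<psi> (r k) x))\<^sup>2) \<le> CP * t" for k
      using CP_le[OF T(1,2), of "r k"] by (simp add: ip_self)
    show "AE x in \<mu>. (\<lambda>k. (norm (\<psi> (r k) x))\<^sup>2) \<longlonglongrightarrow> (norm (u x))\<^sup>2"
      using r(3) by eventually_elim (intro tendsto_intros)
    show "(\<lambda>x. (norm (u x))\<^sup>2) \<in> borel_measurable \<mu>" using r(2) by measurable
  qed auto
  then have u: "u \<in> L2 \<Omega>" using r(2) by (simp add: L2_def)
  \<comment> \<open>Fatou's lemma along the subsequence, for the differences from one fixed member,
    gives convergence of the whole sequence.\<close>
  have lim: "(\<lambda>n. LINT x|\<mu>. \<bar>\<psi> n x - u x\<bar>) \<longlonglongrightarrow> 0"
  proof (rule LIMSEQ_I)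
    fix e :: real assume "e > 0"
    then obtain N where N: "\<forall>m\<ge>N. \<forall>n\<ge>N. (LINT x|\<mu>. norm (\<psi> m x - \<psi> n x)) < e / 2"
      using Cauchy[of "e / 2"] by auto
    have half: "(LINT x|\<mu>. \<bar>\<psi> n x - u x\<bar>) \<le> e / 2" if n: "n \<ge> N" for n
    proof (rule integral_Fatou_bound(2)[where h = "\<lambda>k x. \<bar>\<psi> n x - \<psi> (r k) x\<bar>" and N = N])
      show "integrable \<mu> (\<lambda>x. \<bar>\<psi> n x - \<psi> (r k) x\<bar>)" for k by (rule L2_abs[OF L2_diff[OF L2 L2]])
      show "(LINT x|\<mu>. \<bar>\<psi> n x - \<psi> (r k) x\<bar>) \<le> e / 2" if "k \<ge> N" for k
        using N n that strict_mono_imp_increasing[OF r(1), of k] by (auto intro: less_imp_le)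
      show "AE x in \<mu>. (\<lambda>k. \<bar>\<psi> n x - \<psi> (r k) x\<bar>) \<longlonglongrightarrow> \<bar>\<psi> n x - u x\<bar>"
        using r(3) by eventually_elim (intro tendsto_intros)
      show "(\<lambda>x. \<bar>\<psi> n x - u x\<bar>) \<in> borel_measurable \<mu>"
        using L2_abs[OF L2_diff[OF L2 u]] by (rule borel_measurable_integrable)
    qed auto
    have "norm ((LINT x|\<mu>. \<bar>\<psi> n x - u x\<bar>) - 0) < e" if "n \<ge> N" for n
      using half[OF that] \<open>e > 0\<close> by simp
    then show "\<exists>N. \<forall>n\<ge>N. norm ((LINT x|\<mu>. \<bar>\<psi> n x - u x\<bar>) - 0) < e" by blast
  qed
  have "(\<lambda>n. M t - d n) \<longlonglongrightarrow> M t - 0" by (intro tendsto_intros dlim)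
  then have low: "(\<lambda>n. M t - d n) \<longlonglongrightarrow> M t" by simp
  have "M t - d n \<le> G (\<psi> n)" "G (\<psi> n) \<le> M t" for n
    using T(4)[of n] G_le_M[OF T(1,2), of n] by simp_all
  then have "(\<lambda>n. G (\<psi> n)) \<longlonglongrightarrow> M t"
    by (intro real_tendsto_sandwich[OF _ _ low tendsto_const]) simp_all
  then show ?thesis using T(1-3) u lim by (intro exI[of _ \<psi>] exI[of _ u]) simp
qed

section \<open>Positivity and strict growth of the value function\<close>

lemma M_pos:
  assumes t: "t > 0" shows "M t > 0"
proof -
  obtain x0 where "x0 \<in> \<Omega>" using domain_nonempty by blast
  then obtain a c where ac: "cbox a c \<subseteq> \<Omega>" "x0 \<in> box a c"
    using open_contains_cbox[OF open_domain] by metis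
  have \<phi>: "box_bump a c \<in> TF"
    using box_bump_zero box_subset_cbox by (intro test_functionI[OF smooth_box_bump compact_cbox ac(1)]) blast
  have E0: "E (box_bump a c) \<ge> 0" by (rule ip_self_nonneg)
  \<comment> \<open>The scaling brings the Dirichlet integral of the bump function below t; adding 1
    avoids a division by zero.\<close>
  define s where "s = sqrt (t / (E (box_bump a c) + 1))"
  have s: "s > 0" using t E0 by (simp add: s_def)
  have "s\<^sup>2 * E (box_bump a c) \<le> t"
    using t E0 by (simp add: s_def pos_divide_le_eq)
  then have Es: "E (\<lambda>x. s * box_bump a c x) \<le> t" by (simp add: E_cmult[OF \<phi>])
  note T = test_function_cmult[OF \<phi>, of s]
  have "G (\<lambda>x. s * box_bump a c x) \<noteq> 0"
  proof
    assume "G (\<lambda>x. s * box_bump a c x) = 0"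
    moreover have "AE x in \<mu>. 0 \<le> \<alpha> x * F (s * box_bump a c x)"
      using \<alpha>_pos by eventually_elim (simp add: F_nonneg)
    ultimately have "AE x in \<mu>. \<alpha> x * F (s * box_bump a c x) = 0"
      using integral_nonneg_eq_0_iff_AE[OF G_integrable[OF test_L2(1)[OF T]]] by (simp add: G_def)
    then have "AE x in \<mu>. x \<notin> box a c"
      using \<alpha>_pos
    proof eventually_elim
      case (elim x)
      then show ?case using F_strict_mono[of 0 "s * box_bump a c x"] box_bump_pos[of x a c] s F_nonpos[of 0] by auto
    qed
    then have "AE x in lebesgue. x \<notin> box a c"
      using sets_domain ac(1) box_subset_cbox[of a c]
      by (subst (asm) AE_restrict_space_iff) (auto elim!: eventually_mono)
    then have "box a c \<in> null_sets lebesgue"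
      by (subst (asm) AE_iff_null_sets[symmetric]) auto
    then show False
      using open_not_negligible[of "box a c"] ac(2) by (auto simp: negligible_iff_null_sets)
  qed
  then have "0 < G (\<lambda>x. s * box_bump a c x)" using G_nonneg[of "\<lambda>x. s * box_bump a c x"] by linarith
  then show ?thesis using G_le_M[OF T Es] by linarith
qed

text \<open>The L1 limit u of a maximising sequence has \<open>G u = M t\<close>. Multiplying by c >
  1 uses the enlarged budget t + 1 and strictly increases F wherever u is positive. Without an
  increase of M this would force \<open>G u = 0\<close>, against \<open>M_pos\<close>.\<close>

lemma M_strict:
  assumes t: "t > 0" shows "M t < M (t + 1)"
proof (rule ccontr)
  assume "\<not> M t < M (t + 1)"
  then have le: "M (t + 1) \<le> M t" by simp
  obtain \<psi> u where *: "\<forall>n. \<psi> n \<in> TF" "\<forall>n. E (\<psi> n) \<le> t" "\<forall>n x. 0 \<le> \<psi> n x" "(\<lambda>n. G (\<psi> n)) \<longlonglongrightarrow> M t"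
    and u: "u \<in> L2 \<Omega>" "(\<lambda>n. LINT x|\<mu>. \<bar>\<psi> n x - u x\<bar>) \<longlonglongrightarrow> 0"
    using maximising_sequence[OF less_imp_le[OF t]] by blast
  note \<psi> = *(1-3)[rule_format] *(4)
  define c where "c = sqrt ((t + 1) / t)"
  have c: "c > 1" using t by (simp add: c_def)
  have c2: "c\<^sup>2 * t = t + 1" using t by (simp add: c_def)
  have L: "\<psi> n \<in> L2 \<Omega>" for n by (rule test_L2(1)[OF \<psi>(1)])
  have Gu: "G u = M t"
    using G_tendsto[OF L u CP_le[OF \<psi>(1,2)]] \<psi>(4) by (rule LIMSEQ_unique)
  have T: "(\<lambda>x. c * \<psi> n x) \<in> TF" "E (\<lambda>x. c * \<psi> n x) \<le> t + 1" for n
    using test_function_cmult[OF \<psi>(1)] E_cmult[OF \<psi>(1), of c n] mult_left_mono[OF \<psi>(2)[of n], of "c\<^sup>2"] c2 by auto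
  have "(\<lambda>n. LINT x|\<mu>. \<bar>c * \<psi> n x - c * u x\<bar>) \<longlonglongrightarrow> 0"
  proof -
    have "\<bar>c * \<psi> n x - c * u x\<bar> = c * \<bar>\<psi> n x - u x\<bar>" for n x
      using c by (simp add: abs_mult flip: right_diff_distrib)
    then show ?thesis using tendsto_mult_left[OF u(2), of c] by simp
  qed
  from G_tendsto[OF test_L2(1)[OF T(1)] L2_cmult[OF u(1)] this CP_le[OF T]]
  have "G (\<lambda>x. c * u x) \<le> M (t + 1)"
    by (rule LIMSEQ_le_const2) (use G_le_M[OF T] in auto)
  then have "(LINT x|\<mu>. \<alpha> x * F (c * u x) - \<alpha> x * F (u x)) \<le> 0"
    using le Gu G_integrable[OF u(1)] G_integrable[OF L2_cmult[OF u(1), of c]] by (simp add: G_def)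
  moreover have mono: "F y \<le> F (c * y)" for y
  proof (cases "y \<ge> 0")
    case True
    then have "1 * y \<le> c * y" using c by (intro mult_right_mono) auto
    then show ?thesis by (intro F_mono) simp
  qed (simp add: F_nonpos F_nonneg)
  then have nn: "AE x in \<mu>. 0 \<le> \<alpha> x * F (c * u x) - \<alpha> x * F (u x)"
    using \<alpha>_pos by (auto elim!: eventually_mono intro!: mult_left_mono)
  ultimately have "(LINT x|\<mu>. \<alpha> x * F (c * u x) - \<alpha> x * F (u x)) = 0"
    using integral_nonneg_AE[OF nn] by linarith
  then have "AE x in \<mu>. \<alpha> x * F (c * u x) - \<alpha> x * F (u x) = 0"
    using integral_nonneg_eq_0_iff_AE[OF _ nn] G_integrable[OF u(1)] G_integrable[OF L2_cmult[OF u(1), of c]] by simp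
  then have "AE x in \<mu>. \<alpha> x * F (u x) = 0"
    using \<alpha>_pos
  proof eventually_elim
    case (elim x)
    show ?case
    proof (cases "u x > 0")
      case True
      then have "F (u x) < F (c * u x)" using c by (intro F_strict_mono) auto
      then show ?thesis using elim by (simp flip: right_diff_distrib)
    qed (simp add: F_nonpos)
  qed
  then have "G u = 0" unfolding G_def by (simp add: integral_eq_zero_AE)
  then show False using Gu M_pos[OF t] by simp
qed

text \<open>For the midpoint w of two late members, L1 closeness to u0 makes \<open>G w\<close>
  almost \<open>M t\<close>, while the supporting slope gives
  \<open>G w \<le> M t + \<kappa> / 2 * (E w - t)\<close>. Hence \<open>E w\<close> is almost t, and
  by the parallelogram law the two gradients are close. The positive slope thus replaces compactness
  for the gradients.\<close>

lemma minimiser: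
  assumes t: "t > 0" and \<kappa>: "\<kappa> > 0" and slope: "\<And>s. s \<ge> 0 \<Longrightarrow> M s \<le> M t + \<kappa> / 2 * (s - t)"
  obtains u where "u \<in> H10 \<Omega>" "AE x in \<mu>. u x \<ge> 0" "gip u u = t"
    "\<And>v. v \<in> H10 \<Omega> \<Longrightarrow> energy \<Omega> \<kappa> \<alpha> f u \<le> energy \<Omega> \<kappa> \<alpha> f v"
proof -
  obtain \<psi> u0 where *: "\<forall>n. \<psi> n \<in> TF" "\<forall>n. E (\<psi> n) \<le> t" "\<forall>n x. 0 \<le> \<psi> n x" "(\<lambda>n. G (\<psi> n)) \<longlonglongrightarrow> M t"
    and u0: "u0 \<in> L2 \<Omega>" "(\<lambda>n. LINT x|\<mu>. \<bar>\<psi> n x - u0 x\<bar>) \<longlonglongrightarrow> 0"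
    using maximising_sequence[OF less_imp_le[OF t]] by blast
  note \<psi> = *(1-3)[rule_format] *(4)
  have L: "\<psi> n \<in> L2 \<Omega>" and Lg: "gradient (\<psi> n) \<in> L2 \<Omega>" for n by (rule test_L2[OF \<psi>(1)])+
  have sm: "smooth (\<psi> n)" for n by (rule test_function_smooth[OF \<psi>(1)])
  have Gu0: "G u0 = M t"
    using G_tendsto[OF L u0 CP_le[OF \<psi>(1,2)]] \<psi>(4) by (rule LIMSEQ_unique)
  let ?d = "\<lambda>m n. ip (\<lambda>x. gradient (\<psi> m) x - gradient (\<psi> n) x) (\<lambda>x. gradient (\<psi> m) x - gradient (\<psi> n) x)"
  have CauchyE: "\<exists>N. \<forall>m\<ge>N. \<forall>n\<ge>N. ?d m n < e" if e: "e > 0" for e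
  proof -
    define B where "B = max (CP * t) (ip u0 u0)"
    \<comment> \<open>The parallelogram law contributes 1/4 and the slope \<kappa> / 2, which
      together make the threshold \<kappa> e / 8.\<close>
    have "e * \<kappa> / 8 > 0" using e \<kappa> by simp
    from G_uniformly_continuous[OF this, of B]
    obtain \<delta> where \<delta>: "\<delta> > 0" "\<forall>w\<in>L2 \<Omega>. \<forall>v\<in>L2 \<Omega>. ip w w \<le> B \<longrightarrow> ip v v \<le> B \<longrightarrow>
      (LINT x|\<mu>. \<bar>w x - v x\<bar>) < \<delta> \<longrightarrow> \<bar>G w - G v\<bar> < e * \<kappa> / 8" by blast
    obtain N where N: "\<And>n. n \<ge> N \<Longrightarrow> (LINT x|\<mu>. \<bar>\<psi> n x - u0 x\<bar>) < \<delta>"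
      using order_tendstoD(2)[OF u0(2) \<delta>(1)] by (auto simp: eventually_sequentially)
    have "?d m n < e" if mn: "m \<ge> N" "n \<ge> N" for m n
    proof -
      define w where "w = (\<lambda>x. 1/2 * \<psi> m x + 1/2 * \<psi> n x)"
      have w: "w \<in> TF" unfolding w_def by (intro test_function_add test_function_cmult \<psi>)
      have gw: "gradient w = (\<lambda>x. (1/2) *\<^sub>R gradient (\<psi> m) x + (1/2) *\<^sub>R gradient (\<psi> n) x)"
        unfolding w_def by (rule ext) (simp only: gradient_add[OF smooth_cmult[OF sm] smooth_cmult[OF sm]] gradient_cmult[OF sm])
      have par: "E w = 1/2 * E (\<psi> m) + 1/2 * E (\<psi> n) - 1/4 * ?d m n"
        unfolding gw ip_diff_self[OF Lg Lg]
        using ip_add_self[OF L2_scaleR[OF Lg, of "1/2" m] L2_scaleR[OF Lg, of "1/2" n]]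
        by (simp add: ip_scaleR_left ip_scaleR_right field_simps)
      then have Ew: "E w \<le> t - 1/4 * ?d m n" using \<psi>(2)[of m] \<psi>(2)[of n] by linarith
      have Ewt: "E w \<le> t" using Ew ip_self_nonneg[of "\<lambda>x. gradient (\<psi> m) x - gradient (\<psi> n) x"] by linarith
      have "(LINT x|\<mu>. \<bar>w x - u0 x\<bar>) \<le> (LINT x|\<mu>. 1/2 * \<bar>\<psi> m x - u0 x\<bar> + 1/2 * \<bar>\<psi> n x - u0 x\<bar>)"
      proof (rule integral_mono[OF L2_abs[OF L2_diff[OF test_L2(1)[OF w] u0(1)]]])
        show "integrable \<mu> (\<lambda>x. 1/2 * \<bar>\<psi> m x - u0 x\<bar> + 1/2 * \<bar>\<psi> n x - u0 x\<bar>)"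
          using L2_abs[OF L2_diff[OF L u0(1)]] by simp
        show "\<bar>w x - u0 x\<bar> \<le> 1/2 * \<bar>\<psi> m x - u0 x\<bar> + 1/2 * \<bar>\<psi> n x - u0 x\<bar>" for x
          unfolding w_def by (simp add: abs_if field_simps)
      qed
      also have "\<dots> < \<delta>"
        using N[OF mn(1)] N[OF mn(2)] L2_abs[OF L2_diff[OF L u0(1)]] by simp
      finally have "\<bar>G w - G u0\<bar> < e * \<kappa> / 8"
        using CP_le[OF w Ewt] by (intro \<delta>(2)[rule_format] test_L2(1)[OF w] u0(1)) (auto simp: B_def)
      moreover have "G w \<le> M t + \<kappa> / 2 * (E w - t)"
        using G_le_M[OF w order_refl] slope[OF ip_self_nonneg, of "gradient w"] by linarith
      moreover have "\<kappa> / 2 * (E w - t) = - (\<kappa> / 2 * (t - E w))" by (simp add: field_simps)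
      ultimately have "\<kappa> / 2 * (t - E w) < e * \<kappa> / 8"
        using Gu0 by linarith
      moreover have "\<kappa> / 2 * (1/4 * ?d m n) \<le> \<kappa> / 2 * (t - E w)"
        using Ew \<kappa> by (intro mult_left_mono) auto
      ultimately have "\<kappa> * ?d m n < \<kappa> * e" by (simp add: mult.commute)
      then show ?thesis using \<kappa> by simp
    qed
    then show ?thesis by blast
  qed
  obtain g where g: "L2_tendsto (\<lambda>n. gradient (\<psi> n)) g"
    using L2_complete[OF Lg CauchyE] by blast
  have CauchyL: "\<exists>N. \<forall>m\<ge>N. \<forall>n\<ge>N. ip (\<lambda>x. \<psi> m x - \<psi> n x) (\<lambda>x. \<psi> m x - \<psi> n x) < e" if e: "e > 0" for e
  proof -
    obtain N where N: "\<And>m n. m \<ge> N \<Longrightarrow> n \<ge> N \<Longrightarrow> ?d m n < e / CP"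
      using CauchyE[of "e / CP"] e CP_pos by auto
    have "ip (\<lambda>x. \<psi> m x - \<psi> n x) (\<lambda>x. \<psi> m x - \<psi> n x) < e" if "m \<ge> N" "n \<ge> N" for m n
    proof -
      have "gradient (\<lambda>x. \<psi> m x - \<psi> n x) = (\<lambda>x. gradient (\<psi> m) x - gradient (\<psi> n) x)"
        by (rule ext) (rule gradient_diff[OF sm sm])
      then have "ip (\<lambda>x. \<psi> m x - \<psi> n x) (\<lambda>x. \<psi> m x - \<psi> n x) \<le> CP * ?d m n"
        using CP[OF test_function_diff[OF \<psi>(1) \<psi>(1)], of m n] by simp
      also have "\<dots> < e" using N[OF that] CP_pos by (simp add: pos_less_divide_eq mult.commute)
      finally show ?thesis .
    qed
    then show ?thesis by blast
  qed
  obtain u where u: "L2_tendsto \<psi> u"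
    using L2_complete[of \<psi>, OF L CauchyL] by blast
  have uL: "u \<in> L2 \<Omega>" using u by (simp add: L2_tendsto_def)
  note H = H10_closed[OF \<psi>(1) u g]
  have "gL": "g \<in> L2 \<Omega>" using g by (simp add: L2_tendsto_def)
  have wg: "gip u u = ip g g"
    unfolding gip_def by (rule ip_AE_cong[OF gL gL]) (use H(2) in \<open>auto elim!: eventually_mono\<close>)
  have Elim: "(\<lambda>n. E (\<psi> n)) \<longlonglongrightarrow> gip u u" unfolding wg by (rule L2_tendsto_ip[OF g g])
  have Gu: "G u = M t" using G_tendsto_L2[OF u] \<psi>(4) by (rule LIMSEQ_unique)
  have nonneg: "AE x in \<mu>. u x \<ge> 0"
  proof -
    have "(\<lambda>x. max 0 (- u x)) \<in> L2 \<Omega>"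
      by (rule L2_dominated[OF uL]) (use L2_measurable[OF uL] in \<open>auto simp: max_def\<close>)
    note i = L2_integrable[OF this]
    have "(LINT x|\<mu>. \<bar>max 0 (- u x)\<bar>) \<le> (LINT x|\<mu>. \<bar>\<psi> n x - u x\<bar>)" for n
    proof (rule integral_mono[OF _ L2_abs[OF L2_diff[OF L uL]]])
      show "integrable \<mu> (\<lambda>x. \<bar>max 0 (- u x)\<bar>)" using i by simp
      show "\<bar>max 0 (- u x)\<bar> \<le> \<bar>\<psi> n x - u x\<bar>" for x using \<psi>(3)[of n x] by auto
    qed
    then have "(LINT x|\<mu>. \<bar>max 0 (- u x)\<bar>) \<le> 0"
      using L2_tendsto_L1[OF u] by (intro LIMSEQ_le_const[of _ 0]) auto
    from L1_null_imp_AE_eq[OF i this] show ?thesis by eventually_elim auto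
  qed
  \<comment> \<open>A Dirichlet integral below t would, by the slope inequality, keep the values of
    G away from \<open>M t\<close>.\<close>
  have gt: "gip u u = t"
  proof (rule antisym)
    show "gip u u \<le> t" by (rule LIMSEQ_le_const2[OF Elim]) (use \<psi>(2) in auto)
    have "G (\<psi> n) \<le> M t + \<kappa> / 2 * (E (\<psi> n) - t)" for n
      using G_le_M[OF \<psi>(1) order_refl] slope[OF ip_self_nonneg] by (meson order_trans)
    moreover have "(\<lambda>n. M t + \<kappa> / 2 * (E (\<psi> n) - t)) \<longlonglongrightarrow> M t + \<kappa> / 2 * (gip u u - t)"
      by (intro tendsto_intros Elim)
    ultimately have "M t \<le> M t + \<kappa> / 2 * (gip u u - t)"
      using LIMSEQ_le[OF \<psi>(4)] by blast
    then show "t \<le> gip u u" using \<kappa> by (simp add: zero_le_mult_iff)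
  qed
  \<comment> \<open>For test functions this is the supporting inequality at the level of their own
    Dirichlet integral; approximation extends it to \<open>H10\<close>.\<close>
  have min: "1/2 * \<kappa> * t - M t \<le> 1/2 * \<kappa> * gip v v - G v" if v: "v \<in> H10 \<Omega>" for v
  proof -
    obtain \<phi> where \<phi>: "\<And>n. \<phi> n \<in> TF" "L2_tendsto \<phi> v" "L2_tendsto (\<lambda>n. gradient (\<phi> n)) (weak_gradient \<Omega> v)"
      using H10_approx[OF v] by metis
    have "1/2 * \<kappa> * t - M t \<le> 1/2 * \<kappa> * E (\<phi> n) - G (\<phi> n)" for n
      using G_le_M[OF \<phi>(1) order_refl, of n] slope[OF ip_self_nonneg, of "gradient (\<phi> n)"]
      by (simp add: algebra_simps)
    moreover have "(\<lambda>n. 1/2 * \<kappa> * E (\<phi> n) - G (\<phi> n)) \<longlonglongrightarrow> 1/2 * \<kappa> * gip v v - G v"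
      unfolding gip_def by (intro tendsto_intros L2_tendsto_ip \<phi> G_tendsto_L2)
    ultimately show ?thesis by (intro LIMSEQ_le_const[of _ "1/2 * \<kappa> * gip v v - G v"]) auto
  qed
  show ?thesis
    by (rule that[OF H(1) nonneg gt]) (simp only: energy_eq gt Gu min)
qed

section \<open>Minimisers are positive weak solutions\<close>

text \<open>On \<open>{u = 0}\<close> the comparison function \<open>sqrt (u\<^sup>2 + s \<phi>\<^sup>2)\<close> costs at most \<open>s\<close> times a constant in the
  Dirichlet integral, but gains more than that in \<open>G\<close>, because \<open>f \<xi> / \<xi>\<close> is unbounded near \<open>0\<close>.\<close>

lemma minimiser_gain:
  assumes u: "u \<in> H10 \<Omega>" and \<kappa>: "\<kappa> > 0"
    and min: "\<And>v. v \<in> H10 \<Omega> \<Longrightarrow> energy \<Omega> \<kappa> \<alpha> f u \<le> energy \<Omega> \<kappa> \<alpha> f v"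
    and \<phi>: "\<phi> \<in> TF" and s: "s > 0"
  shows "(\<lambda>x. sqrt (1 * (u x)\<^sup>2 + s * (\<phi> x)\<^sup>2)) \<in> L2 \<Omega>"
    and "G (\<lambda>x. sqrt (1 * (u x)\<^sup>2 + s * (\<phi> x)\<^sup>2)) - G u \<le> \<kappa> / 2 * (s * E \<phi>)"
proof -
  obtain \<psi> where \<psi>: "\<And>n. \<psi> n \<in> TF" "L2_tendsto \<psi> u" "L2_tendsto (\<lambda>n. gradient (\<psi> n)) (weak_gradient \<Omega> u)"
    using H10_approx[OF u] by metis
  obtain t where t: "\<And>n. E (\<psi> n) \<le> t" using L2_tendsto_bounded[OF \<psi>(3)] by metis
  have uL: "u \<in> L2 \<Omega>" using \<psi>(2) by (simp add: L2_tendsto_def)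
  have L1: "(\<lambda>n. LINT x|\<mu>. \<bar>\<psi> n x - u x\<bar>) \<longlonglongrightarrow> 0" using L2_tendsto_L1[OF \<psi>(2)] by simp
  have lm: "(0::real) \<le> 1" "0 \<le> s" using s by auto
  note lim = rms_tendsto[OF \<psi>(1) t uL L1 \<phi> lm]
  show R: "(\<lambda>x. sqrt (1 * (u x)\<^sup>2 + s * (\<phi> x)\<^sup>2)) \<in> L2 \<Omega>" by (rule lim(1))
  let ?z = "\<lambda>n. rms 1 s (inverse (real (Suc n))) (\<psi> n) \<phi>"
  \<comment> \<open>The competitor is built from an approximant of u, so that
    \<open>rms_test\<close> bounds its Dirichlet integral; only this inequality is passed to the
    limit.\<close>
  have "1/2 * \<kappa> * gip u u - G u \<le> 1/2 * \<kappa> * (E (\<psi> n) + s * E \<phi>) - G (?z n)" for n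
  proof -
    have e: "inverse (real (Suc n)) > 0" by simp
    note z = rms_test[OF \<psi>(1)[of n] \<phi> lm e]
    have "1/2 * \<kappa> * E (?z n) \<le> 1/2 * \<kappa> * (E (\<psi> n) + s * E \<phi>)"
      using z(2) \<kappa> by (intro mult_left_mono) auto
    then show ?thesis
      using min[OF test_H10[OF z(1)]] unfolding energy_eq gip_test[OF z(1) z(1)] by linarith
  qed
  moreover have "(\<lambda>n. 1/2 * \<kappa> * (E (\<psi> n) + s * E \<phi>) - G (?z n))
      \<longlonglongrightarrow> 1/2 * \<kappa> * (gip u u + s * E \<phi>) - G (\<lambda>x. sqrt (1 * (u x)\<^sup>2 + s * (\<phi> x)\<^sup>2))"
    unfolding gip_def by (intro tendsto_intros L2_tendsto_ip \<psi>(3) lim(3))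
  ultimately have "1/2 * \<kappa> * gip u u - G u \<le> 1/2 * \<kappa> * (gip u u + s * E \<phi>) - G (\<lambda>x. sqrt (1 * (u x)\<^sup>2 + s * (\<phi> x)\<^sup>2))"
    by (intro LIMSEQ_le_const) auto
  then show "G (\<lambda>x. sqrt (1 * (u x)\<^sup>2 + s * (\<phi> x)\<^sup>2)) - G u \<le> \<kappa> / 2 * (s * E \<phi>)"
    by (simp add: algebra_simps)
qed

text \<open>Let P be the integral of \<alpha> \<phi>^2 over the set where u vanishes. Gain against
  cost yields \<open>N * P \<le> \<kappa> * E \<phi>\<close> for every N > 0, so P = 0. For bump
  functions this makes the zero set null in every box.\<close>

lemma minimiser_positive:
  assumes u: "u \<in> H10 \<Omega>" and \<kappa>: "\<kappa> > 0" and nonneg: "AE x in \<mu>. u x \<ge> 0"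
    and min: "\<And>v. v \<in> H10 \<Omega> \<Longrightarrow> energy \<Omega> \<kappa> \<alpha> f u \<le> energy \<Omega> \<kappa> \<alpha> f v"
  shows "AE x in \<mu>. u x > 0"
proof -
  have uL: "u \<in> L2 \<Omega>" by (rule H1_L2[OF H10_H1[OF u]])
  define Z where "Z x = (if u x \<le> 0 then 1 else 0 :: real)" for x
  have Zm: "Z \<in> borel_measurable \<mu>"
    unfolding Z_def using L2_measurable[OF uL] by measurable
  have test: "AE x in \<mu>. u x \<le> 0 \<longrightarrow> \<phi> x = 0" if \<phi>: "\<phi> \<in> TF" for \<phi>
  proof -
    define P where "P = (LINT x|\<mu>. \<alpha> x * (Z x * (\<phi> x)\<^sup>2))"
    have i: "integrable \<mu> (\<lambda>x. \<alpha> x * (Z x * (\<phi> x)\<^sup>2))"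
    proof (rule \<alpha>_mult_integrable, rule Bochner_Integration.integrable_bound[OF L2_square[OF test_L2(1)[OF \<phi>]]])
      show "(\<lambda>x. Z x * (\<phi> x)\<^sup>2) \<in> borel_measurable \<mu>"
        using Zm L2_measurable[OF test_L2(1)[OF \<phi>]] by measurable
    qed (auto simp: Z_def)
    obtain B where B: "B > 0" "\<And>x. \<bar>\<phi> x\<bar> \<le> B" using test_function_bounded[OF \<phi>] by metis
    have bound: "N * P \<le> \<kappa> * E \<phi>" if N: "N > 0" for N
    proof -
      have "eventually (\<lambda>r. f r / r \<ge> N) (at_right 0)"
        using f_singular by (simp add: filterlim_at_top)
      then obtain r0 where r0: "r0 > 0" "\<And>r. 0 < r \<Longrightarrow> r < r0 \<Longrightarrow> f r / r \<ge> N"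
        by (auto simp: eventually_at_right_field)
      \<comment> \<open>With this s the perturbation \<open>sqrt s * \<bar>\<phi> x\<bar>\<close> is
        at most r0 / 2 everywhere, inside the range where the quotient of f is at least N.\<close>
      define s where "s = (r0 / (2 * B))\<^sup>2"
      have s: "s > 0" using r0 B by (simp add: s_def)
      have sq: "sqrt s = r0 / (2 * B)" using r0 B by (simp add: s_def)
      have low: "N * s * (\<phi> x)\<^sup>2 / 2 \<le> F (sqrt s * \<bar>\<phi> x\<bar>)" for x
      proof (cases "\<phi> x = 0")
        case False
        define y where "y = sqrt s * \<bar>\<phi> x\<bar>"
        have y: "y > 0" using False s by (simp add: y_def)
        have "y \<le> sqrt s * B" unfolding y_def using B(2) s by (intro mult_left_mono) auto
        also have "\<dots> < r0" using r0 B by (simp add: sq)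
        finally have "N * y \<le> f y" using r0(2)[OF y] y by (simp add: pos_le_divide_eq)
        then have "y * (N * y) \<le> y * f y" using y by (intro mult_left_mono) auto
        then have "N * y\<^sup>2 / 2 \<le> F y" using F_lower[OF y] by (simp add: power2_eq_square mult.commute mult.left_commute)
        moreover have "y\<^sup>2 = s * (\<phi> x)\<^sup>2" using s by (simp add: y_def power_mult_distrib)
        ultimately show ?thesis by (simp add: y_def mult.assoc)
      qed (simp add: F_nonneg)
      let ?R = "\<lambda>x. sqrt (1 * (u x)\<^sup>2 + s * (\<phi> x)\<^sup>2)"
      note gain = minimiser_gain[OF u \<kappa> min \<phi> s]
      have "N * s / 2 * P \<le> (LINT x|\<mu>. \<alpha> x * F (?R x) - \<alpha> x * F (u x))"
      proof -
        have "(LINT x|\<mu>. N * s / 2 * (\<alpha> x * (Z x * (\<phi> x)\<^sup>2))) \<le> (LINT x|\<mu>. \<alpha> x * F (?R x) - \<alpha> x * F (u x))"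
        proof (rule integral_mono_AE)
          show "integrable \<mu> (\<lambda>x. N * s / 2 * (\<alpha> x * (Z x * (\<phi> x)\<^sup>2)))" using i by (rule integrable_mult_right)
          show "integrable \<mu> (\<lambda>x. \<alpha> x * F (?R x) - \<alpha> x * F (u x))"
            by (rule Bochner_Integration.integrable_diff[OF G_integrable[OF gain(1)] G_integrable[OF uL]])
          show "AE x in \<mu>. N * s / 2 * (\<alpha> x * (Z x * (\<phi> x)\<^sup>2)) \<le> \<alpha> x * F (?R x) - \<alpha> x * F (u x)"
            using nonneg \<alpha>_pos
          proof eventually_elim
            case (elim x)
            show ?case
            proof (cases "u x \<le> 0")
              case True
              then have "u x = 0" using elim by simp
              then have "?R x = sqrt s * \<bar>\<phi> x\<bar>" "F (u x) = 0" by (simp_all add: real_sqrt_mult F_nonpos)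
              moreover have "\<alpha> x * (N * s * (\<phi> x)\<^sup>2 / 2) \<le> \<alpha> x * F (sqrt s * \<bar>\<phi> x\<bar>)"
                using low elim by (intro mult_left_mono) auto
              ultimately show ?thesis using True by (simp add: Z_def mult.commute mult.left_commute)
            next
              case False
              have "sqrt ((u x)\<^sup>2) \<le> ?R x" using s by (intro real_sqrt_le_mono) simp
              then have "F (u x) \<le> F (?R x)" using False by (intro F_mono) simp
              then have "\<alpha> x * F (u x) \<le> \<alpha> x * F (?R x)" using elim by (intro mult_left_mono) auto
              then show ?thesis using False by (simp add: Z_def)
            qed
          qed
        qed
        then show ?thesis unfolding P_def by simp
      qed
      also have "\<dots> = G ?R - G u"
        unfolding G_def by (rule Bochner_Integration.integral_diff[OF G_integrable[OF gain(1)] G_integrable[OF uL]])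
      also have "\<dots> \<le> \<kappa> / 2 * (s * E \<phi>)" by (rule gain(2))
      finally have "s * (N * P) \<le> s * (\<kappa> * E \<phi>)" by (simp add: mult.commute mult.left_commute)
      then show ?thesis using s by simp
    qed
    have "P \<le> 0"
    proof (rule ccontr)
      assume "\<not> P \<le> 0"
      then have P: "P > 0" by simp
      have "0 \<le> \<kappa> * E \<phi>" using \<kappa> ip_self_nonneg[of "gradient \<phi>"] by simp
      then have "((\<kappa> * E \<phi> + 1) / P) * P \<le> \<kappa> * E \<phi>" using P by (intro bound) simp
      then show False using P by simp
    qed
    have nn: "AE x in \<mu>. 0 \<le> \<alpha> x * (Z x * (\<phi> x)\<^sup>2)"
      using \<alpha>_pos by eventually_elim (simp add: Z_def)
    have "P = 0" using \<open>P \<le> 0\<close> integral_nonneg_AE[OF nn] by (simp add: P_def)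
    then have "AE x in \<mu>. \<alpha> x * (Z x * (\<phi> x)\<^sup>2) = 0"
      using integral_nonneg_eq_0_iff_AE[OF i nn] by (simp add: P_def)
    then show ?thesis using \<alpha>_pos by eventually_elim (auto simp: Z_def split: if_splits)
  qed
  show ?thesis
  proof (rule AE_if_AE_boxes[OF open_domain])
    fix a c assume ac: "cbox a c \<subseteq> \<Omega>"
    have "box_bump a c \<in> TF"
      using box_bump_zero box_subset_cbox by (intro test_functionI[OF smooth_box_bump compact_cbox ac]) blast
    from test[OF this] have "AE x in lebesgue. x \<in> \<Omega> \<longrightarrow> u x \<le> 0 \<longrightarrow> box_bump a c x = 0"
      using sets_domain by (subst (asm) AE_restrict_space_iff) auto
    then show "AE x in lebesgue. x \<in> box a c \<longrightarrow> u x > 0"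
    proof eventually_elim
      case (elim x)
      then show ?case using box_bump_pos[of x a c] ac box_subset_cbox[of a c] by fastforce
    qed
  qed
qed

section \<open>The weak equation as the derivative of the energy\<close>

lemma f0_L2:
  assumes u: "u \<in> L2 \<Omega>" shows "(\<lambda>x. f0 (u x)) \<in> L2 \<Omega>"
proof -
  obtain C where C: "C \<ge> 0" "\<And>s. s \<ge> 0 \<Longrightarrow> f s \<le> C + 1 * s" using f_growth[of 1] by auto
  have "(\<lambda>x. C + norm (u x)) \<in> L2 \<Omega>" by (rule L2_add[OF L2_const L2_norm[OF u]])
  then show ?thesis
  proof (rule L2_dominated)
    show "(\<lambda>x. f0 (u x)) \<in> borel_measurable \<mu>" by (rule f0_measurable[OF L2_measurable[OF u]])
    have "\<bar>f0 y\<bar> \<le> \<bar>C + \<bar>y\<bar>\<bar>" for y using C(2)[of "max 0 y"] C(1) f0_nonneg[of y] by simp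
    then show "AE x in \<mu>. norm (f0 (u x)) \<le> norm (C + norm (u x))" by simp
  qed
qed

text \<open>f is unrestricted on negative numbers, where its composition with u could fail to be
  measurable. Since u is positive almost everywhere, f and f0 give the same integrand up to a null
  set.\<close>

lemma reaction_integral:
  assumes u: "u \<in> L2 \<Omega>" and v: "v \<in> L2 \<Omega>" and pos: "AE x in \<mu>. u x > 0"
  shows "integrable \<mu> (\<lambda>x. \<alpha> x * f0 (u x) * v x)"
    and "integrable \<mu> (\<lambda>x. \<alpha> x * f (u x) * v x)"
    and "(LINT x|\<mu>. \<alpha> x * f (u x) * v x) = (LINT x|\<mu>. \<alpha> x * f0 (u x) * v x)"
proof -
  have "integrable \<mu> (\<lambda>x. \<alpha> x * (f0 (u x) * v x))"
    by (rule \<alpha>_mult_integrable[OF L2_mult_integrable[OF f0_L2[OF u] v]])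
  then show i: "integrable \<mu> (\<lambda>x. \<alpha> x * f0 (u x) * v x)" by (simp add: mult.assoc)
  have ae: "AE x in \<mu>. \<alpha> x * f0 (u x) * v x = \<alpha> x * f (u x) * v x"
    using pos by eventually_elim (simp add: max_absorb2)
  have m: "(\<lambda>x. \<alpha> x * f (u x) * v x) \<in> borel_measurable \<mu>"
    by (rule borel_measurable_AE_cong[OF borel_measurable_integrable[OF i] ae])
  show "integrable \<mu> (\<lambda>x. \<alpha> x * f (u x) * v x)"
    by (rule integrable_cong_AE_imp[OF i m ae])
  show "(LINT x|\<mu>. \<alpha> x * f (u x) * v x) = (LINT x|\<mu>. \<alpha> x * f0 (u x) * v x)"
    by (rule integral_cong_AE[OF m borel_measurable_integrable[OF i]]) (use ae in \<open>auto elim!: eventually_mono\<close>)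
qed

text \<open>Dominated convergence of difference quotients. As the steps are at most 1,
  \<open>F_Lipschitz\<close> with slope 1 provides the majorant, a product of two square integrable
  functions.\<close>

lemma G_derivative:
  assumes u: "u \<in> L2 \<Omega>" and v: "v \<in> L2 \<Omega>"
  shows "(\<lambda>n. (G (\<lambda>x. u x + inverse (real (Suc n)) * v x) - G u) * real (Suc n)) \<longlonglongrightarrow> (LINT x|\<mu>. \<alpha> x * f0 (u x) * v x)"
proof -
  obtain C where C: "C \<ge> 0" "\<And>s. s \<ge> 0 \<Longrightarrow> f s \<le> C + 1 * s" using f_growth[of 1] by auto
  define e where "e n = inverse (real (Suc n))" for n
  have e: "0 < e n" "e n \<le> 1" "e n * real (Suc n) = 1" for n by (auto simp: e_def inverse_le_1_iff)
  have uv: "(\<lambda>x. u x + e n * v x) \<in> L2 \<Omega>" for n by (rule L2_add[OF u L2_cmult[OF v]])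
  let ?d = "\<lambda>n x. \<alpha> x * ((F (u x + e n * v x) - F (u x)) * real (Suc n))"
  have eq: "(G (\<lambda>x. u x + e n * v x) - G u) * real (Suc n) = (LINT x|\<mu>. ?d n x)" for n
  proof -
    have "(G (\<lambda>x. u x + e n * v x) - G u) * real (Suc n) = (LINT x|\<mu>. (\<alpha> x * F (u x + e n * v x) - \<alpha> x * F (u x)) * real (Suc n))"
      unfolding G_def using G_integrable[OF uv] G_integrable[OF u] by (simp del: of_nat_Suc)
    then show ?thesis by (simp only: mult.assoc right_diff_distrib left_diff_distrib)
  qed
  have "(\<lambda>n. LINT x|\<mu>. ?d n x) \<longlonglongrightarrow> (LINT x|\<mu>. \<alpha> x * f0 (u x) * v x)"
  proof (rule integral_dominated_convergence[where w = "\<lambda>x. A * (\<bar>v x\<bar> * (C + 2 * \<bar>u x\<bar> + \<bar>v x\<bar>))"])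
    show "(\<lambda>x. \<alpha> x * f0 (u x) * v x) \<in> borel_measurable \<mu>"
      using \<alpha>_measurable f0_measurable[OF L2_measurable[OF u]] L2_measurable[OF v] by measurable
    show "?d n \<in> borel_measurable \<mu>" for n
      using \<alpha>_measurable F_measurable[OF L2_measurable[OF u]] F_measurable[OF L2_measurable[OF uv]] by measurable
    have "(\<lambda>x. C + 2 * \<bar>u x\<bar> + \<bar>v x\<bar>) \<in> L2 \<Omega>"
      using L2_add[OF L2_add[OF L2_const L2_cmult[OF L2_norm[OF u]]] L2_norm[OF v], of C 2] by simp
    then have "integrable \<mu> (\<lambda>x. \<bar>v x\<bar> * (C + 2 * \<bar>u x\<bar> + \<bar>v x\<bar>))"
      using L2_mult_integrable[OF L2_norm[OF v]] by simp
    then show "integrable \<mu> (\<lambda>x. A * (\<bar>v x\<bar> * (C + 2 * \<bar>u x\<bar> + \<bar>v x\<bar>)))" by simp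
    have elim: "(\<lambda>n. e n) \<longlonglongrightarrow> 0" unfolding e_def by (rule LIMSEQ_inverse_real_of_nat)
    have pt: "(\<lambda>n. (F (a + e n * b) - F a) * real (Suc n)) \<longlonglongrightarrow> f0 a * b" for a b
    proof -
      have "((\<lambda>t. F (a + t * b)) has_real_derivative f0 (a + 0 * b) * b) (at 0)"
        by (rule DERIV_chain2[OF F_deriv]) (auto intro!: derivative_eq_intros)
      then have lim: "(\<lambda>t. (F (a + t * b) - F a) / t) \<midarrow>0\<rightarrow> f0 a * b" by (simp add: DERIV_def)
      have "(\<lambda>n. (F (a + e n * b) - F a) / e n) \<longlonglongrightarrow> f0 a * b"
        by (rule filterlim_compose[OF lim], rule filterlim_atI[OF elim]) (use e(1) in \<open>auto intro!: always_eventually simp: less_imp_neq[symmetric]\<close>)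
      then show ?thesis by (simp add: e_def divide_inverse)
    qed
    show "AE x in \<mu>. (\<lambda>n. ?d n x) \<longlonglongrightarrow> \<alpha> x * f0 (u x) * v x"
      using tendsto_mult_left[OF pt] by (simp add: mult.assoc)
    have le: "\<bar>(F (a + e n * b) - F a) * real (Suc n)\<bar> \<le> \<bar>b\<bar> * (C + 2 * \<bar>a\<bar> + \<bar>b\<bar>)" for a b n
    proof -
      have "\<bar>F (a + e n * b) - F a\<bar> \<le> \<bar>a + e n * b - a\<bar> * (C + 1 * (\<bar>a + e n * b\<bar> + \<bar>a\<bar>))"
        by (rule F_Lipschitz[OF _ C]) simp
      also have "\<dots> \<le> (e n * \<bar>b\<bar>) * (C + 2 * \<bar>a\<bar> + \<bar>b\<bar>)"
      proof (intro mult_mono)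
        have "e n * \<bar>b\<bar> \<le> 1 * \<bar>b\<bar>" using e(2) by (intro mult_right_mono) auto
        then have "\<bar>a + e n * b\<bar> \<le> \<bar>a\<bar> + \<bar>b\<bar>"
          using abs_triangle_ineq[of a "e n * b"] e(1)[of n] by (simp add: abs_mult)
        then show "C + 1 * (\<bar>a + e n * b\<bar> + \<bar>a\<bar>) \<le> C + 2 * \<bar>a\<bar> + \<bar>b\<bar>" by simp
      qed (use e(1)[of n] C(1) in \<open>auto simp: abs_mult\<close>)
      finally have "\<bar>F (a + e n * b) - F a\<bar> * real (Suc n) \<le> (e n * \<bar>b\<bar>) * (C + 2 * \<bar>a\<bar> + \<bar>b\<bar>) * real (Suc n)"
        by (intro mult_right_mono) auto
      also have "\<dots> = (e n * real (Suc n)) * (\<bar>b\<bar> * (C + 2 * \<bar>a\<bar> + \<bar>b\<bar>))" by (simp only: ac_simps)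
      finally show ?thesis unfolding e(3) by (simp add: abs_mult)
    qed
    show "AE x in \<mu>. norm (?d n x) \<le> A * (\<bar>v x\<bar> * (C + 2 * \<bar>u x\<bar> + \<bar>v x\<bar>))" for n
      using \<alpha>_bounds
    proof eventually_elim
      case (elim x)
      have "norm (?d n x) = \<alpha> x * \<bar>(F (u x + e n * v x) - F (u x)) * real (Suc n)\<bar>"
        using elim by (simp add: abs_mult)
      also have "\<dots> \<le> A * (\<bar>v x\<bar> * (C + 2 * \<bar>u x\<bar> + \<bar>v x\<bar>))"
        using elim le[of "u x" n "v x"] by (intro mult_mono) auto
      finally show ?case .
    qed
  qed
  then show ?thesis unfolding eq[symmetric] by (simp only: e_def)
qed

text \<open>Minimality along u + e v with e > 0 gives one inequality; the direction -v gives the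
  other.\<close>

lemma minimiser_weak_equation:
  assumes u: "u \<in> H10 \<Omega>" and v: "v \<in> H10 \<Omega>"
    and min: "\<And>v. v \<in> H10 \<Omega> \<Longrightarrow> energy \<Omega> \<kappa> \<alpha> f u \<le> energy \<Omega> \<kappa> \<alpha> f v"
  shows "\<kappa> * gip u v = (LINT x|\<mu>. \<alpha> x * f0 (u x) * v x)"
proof -
  have L: "w \<in> L2 \<Omega>" if "w \<in> H10 \<Omega>" for w using that H10_H1 H1_L2 by blast
  have ge: "(LINT x|\<mu>. \<alpha> x * f0 (u x) * v x) \<le> \<kappa> * gip u v" if v: "v \<in> H10 \<Omega>" for v
  proof -
    define e where "e n = inverse (real (Suc n))" for n
    have e: "0 < e n" "e n * real (Suc n) = 1" for n by (auto simp: e_def)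
    have "(G (\<lambda>x. u x + e n * v x) - G u) * real (Suc n) \<le> \<kappa> * gip u v + 1/2 * \<kappa> * e n * gip v v" for n
    proof -
      have "energy \<Omega> \<kappa> \<alpha> f u \<le> energy \<Omega> \<kappa> \<alpha> f (\<lambda>x. 1 * u x + e n * v x)"
        by (rule min[OF H10_combination[OF u v]])
      then have "G (\<lambda>x. u x + e n * v x) - G u \<le> e n * (\<kappa> * gip u v + 1/2 * \<kappa> * e n * gip v v)"
        unfolding energy_eq gip_combination_self[OF H10_H1[OF u] H10_H1[OF v]]
        by (simp add: algebra_simps power2_eq_square)
      then have "(G (\<lambda>x. u x + e n * v x) - G u) * real (Suc n) \<le> e n * (\<kappa> * gip u v + 1/2 * \<kappa> * e n * gip v v) * real (Suc n)"
        by (intro mult_right_mono) auto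
      also have "\<dots> = (e n * real (Suc n)) * (\<kappa> * gip u v + 1/2 * \<kappa> * e n * gip v v)" by (simp only: ac_simps)
      finally show ?thesis unfolding e(2) by simp
    qed
    moreover have "(\<lambda>n. \<kappa> * gip u v + 1/2 * \<kappa> * e n * gip v v) \<longlonglongrightarrow> \<kappa> * gip u v + 1/2 * \<kappa> * 0 * gip v v"
      unfolding e_def by (intro tendsto_intros LIMSEQ_inverse_real_of_nat)
    ultimately have "(LINT x|\<mu>. \<alpha> x * f0 (u x) * v x) \<le> \<kappa> * gip u v + 1/2 * \<kappa> * 0 * gip v v"
      using G_derivative[OF L[OF u] L[OF v]] unfolding e_def by (intro LIMSEQ_le) auto
    then show ?thesis by simp
  qed
  \<comment> \<open>The summand with weight 0 only fits -v to the two-term form of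
    \<open>H10_combination\<close>.\<close>
  have neg: "(\<lambda>x. (-1) * v x + 0 * v x) \<in> H10 \<Omega>" by (rule H10_combination[OF v v])
  have "gip u (\<lambda>x. (-1) * v x + 0 * v x) = - gip u v"
    using gip_left[OF H10_H1[OF v] H10_H1[OF v] H10_H1[OF u], of "-1" 0] by (simp add: gip_commute)
  then show ?thesis using ge[OF v] ge[OF neg] by simp
qed

section \<open>Weak solutions are minimisers\<close>

text \<open>The weak equation is tested with \<open>\<phi>\<^sup>2 / (q + \<epsilon>)\<close>, where \<open>q\<close> is a nonnegative test function close to \<open>u\<close>.\<close>

lemma Picone_test:
  assumes u: "u \<in> H10 \<Omega>" and nonneg: "AE x in \<mu>. u x \<ge> 0" and \<kappa>: "\<kappa> > 0"
    and eq: "\<And>v. v \<in> H10 \<Omega> \<Longrightarrow> \<kappa> * gip u v = (LINT x|\<mu>. \<alpha> x * f0 (u x) * v x)"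
    and \<phi>: "\<phi> \<in> TF" and \<epsilon>: "\<epsilon> > 0"
  shows "(LINT x|\<mu>. \<alpha> x * f0 (u x) / (max 0 (u x) + \<epsilon>) * (\<phi> x)\<^sup>2) \<le> \<kappa> * E \<phi>"
proof -
  obtain q where q: "\<And>n. q n \<in> TF" "\<And>n x. 0 \<le> q n x" "L2_tendsto q u" "L2_tendsto (\<lambda>n. gradient (q n)) (weak_gradient \<Omega> u)"
    using H10_approx_nonneg[OF u nonneg] by metis
  have sm: "smooth \<phi>" "smooth (q n)" for n using \<phi> q(1) test_function_smooth by blast+
  have uL: "u \<in> L2 \<Omega>" and wL: "weak_gradient \<Omega> u \<in> L2 \<Omega>" using q(3,4) by (auto simp: L2_tendsto_def)
  note gL = test_L2(2)[OF q(1)]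
  obtain B where B: "B > 0" "\<And>x. \<bar>\<phi> x\<bar> \<le> B" "\<And>x. norm (gradient \<phi> x) \<le> B" using test_function_bounded[OF \<phi>] by metis
  \<comment> \<open>Nonnegativity of \<open>q n\<close> keeps the denominator at least \<epsilon>,
    so the quotient is smooth and bounded by 1 / \<epsilon>.\<close>
  define r where "r n x = inverse (q n x + \<epsilon>)" for n x
  have rpos: "0 < r n x" "r n x \<le> 1 / \<epsilon>" for n x
    using q(2)[of n x] \<epsilon> by (auto simp: r_def field_simps)
  have sq: "smooth (\<lambda>x. q n x + \<epsilon>)" for n by (rule smooth_add[OF sm(2) smooth_const])
  have smr: "smooth (r n)" for n
    unfolding r_def[abs_def] by (rule smooth_inverse[OF sq]) (use q(2) \<epsilon> in \<open>auto intro: add_nonneg_pos\<close>)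
  define v where "v n x = (\<phi> x * \<phi> x) * r n x" for n x
  have vT: "v n \<in> TF" for n
    unfolding v_def[abs_def] by (rule test_function_mult[OF test_function_mult[OF \<phi> sm(1)] smr])
  have gr: "gradient (r n) x = - (r n x)\<^sup>2 *\<^sub>R gradient (q n) x" for n x
  proof -
    have "q n x + \<epsilon> \<noteq> 0" using q(2)[of n x] \<epsilon> by linarith
    then have "(inverse has_real_derivative - (r n x)\<^sup>2) (at (q n x + \<epsilon>))"
      using DERIV_inverse[of "q n x + \<epsilon>"] by (simp add: r_def power_inverse numeral_2_eq_2)
    from gradient_compose[OF sq this] show ?thesis
      unfolding r_def[abs_def] gradient_add[OF sm(2) smooth_const] gradient_const by simp
  qed
  have gv: "gradient (v n) x = (2 * \<phi> x * r n x) *\<^sub>R gradient \<phi> x - (\<phi> x * r n x)\<^sup>2 *\<^sub>R gradient (q n) x" for n x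
    unfolding v_def[abs_def] gradient_mult[OF smooth_mult[OF sm(1) sm(1)] smr] gradient_mult[OF sm(1) sm(1)] gr
    by (simp add: algebra_simps power2_eq_square flip: scaleR_add_left)
  \<comment> \<open>Picone's inequality at a point: the missing term is the square of the norm of
    \<nabla>\<phi> - (\<phi> r) \<nabla>q.\<close>
  have picone: "gradient (q n) x \<bullet> gradient (v n) x \<le> (norm (gradient \<phi> x))\<^sup>2" for n x
  proof -
    let ?s = "\<phi> x * r n x"
    have "0 \<le> (norm (gradient \<phi> x - ?s *\<^sub>R gradient (q n) x))\<^sup>2" by simp
    also have "\<dots> = (norm (gradient \<phi> x))\<^sup>2 - gradient (q n) x \<bullet> gradient (v n) x"
      unfolding gv power2_norm_eq_inner
      by (simp add: inner_diff_left inner_diff_right inner_commute power2_eq_square algebra_simps)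
    finally show ?thesis by simp
  qed
  have ipq: "ip (gradient (q n)) (gradient (v n)) \<le> E \<phi>" for n
    unfolding ip_self unfolding ip_def
    by (rule integral_mono[OF L2_inner_integrable[OF gL test_L2(2)[OF vT]] L2_norm2[OF test_L2(2)[OF \<phi>]] picone])
  obtain Q where Q: "\<And>n. E (q n) \<le> Q" using L2_tendsto_bounded[OF q(4)] by metis
  \<comment> \<open>A bound for the Dirichlet integrals of all \<open>v n\<close>, from \<bar>\<phi>
    r\<bar> \<le> B / \<epsilon> and the two terms of \<open>gv\<close>. It makes the error of
    replacing \<nabla>u by the gradient of \<open>q n\<close> tend to 0.\<close>
  define V where "V = 2 * (2 * B * (1/\<epsilon>))\<^sup>2 * E \<phi> + 2 * ((B * (1/\<epsilon>))\<^sup>2)\<^sup>2 * Q"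
  have Ev: "E (v n) \<le> V" for n
  proof -
    have s: "\<bar>\<phi> x * r n x\<bar> \<le> B * (1/\<epsilon>)" for x
      using B(1,2) rpos[of n x] unfolding abs_mult by (intro mult_mono) auto
    have pt: "(norm (gradient (v n) x))\<^sup>2 \<le> 2 * (2 * B * (1/\<epsilon>))\<^sup>2 * (norm (gradient \<phi> x))\<^sup>2 + 2 * ((B * (1/\<epsilon>))\<^sup>2)\<^sup>2 * (norm (gradient (q n) x))\<^sup>2" for x
    proof -
      have "norm (gradient (v n) x) \<le> norm ((2 * \<phi> x * r n x) *\<^sub>R gradient \<phi> x) + norm ((\<phi> x * r n x)\<^sup>2 *\<^sub>R gradient (q n) x)"
        unfolding gv by (rule norm_triangle_ineq4)
      also have "norm ((2 * \<phi> x * r n x) *\<^sub>R gradient \<phi> x) = 2 * \<bar>\<phi> x * r n x\<bar> * norm (gradient \<phi> x)"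
        by (simp add: abs_mult)
      also have "norm ((\<phi> x * r n x)\<^sup>2 *\<^sub>R gradient (q n) x) = \<bar>\<phi> x * r n x\<bar>\<^sup>2 * norm (gradient (q n) x)"
        by simp
      also have "2 * \<bar>\<phi> x * r n x\<bar> * norm (gradient \<phi> x) + \<bar>\<phi> x * r n x\<bar>\<^sup>2 * norm (gradient (q n) x)
          \<le> 2 * (B * (1/\<epsilon>)) * norm (gradient \<phi> x) + (B * (1/\<epsilon>))\<^sup>2 * norm (gradient (q n) x)"
        using s[of x] by (intro add_mono mult_right_mono mult_left_mono power_mono) auto
      finally have "(norm (gradient (v n) x))\<^sup>2 \<le> (2 * (B * (1/\<epsilon>)) * norm (gradient \<phi> x) + (B * (1/\<epsilon>))\<^sup>2 * norm (gradient (q n) x))\<^sup>2"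
        by (rule power_mono) simp
      also have "\<dots> \<le> 2 * (2 * (B * (1/\<epsilon>)) * norm (gradient \<phi> x))\<^sup>2 + 2 * ((B * (1/\<epsilon>))\<^sup>2 * norm (gradient (q n) x))\<^sup>2"
        by (rule power2_sum_le)
      finally show ?thesis by (simp only: power_mult_distrib mult.assoc)
    qed
    have i: "integrable \<mu> (\<lambda>x. (norm (gradient \<phi> x))\<^sup>2)" "integrable \<mu> (\<lambda>x. (norm (gradient (q n) x))\<^sup>2)"
      by (rule L2_norm2[OF test_L2(2)[OF \<phi>]], rule L2_norm2[OF gL])
    have "E (v n) \<le> (LINT x|\<mu>. 2 * (2 * B * (1/\<epsilon>))\<^sup>2 * (norm (gradient \<phi> x))\<^sup>2 + 2 * ((B * (1/\<epsilon>))\<^sup>2)\<^sup>2 * (norm (gradient (q n) x))\<^sup>2)"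
      unfolding ip_self by (rule integral_mono[OF L2_norm2[OF test_L2(2)[OF vT]] _ pt]) (use i in simp)
    also have "\<dots> = 2 * (2 * B * (1/\<epsilon>))\<^sup>2 * E \<phi> + 2 * ((B * (1/\<epsilon>))\<^sup>2)\<^sup>2 * E (q n)"
      unfolding ip_self using i by simp
    also have "\<dots> \<le> V" unfolding V_def using Q[of n] by (intro add_left_mono mult_left_mono) auto
    finally show ?thesis .
  qed
  define d where "d n = sqrt (ip (\<lambda>x. gradient (q n) x - weak_gradient \<Omega> u x) (\<lambda>x. gradient (q n) x - weak_gradient \<Omega> u x))" for n
  have dlim: "d \<longlonglongrightarrow> 0" using L2_tendsto_sqrt[OF q(4)] by (simp add: d_def[abs_def])
  have "gip u (v n) \<le> E \<phi> + d n * sqrt V" for n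
  proof -
    have "\<bar>ip (\<lambda>x. gradient (q n) x - weak_gradient \<Omega> u x) (gradient (v n))\<bar> \<le> d n * sqrt (E (v n))"
      unfolding d_def by (rule ip_Cauchy_Schwarz[OF L2_diff[OF gL wL] test_L2(2)[OF vT]])
    also have "\<dots> \<le> d n * sqrt V"
      using Ev[of n] by (intro mult_left_mono) (auto simp: d_def ip_self_nonneg)
    finally show ?thesis
      using ipq[of n] ip_diff_left[OF gL wL test_L2(2)[OF vT], of n n] gip_H1_test[OF H10_H1[OF u] vT, of n] by linarith
  qed
  then have up: "(LINT x|\<mu>. \<alpha> x * f0 (u x) * v n x) \<le> \<kappa> * (E \<phi> + d n * sqrt V)" for n
    using mult_left_mono[of "gip u (v n)" "E \<phi> + d n * sqrt V" \<kappa>] \<kappa> eq[OF test_H10[OF vT]] by simp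
  \<comment> \<open>The reaction integral is \<open>ip g (r n)\<close> with g fixed in L2. Inversion
    is Lipschitz with constant 1 / \<epsilon>^2 on numbers at least \<epsilon>, so
    \<open>r n\<close> inherits the convergence of \<open>q n\<close>.\<close>
  define g where "g x = \<alpha> x * f0 (u x) * (\<phi> x)\<^sup>2" for x
  have g: "g \<in> L2 \<Omega>"
  proof (rule L2_dominated[OF L2_cmult[OF f0_L2[OF uL], of "A * B\<^sup>2"]])
    show "g \<in> borel_measurable \<mu>"
      unfolding g_def using \<alpha>_measurable f0_measurable[OF L2_measurable[OF uL]] L2_measurable[OF test_L2(1)[OF \<phi>]] by measurable
    show "AE x in \<mu>. norm (g x) \<le> norm (A * B\<^sup>2 * f0 (u x))"
      using \<alpha>_bounds
    proof eventually_elim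
      case (elim x)
      have "(\<phi> x)\<^sup>2 \<le> B\<^sup>2" using power_mono[OF B(2)[of x], of 2] by simp
      then have "\<alpha> x * (\<phi> x)\<^sup>2 \<le> A * B\<^sup>2" using elim by (intro mult_mono) auto
      then have "(\<alpha> x * (\<phi> x)\<^sup>2) * f0 (u x) \<le> (A * B\<^sup>2) * f0 (u x)" using f0_nonneg by (rule mult_right_mono)
      then show ?case using elim A_pos f0_nonneg[of "u x"] by (simp add: g_def abs_mult mult.commute mult.left_commute)
    qed
  qed
  define r0 where "r0 x = inverse (max 0 (u x) + \<epsilon>)" for x
  have r0L: "r0 \<in> L2 \<Omega>"
  proof (rule L2_bounded[where C = "1/\<epsilon>"])
    show "r0 \<in> borel_measurable \<mu>" unfolding r0_def using L2_measurable[OF uL] by measurable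
    show "norm (r0 x) \<le> 1 / \<epsilon>" for x using \<epsilon> by (simp add: r0_def field_simps)
  qed
  have rL: "r n \<in> L2 \<Omega>" for n
    by (rule L2_bounded[where C = "1/\<epsilon>", OF continuous_borel_measurable[OF smooth_continuous[OF smr]]])
      (use rpos in \<open>simp add: less_imp_le\<close>)
  have rlim: "L2_tendsto r r0"
  proof (rule L2_tendsto_dominated[where c = "(1/\<epsilon>) * (1/\<epsilon>)", OF q(3) rL r0L])
    fix n
    show "AE x in \<mu>. norm (r n x - r0 x) \<le> (1/\<epsilon>) * (1/\<epsilon>) * norm (q n x - u x)"
      using nonneg
    proof eventually_elim
      case (elim x)
      have ne: "q n x + \<epsilon> \<noteq> 0" "u x + \<epsilon> \<noteq> 0" using q(2)[of n x] elim \<epsilon> by linarith+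
      have "r n x - r0 x = - (r n x * r0 x) * (q n x - u x)"
        using inverse_diff_inverse[OF ne] elim by (simp add: r_def r0_def max_absorb2 mult.commute mult.left_commute)
      moreover have "\<bar>r n x * r0 x\<bar> \<le> (1/\<epsilon>) * (1/\<epsilon>)"
        unfolding abs_mult using rpos[of n x] elim \<epsilon> by (intro mult_mono) (auto simp: r0_def max_absorb2 field_simps)
      ultimately show ?case
        unfolding real_norm_def by (simp only: abs_mult abs_minus) (rule mult_right_mono, simp_all add: abs_mult)
    qed
  qed
  have "(\<lambda>n. ip g (r n)) \<longlonglongrightarrow> ip g r0" by (rule L2_tendsto_ip[OF L2_tendsto_const[OF g] rlim])
  moreover have "ip g (r n) \<le> \<kappa> * (E \<phi> + d n * sqrt V)" for n
    using up[of n] by (simp add: ip_def g_def v_def power2_eq_square mult.assoc)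
  moreover have "(\<lambda>n. \<kappa> * (E \<phi> + d n * sqrt V)) \<longlonglongrightarrow> \<kappa> * (E \<phi> + 0 * sqrt V)"
    by (intro tendsto_intros dlim)
  ultimately have "ip g r0 \<le> \<kappa> * (E \<phi> + 0 * sqrt V)" by (intro LIMSEQ_le) auto
  moreover have "ip g r0 = (LINT x|\<mu>. \<alpha> x * f0 (u x) / (max 0 (u x) + \<epsilon>) * (\<phi> x)\<^sup>2)"
    unfolding ip_def g_def r0_def by (intro Bochner_Integration.integral_cong) (simp_all add: divide_inverse mult.commute mult.left_commute)
  ultimately show ?thesis by simp
qed

text \<open>With \<epsilon> fixed the weight is bounded, so test functions may tend to v. Then
  \<epsilon> tends to 0, and Fatou's lemma yields the inequality together with integrability of the
  singular quotient, which is not known beforehand.\<close>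

lemma Picone_H10:
  assumes u: "u \<in> H10 \<Omega>" and pos: "AE x in \<mu>. u x > 0" and \<kappa>: "\<kappa> > 0"
    and eq: "\<And>v. v \<in> H10 \<Omega> \<Longrightarrow> \<kappa> * gip u v = (LINT x|\<mu>. \<alpha> x * f0 (u x) * v x)"
    and v: "v \<in> H10 \<Omega>"
  shows "integrable \<mu> (\<lambda>x. \<alpha> x * f0 (u x) / u x * (v x)\<^sup>2)"
    and "(LINT x|\<mu>. \<alpha> x * f0 (u x) / u x * (v x)\<^sup>2) \<le> \<kappa> * gip v v"
proof -
  have L: "u \<in> L2 \<Omega>" "v \<in> L2 \<Omega>" using H1_L2[OF H10_H1] u v by auto
  have nonneg: "AE x in \<mu>. u x \<ge> 0" using pos by eventually_elim simp
  define \<omega> where "\<omega> \<epsilon> x = \<alpha> x * f0 (u x) / (max 0 (u x) + \<epsilon>)" for \<epsilon> x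
  have \<omega>m: "\<omega> \<epsilon> \<in> borel_measurable \<mu>" for \<epsilon>
    unfolding \<omega>_def[abs_def] using \<alpha>_measurable f0_measurable[OF L2_measurable[OF L(1)]] L2_measurable[OF L(1)] by measurable
  obtain C where C: "C \<ge> 0" "\<And>s. s \<ge> 0 \<Longrightarrow> f s \<le> C + 1 * s" using f_growth[of 1] by auto
  have \<omega>0: "AE x in \<mu>. 0 \<le> \<omega> \<epsilon> x" if "\<epsilon> > 0" for \<epsilon>
    using \<alpha>_pos by eventually_elim (use f0_nonneg that in \<open>simp add: \<omega>_def\<close>)
  \<comment> \<open>Growth \<open>f0 \<le> C + max 0 (u x)\<close> divided by
    \<open>max 0 (u x) + \<epsilon>\<close> leaves C / \<epsilon> + 1.\<close>
  have \<omega>_le: "AE x in \<mu>. \<bar>\<omega> \<epsilon> x\<bar> \<le> A * (C / \<epsilon> + 1)" if \<epsilon>: "\<epsilon> > 0" for \<epsilon>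
    using \<alpha>_bounds
  proof eventually_elim
    case (elim x)
    let ?m = "max 0 (u x)"
    have m: "?m + \<epsilon> > 0" using \<epsilon> by (simp add: add_nonneg_pos)
    have "C / \<epsilon> * (?m + \<epsilon>) = C / \<epsilon> * ?m + C" using \<epsilon> by (simp add: field_simps)
    moreover have "0 \<le> C / \<epsilon> * ?m" using C(1) \<epsilon> by simp
    ultimately have "C \<le> C / \<epsilon> * (?m + \<epsilon>)" by linarith
    then have "f0 (u x) \<le> (C / \<epsilon> + 1) * (?m + \<epsilon>)"
      using C(2)[of ?m] \<epsilon> by (simp only: distrib_right) simp
    then have le: "f0 (u x) / (?m + \<epsilon>) \<le> C / \<epsilon> + 1" using m by (simp only: pos_divide_le_eq)
    have "\<bar>\<omega> \<epsilon> x\<bar> = \<alpha> x * (f0 (u x) / (?m + \<epsilon>))"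
      using elim m f0_nonneg[of "u x"] by (simp add: \<omega>_def abs_mult)
    also have "\<dots> \<le> A * (C / \<epsilon> + 1)"
      using elim le m f0_nonneg[of "u x"] A_pos by (intro mult_mono) auto
    finally show ?case .
  qed
  have \<omega>L: "(\<lambda>x. \<omega> \<epsilon> x * w x) \<in> L2 \<Omega>" if "\<epsilon> > 0" and w: "w \<in> L2 \<Omega>" for \<epsilon> and w :: "'a \<Rightarrow> real"
  proof (rule L2_dominated[OF L2_cmult[OF w, of "A * (C / \<epsilon> + 1)"]])
    show "(\<lambda>x. \<omega> \<epsilon> x * w x) \<in> borel_measurable \<mu>" using \<omega>m L2_measurable[OF w] by measurable
    show "AE x in \<mu>. norm (\<omega> \<epsilon> x * w x) \<le> norm (A * (C / \<epsilon> + 1) * w x)"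
      using \<omega>_le[OF that(1)]
    proof eventually_elim
      case (elim x)
      then have "\<bar>\<omega> \<epsilon> x\<bar> \<le> \<bar>A * (C / \<epsilon> + 1)\<bar>" by linarith
      then show ?case unfolding real_norm_def abs_mult[of _ "w x"] by (rule mult_right_mono) simp
    qed
  qed
  have trunc: "(LINT x|\<mu>. \<omega> \<epsilon> x * (v x)\<^sup>2) \<le> \<kappa> * gip v v" if \<epsilon>: "\<epsilon> > 0" for \<epsilon>
  proof -
    obtain \<phi> where \<phi>: "\<And>n. \<phi> n \<in> TF" "L2_tendsto \<phi> v" "L2_tendsto (\<lambda>n. gradient (\<phi> n)) (weak_gradient \<Omega> v)"
      using H10_approx[OF v] by metis
    note \<phi>L = test_L2(1)[OF \<phi>(1)]
    have "L2_tendsto (\<lambda>n x. \<omega> \<epsilon> x * \<phi> n x) (\<lambda>x. \<omega> \<epsilon> x * v x)"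
    proof (rule L2_tendsto_dominated[where c = "A * (C / \<epsilon> + 1)", OF \<phi>(2) \<omega>L[OF \<epsilon> \<phi>L] \<omega>L[OF \<epsilon> L(2)]])
      fix n
      show "AE x in \<mu>. norm (\<omega> \<epsilon> x * \<phi> n x - \<omega> \<epsilon> x * v x) \<le> A * (C / \<epsilon> + 1) * norm (\<phi> n x - v x)"
        using \<omega>_le[OF \<epsilon>]
      proof eventually_elim
        case (elim x)
        then show ?case
          unfolding right_diff_distrib[symmetric] real_norm_def abs_mult by (rule mult_right_mono) simp
      qed
    qed
    from L2_tendsto_ip[OF this \<phi>(2)]
    have "(\<lambda>n. ip (\<lambda>x. \<omega> \<epsilon> x * \<phi> n x) (\<phi> n)) \<longlonglongrightarrow> ip (\<lambda>x. \<omega> \<epsilon> x * v x) v" .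
    moreover have "(\<lambda>n. \<kappa> * E (\<phi> n)) \<longlonglongrightarrow> \<kappa> * gip v v"
      unfolding gip_def by (intro tendsto_intros L2_tendsto_ip \<phi>(3))
    moreover have "ip (\<lambda>x. \<omega> \<epsilon> x * \<phi> n x) (\<phi> n) \<le> \<kappa> * E (\<phi> n)" for n
      using Picone_test[OF u nonneg \<kappa> eq \<phi>(1) \<epsilon>, of n] by (simp add: ip_def \<omega>_def power2_eq_square mult.assoc)
    ultimately have "ip (\<lambda>x. \<omega> \<epsilon> x * v x) v \<le> \<kappa> * gip v v" by (intro LIMSEQ_le) auto
    then show ?thesis by (simp add: ip_def power2_eq_square mult.assoc)
  qed
  define e where "e n = inverse (real (Suc n))" for n
  have e: "e n > 0" for n by (simp add: e_def)
  \<comment> \<open>The absolute value makes the integrands nonnegative everywhere, as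
    \<open>integral_Fatou_bound\<close> asks, and changes nothing almost everywhere.\<close>
  let ?h = "\<lambda>n x. \<bar>\<omega> (e n) x\<bar> * (v x)\<^sup>2"
  have hint: "integrable \<mu> (\<lambda>x. \<omega> (e n) x * (v x)\<^sup>2)" for n
    using L2_mult_integrable[OF \<omega>L[OF e L(2)] L(2), of n] by (simp add: power2_eq_square mult.assoc)
  have h1: "integrable \<mu> (?h n)" for n
    using integrable_norm[OF hint[of n]] by (simp add: abs_mult)
  have h2: "(LINT x|\<mu>. ?h n x) \<le> \<kappa> * gip v v" for n
  proof -
    have "(LINT x|\<mu>. ?h n x) = (LINT x|\<mu>. \<omega> (e n) x * (v x)\<^sup>2)"
    proof (rule integral_cong_AE[OF borel_measurable_integrable[OF h1] borel_measurable_integrable[OF hint]])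
      show "AE x in \<mu>. ?h n x = \<omega> (e n) x * (v x)\<^sup>2" using \<omega>0[OF e, of n] by eventually_elim simp
    qed
    then show ?thesis using trunc[OF e, of n] by simp
  qed
  have h3: "AE x in \<mu>. (\<lambda>n. ?h n x) \<longlonglongrightarrow> \<alpha> x * f0 (u x) / u x * (v x)\<^sup>2"
    using pos \<alpha>_pos
  proof eventually_elim
    case (elim x)
    have "(\<lambda>n. \<bar>\<alpha> x * f0 (u x) / (max 0 (u x) + e n)\<bar> * (v x)\<^sup>2) \<longlonglongrightarrow> \<bar>\<alpha> x * f0 (u x) / (max 0 (u x) + 0)\<bar> * (v x)\<^sup>2"
      unfolding e_def by (intro tendsto_intros LIMSEQ_inverse_real_of_nat) (use elim in simp)
    then show ?case using elim f0_nonneg[of "u x"] by (simp add: \<omega>_def max_absorb2 abs_mult)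
  qed
  have h4: "(\<lambda>x. \<alpha> x * f0 (u x) / u x * (v x)\<^sup>2) \<in> borel_measurable \<mu>"
    using \<alpha>_measurable f0_measurable[OF L2_measurable[OF L(1)]] L2_measurable[OF L(1)] L2_measurable[OF L(2)] by measurable
  show "integrable \<mu> (\<lambda>x. \<alpha> x * f0 (u x) / u x * (v x)\<^sup>2)"
    by (rule integral_Fatou_bound(1)[where h = ?h and N = 0, OF h1 _ h2 h3 h4]) simp
  show "(LINT x|\<mu>. \<alpha> x * f0 (u x) / u x * (v x)\<^sup>2) \<le> \<kappa> * gip v v"
    by (rule integral_Fatou_bound(2)[where h = ?h and N = 0, OF h1 _ h2 h3 h4]) simp
qed

text \<open>Q is \<alpha> times the gap in the tangent inequality for F at u, hence nonnegative.
  Picone bounds its first term by half of \<open>\<kappa> * gip v v\<close>, and the equation tested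
  with u identifies the second with half of \<open>\<kappa> * gip u u\<close>, so the integral of Q
  is at most the energy difference. Equal energies force Q = 0, and strictness of the tangent
  inequality gives v = u.\<close>

lemma weak_solution_minimises:
  assumes u: "u \<in> H10 \<Omega>" and pos: "AE x in \<mu>. u x > 0" and \<kappa>: "\<kappa> > 0"
    and eq: "\<And>v. v \<in> H10 \<Omega> \<Longrightarrow> \<kappa> * gip u v = (LINT x|\<mu>. \<alpha> x * f0 (u x) * v x)"
    and v: "v \<in> H10 \<Omega>"
  shows "energy \<Omega> \<kappa> \<alpha> f u \<le> energy \<Omega> \<kappa> \<alpha> f v"
    and "energy \<Omega> \<kappa> \<alpha> f v \<le> energy \<Omega> \<kappa> \<alpha> f u \<Longrightarrow> AE x in \<mu>. v x = u x"
proof -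
  have L: "u \<in> L2 \<Omega>" "v \<in> L2 \<Omega>" using H1_L2[OF H10_H1] u v by auto
  note P = Picone_H10[OF u pos \<kappa> eq v]
  note R = reaction_integral(1)[OF L(1) L(1) pos]
  note iu = G_integrable[OF L(1)] and iv = G_integrable[OF L(2)]
  define Q where "Q x = 1/2 * (\<alpha> x * f0 (u x) / u x * (v x)\<^sup>2) - 1/2 * (\<alpha> x * f0 (u x) * u x) - (\<alpha> x * F (v x) - \<alpha> x * F (u x))" for x
  have Qint: "integrable \<mu> Q"
    unfolding Q_def using P(1) R iu iv by (intro Bochner_Integration.integrable_diff integrable_mult_right)
  have "(LINT x|\<mu>. Q x) = 1/2 * (LINT x|\<mu>. \<alpha> x * f0 (u x) / u x * (v x)\<^sup>2) - 1/2 * (LINT x|\<mu>. \<alpha> x * f0 (u x) * u x) - (G v - G u)"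
    unfolding Q_def G_def
    by (simp only: Bochner_Integration.integral_diff[OF iv iu]
        Bochner_Integration.integral_diff[OF integrable_mult_right[OF P(1)] integrable_mult_right[OF R]]
        Bochner_Integration.integral_diff[OF Bochner_Integration.integrable_diff[OF integrable_mult_right[OF P(1)] integrable_mult_right[OF R]] Bochner_Integration.integrable_diff[OF iv iu]]
        integral_mult_right_zero)
  then have energy: "(LINT x|\<mu>. Q x) \<le> energy \<Omega> \<kappa> \<alpha> f v - energy \<Omega> \<kappa> \<alpha> f u"
    unfolding energy_eq using P(2) eq[OF u] by (simp add: algebra_simps)
  have Qx: "Q x = \<alpha> x * (f (u x) / (2 * u x) * ((v x)\<^sup>2 - (u x)\<^sup>2) - (F (v x) - F (u x)))" if "u x > 0" for x
    using that by (simp add: Q_def max_absorb2 field_simps power2_eq_square)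
  have nn: "AE x in \<mu>. 0 \<le> Q x"
    using pos \<alpha>_pos
  proof eventually_elim
    case (elim x)
    show ?case unfolding Qx[OF elim(1)] using F_tangent[OF elim(1), of "v x"] elim(2) by (intro mult_nonneg_nonneg) auto
  qed
  show "energy \<Omega> \<kappa> \<alpha> f u \<le> energy \<Omega> \<kappa> \<alpha> f v"
    using energy integral_nonneg_AE[OF nn] by linarith
  assume "energy \<Omega> \<kappa> \<alpha> f v \<le> energy \<Omega> \<kappa> \<alpha> f u"
  then have "(LINT x|\<mu>. Q x) = 0" using energy integral_nonneg_AE[OF nn] by linarith
  then have "AE x in \<mu>. Q x = 0" using integral_nonneg_eq_0_iff_AE[OF Qint nn] by simp
  then show "AE x in \<mu>. v x = u x"
    using pos \<alpha>_pos
  proof eventually_elim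
    case (elim x)
    show ?case
    proof (rule ccontr)
      assume "v x \<noteq> u x"
      from F_tangent_less[OF elim(2) this] show False using elim(1,3) unfolding Qx[OF elim(2)] by simp
    qed
  qed
qed

lemma weak_solution_iff:
  "weak_solution \<Omega> K I \<alpha> f u \<longleftrightarrow> u \<in> H10 \<Omega> \<and> (AE x in \<mu>. u x > 0) \<and> gip u u \<in> I \<and>
     (\<forall>v\<in>H10 \<Omega>. K (gip u u) * gip u v = (LINT x|\<mu>. \<alpha> x * f0 (u x) * v x))"
proof (cases "u \<in> H10 \<Omega> \<and> (AE x in \<mu>. u x > 0)")
  case True
  have "u \<in> L2 \<Omega>" using True H10_H1 H1_L2 by blast
  moreover have "v \<in> L2 \<Omega>" if "v \<in> H10 \<Omega>" for v using that H10_H1 H1_L2 by blast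
  ultimately have "integrable \<mu> (\<lambda>x. \<alpha> x * f (u x) * v x)"
    "(LINT x|\<mu>. \<alpha> x * f (u x) * v x) = (LINT x|\<mu>. \<alpha> x * f0 (u x) * v x)" if "v \<in> H10 \<Omega>" for v
    using reaction_integral(2,3)[of u v] True that by auto
  then show ?thesis
    using True by (auto simp: weak_solution_def dirichlet_gip gip_def ip_def)
next
  case False
  then show ?thesis by (auto simp: weak_solution_def)
qed

end

section \<open>Existence and uniqueness of the solution\<close>

theorem theorem2p2:
  fixes \<Omega> :: "'a::euclidean_space set"
    and K :: "real \<Rightarrow> real" and I :: "real set"
    and f :: "real \<Rightarrow> real" and \<alpha> :: "'a \<Rightarrow> real"
  assumes "smooth_bounded_domain \<Omega>"
    and "open I" and "is_interval I" and "I \<subseteq> {0<..}"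
    and "strict_mono_on I K" and "K ` I = {0<..}"
    and "continuous_on {0..} f" and "\<And>\<xi>. \<xi> \<ge> 0 \<Longrightarrow> f \<xi> \<ge> 0" and "f 0 = 0"
    and "strict_antimono_on {0<..} (\<lambda>\<xi>. f \<xi> / \<xi>)"
    and "((\<lambda>\<xi>. f \<xi> / \<xi>) \<longlongrightarrow> 0) at_top"
    and "filterlim (\<lambda>\<xi>. f \<xi> / \<xi>) at_top (at_right 0)"
    and "\<alpha> \<in> Linf \<Omega>" and "AE x in lebesgue_on \<Omega>. \<alpha> x > 0"
  shows "\<exists>u. weak_solution \<Omega> K I \<alpha> f u \<and>
      (\<forall>w. weak_solution \<Omega> K I \<alpha> f w \<longrightarrow> (AE x in lebesgue_on \<Omega>. w x = u x)) \<and>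
      (\<forall>v\<in>H10 \<Omega>. energy \<Omega> (K (dirichlet \<Omega> u)) \<alpha> f u \<le> energy \<Omega> (K (dirichlet \<Omega> u)) \<alpha> f v) \<and>
      (\<forall>w\<in>H10 \<Omega>.
         (\<forall>v\<in>H10 \<Omega>. energy \<Omega> (K (dirichlet \<Omega> u)) \<alpha> f w \<le> energy \<Omega> (K (dirichlet \<Omega> u)) \<alpha> f v)
         \<longrightarrow> (AE x in lebesgue_on \<Omega>. w x = u x))"
proof -
  interpret sublinear_problem \<Omega> f \<alpha>
    by unfold_locales (use assms in \<open>auto simp: smooth_bounded_domain_def\<close>)
  have Kpos: "K t > 0" if "t \<in> I" for t using that assms(6) by auto
  obtain t where t: "t \<in> I" "\<And>s. s \<ge> 0 \<Longrightarrow> M s \<le> M t + K t / 2 * (s - t)"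
    using concave_supporting_slope[OF assms(2-6) M_concave M_nonneg[OF order_refl] M_strict] by blast
  have t0: "t > 0" using t(1) assms(4) by auto
  obtain u where u: "u \<in> H10 \<Omega>" "AE x in \<mu>. u x \<ge> 0" "gip u u = t"
    and min: "\<And>v. v \<in> H10 \<Omega> \<Longrightarrow> energy \<Omega> (K t) \<alpha> f u \<le> energy \<Omega> (K t) \<alpha> f v"
    using minimiser[OF t0 Kpos[OF t(1)] t(2)] by blast
  have upos: "AE x in \<mu>. u x > 0"
    by (rule minimiser_positive[OF u(1) Kpos[OF t(1)] u(2) min])
  have ueq: "K t * gip u v = (LINT x|\<mu>. \<alpha> x * f0 (u x) * v x)" if "v \<in> H10 \<Omega>" for v
    by (rule minimiser_weak_equation[OF u(1) that min])
  have sol: "weak_solution \<Omega> K I \<alpha> f u"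
    unfolding weak_solution_iff using u upos ueq t(1) by simp
  have unique: "AE x in \<mu>. w x = u x" if w: "weak_solution \<Omega> K I \<alpha> f w" for w
  proof -
    have w': "w \<in> H10 \<Omega>" "AE x in \<mu>. w x > 0" "gip w w \<in> I"
      and weq: "\<And>v. v \<in> H10 \<Omega> \<Longrightarrow> K (gip w w) * gip w v = (LINT x|\<mu>. \<alpha> x * f0 (w x) * v x)"
      using w unfolding weak_solution_iff by auto
    have wu: "energy \<Omega> (K (gip w w)) \<alpha> f w \<le> energy \<Omega> (K (gip w w)) \<alpha> f u"
      by (rule weak_solution_minimises(1)[OF w'(1,2) Kpos[OF w'(3)] weq u(1)])
    have uw: "energy \<Omega> (K t) \<alpha> f u \<le> energy \<Omega> (K t) \<alpha> f w"
      by (rule min[OF w'(1)])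
    \<comment> \<open>The values of G cancel in the sum of the two inequalities.\<close>
    have "(K (gip w w) - K t) * (gip w w - t) \<le> 0"
      using wu uw unfolding energy_eq u(3) by (simp add: algebra_simps)
    then have "gip w w = t"
      using strict_mono_onD[OF assms(5) w'(3) t(1)] strict_mono_onD[OF assms(5) t(1) w'(3)]
      by (cases "gip w w" t rule: linorder_cases) (auto simp: mult_le_0_iff)
    \<comment> \<open>The levels agree, so \<open>wu\<close> now compares energies with the same
      coefficient \<open>K t\<close>, and the equality case applies to w.\<close>
    then show ?thesis
      using weak_solution_minimises(2)[OF u(1) upos Kpos[OF t(1)] ueq w'(1)] wu by simp
  qed
  have "AE x in \<mu>. w x = u x"
    if "w \<in> H10 \<Omega>" "\<forall>v\<in>H10 \<Omega>. energy \<Omega> (K t) \<alpha> f w \<le> energy \<Omega> (K t) \<alpha> f v" for w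
    using weak_solution_minimises(2)[OF u(1) upos Kpos[OF t(1)] ueq that(1)] that(2) u(1) by blast
  then show ?thesis
    using sol unique min by (intro exI[of _ u]) (simp add: dirichlet_gip u(3))
qed

end
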